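(* Every subcubic outerplanar graph is $(1^2,2^2,3)$-packing edge-colorable, that is, has a $(1,1,2,2,3)$-packing edge-coloring.
   Context: Graphs are finite and simple. A graph is subcubic if its maximum degree is at most $3$. The distance between two distinct edges of a graph $G$ is their distance in the line graph of $G$, so edges sharing an endpoint are at distance $1$ (edges in different components are at infinite distance). For a non-decreasing sequence $S=(s_1,\dots,s_k)$ of positive integers, an $S$-packing edge-coloring ($S$-coloring) of $G$ is a partition of $E(G)$ into (possibly empty) classes $E_1,\dots,E_k$ such that for each $i$ any two distinct edges in $E_i$ are at distance at least $s_i+1$. Exponents denote repetition: $(1^2,2^2,3)=(1,1,2,2,3)$. *)

theory Defs
  imports "HOL-Analysis.Analysis" "HOL-Library.Extended_Nat" "HOL-Library.Disjoint_Sets"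
begin

definition simple_graph :: "'a set \<Rightarrow> 'a set set \<Rightarrow> bool" where
  "simple_graph V E \<longleftrightarrow> finite V \<and> E \<subseteq> {e. e \<subseteq> V \<and> card e = 2}"

definition degree :: "'a set set \<Rightarrow> 'a \<Rightarrow> nat" where
  "degree E v = card {e \<in> E. v \<in> e}"

definition subcubic :: "'a set \<Rightarrow> 'a set set \<Rightarrow> bool" where
  "subcubic V E \<longleftrightarrow> (\<forall>v\<in>V. degree E v \<le> 3)"

text \<open>
  A plane drawing is given by the points \<open>p v\<close> and the arcs \<open>g e\<close> (injective paths): distinct
  vertices are distinct points, the arc of an edge joins the points of its two ends and contains no
  other vertex, and two arcs meet at most in the point of a common end.
\<close>

definition plane_drawing ::
    "'a set \<Rightarrow> 'a set set \<Rightarrow> ('a \<Rightarrow> complex) \<Rightarrow> ('a set \<Rightarrow> real \<Rightarrow> complex) \<Rightarrow> bool" where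
  "plane_drawing V E p g \<longleftrightarrow>
     inj_on p V \<and>
     (\<forall>e\<in>E. arc (g e) \<and> {pathstart (g e), pathfinish (g e)} = p ` e \<and>
            path_image (g e) \<inter> p ` V = p ` e) \<and>
     (\<forall>e\<in>E. \<forall>f\<in>E. e \<noteq> f \<longrightarrow> path_image (g e) \<inter> path_image (g f) = p ` (e \<inter> f))"

definition drawing_image ::
    "'a set \<Rightarrow> 'a set set \<Rightarrow> ('a \<Rightarrow> complex) \<Rightarrow> ('a set \<Rightarrow> real \<Rightarrow> complex) \<Rightarrow> complex set" where
  "drawing_image V E p g = p ` V \<union> (\<Union>e\<in>E. path_image (g e))"

text \<open>
  The image of a drawing of a finite graph is compact, so its \<^const>\<open>outside\<close> is the outer face,
  the only unbounded component of the complement.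
\<close>

definition outerplanar :: "'a set \<Rightarrow> 'a set set \<Rightarrow> bool" where
  "outerplanar V E \<longleftrightarrow>
     (\<exists>p g. plane_drawing V E p g \<and>
            (\<forall>v\<in>V. p v \<in> frontier (outside (drawing_image V E p g))))"

definition line_graph :: "'a set set \<Rightarrow> ('a set \<times> 'a set) set" where
  "line_graph E = {(e, f). e \<in> E \<and> f \<in> E \<and> e \<noteq> f \<and> e \<inter> f \<noteq> {}}"

text \<open>
  The least length of a walk from \<open>x\<close> to \<open>y\<close> along the adjacency relation \<open>R\<close>; the infimum of the
  empty set is \<open>\<infinity>\<close>.
\<close>

definition graph_dist :: "('b \<times> 'b) set \<Rightarrow> 'b \<Rightarrow> 'b \<Rightarrow> enat" where
  "graph_dist R x y = (INF n\<in>{n. (x, y) \<in> R ^^ n}. enat n)"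

definition edge_dist :: "'a set set \<Rightarrow> 'a set \<Rightarrow> 'a set \<Rightarrow> enat" where
  "edge_dist E e f = graph_dist (line_graph E) e f"

text \<open>
  The sequence \<open>S\<close> is a list, so positions are counted from 0: the class \<open>C i\<close> belongs to the
  entry \<open>S ! i\<close>. Classes may be empty.
\<close>

definition packing_edge_coloring :: "'a set set \<Rightarrow> nat list \<Rightarrow> (nat \<Rightarrow> 'a set set) \<Rightarrow> bool" where
  "packing_edge_coloring E S C \<longleftrightarrow>
     (\<Union>i<length S. C i) = E \<and>
     disjoint_family_on C {..<length S} \<and>
     (\<forall>i<length S. \<forall>e\<in>C i. \<forall>f\<in>C i. e \<noteq> f \<longrightarrow> edge_dist E e f \<ge> enat (S ! i + 1))"

definition packing_edge_colorable :: "'a set set \<Rightarrow> nat list \<Rightarrow> bool" where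
  "packing_edge_colorable E S \<longleftrightarrow> (\<exists>C. packing_edge_coloring E S C)"

end

theory Submission
  imports Defs
begin

text \<open>
  Colour \<open>Xi\<close> stands for the \<open>i\<close>-th class of the sequence. By the theta-curve theorem an outerplanar drawing contains
  no three internally disjoint paths with inner vertices between the same two vertices (no \<open>K\<^sub>2\<^sub>,\<^sub>3\<close>) and no
  cycle with two crossing chords (no \<open>K\<^sub>4\<close>). Hence, relative to an inclusion-maximal cycle through a given vertex of a connected
  subcubic outerplanar graph, every other edge is a chord or belongs to a part that hangs on the cycle by a single bridge,
  and the chords are disjoint and noncrossing. So the graph is assembled from \<^emph>\<open>words\<close>, the pieces
  between two vertices of the cycle, which grow at one end by a vertex with a bridge or by another word closed up by a chord.

  Whether colourings of two pieces fit together depends only on the colours up to distance two from the common vertex.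
  For each kind of piece a short list of pairs of such boundary conditions, all of which can be realised, is preserved when the
  pieces are assembled; this is a finite computation. The colour \<open>X4\<close> is indispensable: some subcubic
  outerplanar graphs with an 11-cycle have no \<open>(1,1,2,2)\<close>-packing edge-colouring.
\<close>

section \<open>Theta curves in outerplanar drawings\<close>

text \<open>What the induction carries along is that a piece realises every entry of a fixed list.
  When two pieces meet, an entry can be chosen freely from each list, so whether a prescribed entry
  of the new list can be reached is a property of the lists alone. Words need pairs of legs: a word
  grows at its right end while its left end waits for the edge that closes a cycle, and what is
  chosen at one end may restrict the other. On a short word both ends even see the same edges. As no
  radius exceeds 2, an edge added at distance 3 or more from the left end leaves the condition there
  untouched, so only the distances 1, 2 and at least 3 of the ends are told apart. Triangles are an
  exception to the rule for closing up a word, because an edge at one end is there also next to the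
  other. Roots of degree at most two suffice for the induction: that is what is left at the inner
  end of a bridge once the bridge is deleted. A component as a whole may lack such a root; its cycle
  is then cut open at a vertex without a chord, which exists because a shortest chord has such a
  vertex below it.\<close>

lemma arcs_loop:
  fixes p q :: "real \<Rightarrow> complex"
  assumes "arc p" "arc q" "pathstart p = a" "pathfinish p = b" "pathstart q = a" "pathfinish q = b"
    and "path_image p \<inter> path_image q = {a, b}"
  shows "simple_path (p +++ reversepath q)"
    and "pathfinish (p +++ reversepath q) = pathstart (p +++ reversepath q)"
    and "path_image (p +++ reversepath q) = path_image p \<union> path_image q"
proof -
  show "simple_path (p +++ reversepath q)"
  proof (rule simple_path_join_loop)
    show "arc p" "arc (reversepath q)" using assms(1,2) by (simp_all add: arc_reversepath)
    show "path_image p \<inter> path_image (reversepath q) \<subseteq> {pathstart p, pathstart (reversepath q)}"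
      using assms by simp
  qed (use assms in simp_all)
  show "pathfinish (p +++ reversepath q) = pathstart (p +++ reversepath q)"
    using assms by simp
  show "path_image (p +++ reversepath q) = path_image p \<union> path_image q"
    using assms by (simp add: path_image_join)
qed

text \<open>Enlarging a set shrinks its \<open>outside\<close>, so the open set
  \<open>inside J\<close> misses \<open>outside D\<close> and hence also its closure. All that the
  proof draws from the outer face condition passes through this fact: no cycle of the drawing
  encloses a vertex.\<close>

lemma frontier_outside_not_inside:
  fixes D J :: "complex set"
  assumes "z \<in> frontier (outside D)" "J \<subseteq> D" "open (inside J)"
  shows "z \<notin> inside J"
proof
  assume z: "z \<in> inside J"
  have "inside J \<inter> outside D = {}"
    using outside_mono[OF assms(2)] inside_Int_outside[of J] by blast
  then have "inside J \<inter> closure (outside D) = {}"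
    using open_Int_closure_eq_empty[OF assms(3)] by blast
  then show False using z assms(1) by (auto simp: frontier_def)
qed

locale theta_arcs =
  fixes p q r :: "real \<Rightarrow> complex" and a b :: complex
  assumes p: "arc p" "pathstart p = a" "pathfinish p = b"
    and q: "arc q" "pathstart q = a" "pathfinish q = b"
    and r: "arc r" "pathstart r = a" "pathfinish r = b"
    and pq: "path_image p \<inter> path_image q = {a, b}"
    and pr: "path_image p \<inter> path_image r = {a, b}"
    and qr: "path_image q \<inter> path_image r = {a, b}"
begin

lemma permuted: "theta_arcs p r q a b" "theta_arcs q r p a b"
  using p q r pq pr qr by (unfold_locales; simp add: Int_commute)+

text \<open>Without its ends \<open>r\<close> is connected and misses the closed curve formed by
  \<open>p\<close> and \<open>q\<close>, so it stays on one side of it.\<close>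

lemma arc_inside_dichotomy:
  shows "path_image r - {a, b} \<subseteq> inside (path_image p \<union> path_image q) \<or>
    path_image r \<inter> inside (path_image p \<union> path_image q) = {}"
proof -
  let ?J = "path_image p \<union> path_image q"
  note L = Jordan_inside_outside[OF arcs_loop(1,2)[OF p(1) q(1) p(2,3) q(2,3) pq], unfolded arcs_loop(3)[OF p(1) q(1) p(2,3) q(2,3) pq]]
  have op: "open (inside ?J)" "open (outside ?J)" using L by metis+
  have con: "connected (path_image r - {a, b})"
    using connected_simple_path_endless[OF arc_imp_simple_path[OF r(1)]] r(2,3) by metis
  have "inside ?J \<union> outside ?J = - ?J" by (rule inside_Un_outside)
  then have sub: "path_image r - {a, b} \<subseteq> inside ?J \<union> outside ?J"
    using pr qr by blast
  have disj: "inside ?J \<inter> outside ?J \<inter> (path_image r - {a, b}) = {}" by simp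
  have ab: "a \<notin> inside ?J" "b \<notin> inside ?J"
    using pq inside_no_overlap[of ?J] by blast+
  have "inside ?J \<inter> (path_image r - {a, b}) = {} \<or> outside ?J \<inter> (path_image r - {a, b}) = {}"
    by (rule connectedD[OF con op disj sub])
  then show ?thesis
    using sub ab by blast
qed

text \<open>Otherwise a point inside the first curve lies outside the two curves through
  \<open>r\<close>, and Janiszewski's theorem joins it to the unbounded face in the complement of
  all three arcs.\<close>

lemma theta_one_inside:
  shows "path_image r - {a, b} \<subseteq> inside (path_image p \<union> path_image q) \<or>
    path_image q - {a, b} \<subseteq> inside (path_image p \<union> path_image r) \<or>
    path_image p - {a, b} \<subseteq> inside (path_image q \<union> path_image r)"
proof (rule ccontr)
  let ?P = "path_image p" and ?Q = "path_image q" and ?R = "path_image r"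
  assume neg: "\<not> ?thesis"
  note Lpq = Jordan_inside_outside[OF arcs_loop(1,2)[OF p(1) q(1) p(2,3) q(2,3) pq], unfolded arcs_loop(3)[OF p(1) q(1) p(2,3) q(2,3) pq]]
  note Lpr = Jordan_inside_outside[OF arcs_loop(1,2)[OF p(1) r(1) p(2,3) r(2,3) pr], unfolded arcs_loop(3)[OF p(1) r(1) p(2,3) r(2,3) pr]]
  note Lqr = Jordan_inside_outside[OF arcs_loop(1,2)[OF q(1) r(1) q(2,3) r(2,3) qr], unfolded arcs_loop(3)[OF q(1) r(1) q(2,3) r(2,3) qr]]
  have r_out: "?R \<inter> inside (?P \<union> ?Q) = {}"
    using arc_inside_dichotomy neg by blast
  have q_out: "?Q \<inter> inside (?P \<union> ?R) = {}"
    using theta_arcs.arc_inside_dichotomy[OF permuted(1)] neg by blast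
  have p_out: "?P \<inter> inside (?Q \<union> ?R) = {}"
    using theta_arcs.arc_inside_dichotomy[OF permuted(2)] neg by blast
  have endless: "?P - {a, b} \<noteq> {}" "?Q - {a, b} \<noteq> {}" "?R - {a, b} \<noteq> {}"
    using nonempty_simple_path_endless[OF arc_imp_simple_path] p q r by metis+
  \<comment> \<open>A connected inside that avoids the other curve and shares one point with the
    inside of that curve lies in it entirely.\<close>
  have step: "inside A \<subseteq> inside B"
    if "connected (inside A)" "inside A \<inter> B = {}" "x \<in> inside A" "x \<in> inside B" for A B :: "complex set" and x
  proof
    fix y assume "y \<in> inside A"
    then have "connected_component (- B) x y"
      unfolding connected_component_def using that by (intro exI[of _ "inside A"]) auto
    then show "y \<in> inside B" using inside_same_component that by blast
  qed
  obtain x where x: "x \<in> inside (?P \<union> ?Q)" using Lpq by blast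
  obtain y where y: "y \<in> outside (?P \<union> ?Q \<union> ?R)"
  proof -
    have "bounded (?P \<union> ?Q \<union> ?R)"
      using p(1) q(1) r(1) by (simp add: bounded_path_image arc_imp_path)
    then show ?thesis using outside_bounded_nonempty that by blast
  qed
  have xpr: "x \<in> outside (?P \<union> ?R)"
  proof (rule ccontr)
    assume "x \<notin> outside (?P \<union> ?R)"
    moreover have "x \<notin> ?P \<union> ?R" using x r_out inside_no_overlap by blast
    ultimately have xi: "x \<in> inside (?P \<union> ?R)" by (simp add: inside_outside)
    have "inside (?P \<union> ?Q) = inside (?P \<union> ?R)"
    proof
      show "inside (?P \<union> ?Q) \<subseteq> inside (?P \<union> ?R)"
        using step[OF _ _ x xi] Lpq r_out inside_no_overlap[of "?P \<union> ?Q"] by blast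
      show "inside (?P \<union> ?R) \<subseteq> inside (?P \<union> ?Q)"
        using step[OF _ _ xi x] Lpr q_out inside_no_overlap[of "?P \<union> ?R"] by blast
    qed
    \<comment> \<open>A Jordan curve is the frontier of its inside, so equal insides force equal
      curves, although \<open>q\<close> has points off \<open>p\<close> and
      \<open>r\<close>.\<close>
    then have "?P \<union> ?Q = ?P \<union> ?R" using Lpq Lpr by metis
    then show False using endless pq qr by blast
  qed
  have xqr: "x \<in> outside (?Q \<union> ?R)"
  proof (rule ccontr)
    assume "x \<notin> outside (?Q \<union> ?R)"
    moreover have "x \<notin> ?Q \<union> ?R" using x r_out inside_no_overlap by blast
    ultimately have xi: "x \<in> inside (?Q \<union> ?R)" by (simp add: inside_outside)
    have "inside (?P \<union> ?Q) = inside (?Q \<union> ?R)"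
    proof
      show "inside (?P \<union> ?Q) \<subseteq> inside (?Q \<union> ?R)"
        using step[OF _ _ x xi] Lpq r_out inside_no_overlap[of "?P \<union> ?Q"] by blast
      show "inside (?Q \<union> ?R) \<subseteq> inside (?P \<union> ?Q)"
        using step[OF _ _ xi x] Lqr p_out inside_no_overlap[of "?Q \<union> ?R"] by blast
    qed
    then have "?P \<union> ?Q = ?Q \<union> ?R" using Lpq Lqr by metis
    then show False using endless pq pr by blast
  qed
  have ypr: "y \<in> outside (?P \<union> ?R)" and yqr: "y \<in> outside (?Q \<union> ?R)" and ypq: "y \<in> outside (?P \<union> ?Q)"
    using y outside_mono[of "?P \<union> ?R" "?P \<union> ?Q \<union> ?R"] outside_mono[of "?Q \<union> ?R" "?P \<union> ?Q \<union> ?R"]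
      outside_mono[of "?P \<union> ?Q" "?P \<union> ?Q \<union> ?R"] by blast+
  have connected_from: "connected_component (- S) x y" if "connected (outside S)" "x \<in> outside S" "y \<in> outside S" for S
    unfolding connected_component_def using that outside_no_overlap by blast
  \<comment> \<open>The two curves through \<open>r\<close> meet exactly in \<open>r\<close>;
    connectedness of this intersection is the hypothesis of Janiszewski's theorem.\<close>
  have "(?P \<union> ?R) \<inter> (?Q \<union> ?R) = ?R" using pq pr by blast
  moreover have "connected ?R" using r(1) by (simp add: connected_path_image arc_imp_path)
  moreover have "compact (?P \<union> ?R)" "closed (?Q \<union> ?R)"
    using p(1) q(1) r(1) by (auto simp: compact_Un compact_path_image closed_path_image arc_imp_path closed_Un)
  ultimately have "connected_component (- ((?P \<union> ?R) \<union> (?Q \<union> ?R))) x y"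
    using Janiszewski[of "?P \<union> ?R" "?Q \<union> ?R" x y] connected_from Lpr Lqr xpr xqr ypr yqr by metis
  then have "connected_component (- (?P \<union> ?Q)) x y"
    by (rule connected_component_of_subset) auto
  then have "y \<in> inside (?P \<union> ?Q)" using x inside_same_component by blast
  then show False using ypq inside_Int_outside by blast
qed

text \<open>The marked points keep \<open>p\<close> and \<open>q\<close> from being the enclosed arc
  of \<open>theta_one_inside\<close>, which leaves \<open>r\<close>.\<close>

lemma theta_marked_inside:
  assumes D: "path_image p \<union> path_image q \<union> path_image r \<subseteq> D"
    and x: "x \<in> path_image p - {a, b}" "x \<in> frontier (outside D)"
    and y: "y \<in> path_image q - {a, b}" "y \<in> frontier (outside D)"
  shows "path_image r - {a, b} \<subseteq> inside (path_image p \<union> path_image q)"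
proof -
  have "open (inside (path_image p \<union> path_image r))" "open (inside (path_image q \<union> path_image r))"
    using p q r by (simp_all add: open_inside closed_Un closed_path_image arc_imp_path)
  then have "\<not> path_image q - {a, b} \<subseteq> inside (path_image p \<union> path_image r)"
    "\<not> path_image p - {a, b} \<subseteq> inside (path_image q \<union> path_image r)"
    using frontier_outside_not_inside[OF y(2)] frontier_outside_not_inside[OF x(2)] D x(1) y(1) by (meson Un_subset_iff subsetD)+
  then show ?thesis using theta_one_inside by blast
qed

lemma theta_not_all_marked:
  assumes D: "path_image p \<union> path_image q \<union> path_image r \<subseteq> D"
    and x: "x \<in> path_image p - {a, b}" "x \<in> frontier (outside D)"
    and y: "y \<in> path_image q - {a, b}" "y \<in> frontier (outside D)"
    and z: "z \<in> path_image r - {a, b}" "z \<in> frontier (outside D)"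
  shows False
proof -
  have "open (inside (path_image p \<union> path_image q))"
    using p q by (simp add: open_inside closed_Un closed_path_image arc_imp_path)
  then show False
    using theta_marked_inside[OF D x y] z frontier_outside_not_inside[OF z(2)] D
    by (meson Un_subset_iff subsetD)
qed

text \<open>By the theta-curve theorem the chord \<open>r\<close> splits the inside of the cycle \<open>p \<union> q\<close> into two parts, neither of
  which can contain a chord \<open>s\<close> joining the two sides of the cycle.\<close>

lemma crossing_chords_not_both_inside:
  fixes s :: "real \<Rightarrow> complex"
  assumes s: "arc s" "pathstart s = x" "pathfinish s = y"
    and x: "x \<in> path_image p - {a, b}" and y: "y \<in> path_image q - {a, b}"
    and sr: "path_image s \<inter> path_image r = {}"
    and s_in: "path_image s - {x, y} \<subseteq> inside (path_image p \<union> path_image q)"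
    and r_in: "path_image r - {a, b} \<subseteq> inside (path_image p \<union> path_image q)"
  shows False
proof -
  let ?P = "path_image p" and ?Q = "path_image q" and ?R = "path_image r" and ?S = "path_image s"
  have "a \<noteq> b" using p arc_distinct_ends by blast
  have "?R - {a, b} \<noteq> {}" using nonempty_simple_path_endless[OF arc_imp_simple_path] r by metis
  then have ne: "?R \<inter> inside (?P \<union> ?Q) \<noteq> {}" using r_in by blast
  obtain disj: "inside (?P \<union> ?R) \<inter> inside (?Q \<union> ?R) = {}"
    and un: "inside (?P \<union> ?R) \<union> inside (?Q \<union> ?R) \<union> (?R - {a, b}) = inside (?P \<union> ?Q)"
    using split_inside_simple_closed_curve[OF arc_imp_simple_path[OF p(1)] p(2,3) arc_imp_simple_path[OF q(1)] q(2,3)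
      arc_imp_simple_path[OF r(1)] r(2,3) \<open>a \<noteq> b\<close> pq pr qr ne] by blast
  have op: "open (inside (?P \<union> ?R))" "open (inside (?Q \<union> ?R))"
    using p q r by (simp_all add: open_inside closed_Un closed_path_image arc_imp_path)
  have con: "connected (?S - {x, y})"
    using connected_simple_path_endless[OF arc_imp_simple_path[OF s(1)]] s by simp
  have sub: "?S - {x, y} \<subseteq> inside (?P \<union> ?R) \<union> inside (?Q \<union> ?R)"
    using s_in un sr by blast
  have "x \<noteq> y" using s arc_distinct_ends by blast
  \<comment> \<open>The ends of \<open>s\<close> are limits of its other points, so the closure of
    the region that contains the open arc also contains the ends.\<close>
  have "connected ?S" using s(1) connected_path_image arc_imp_path by blast
  moreover have xS: "x \<in> ?S" and yS: "y \<in> ?S"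
    using s(2,3) pathstart_in_path_image pathfinish_in_path_image by blast+
  moreover have "\<nexists>z. ?S = {z}" using xS yS \<open>x \<noteq> y\<close> by auto
  ultimately have "x islimpt ?S" "y islimpt ?S"
    using connected_imp_perfect by blast+
  then have "x islimpt {x, y} \<union> (?S - {x, y})" "y islimpt {x, y} \<union> (?S - {x, y})"
    by (auto elim: islimpt_subset)
  then have "x islimpt ?S - {x, y}" "y islimpt ?S - {x, y}"
    using islimpt_Un_finite[of "{x, y}"] by blast+
  then have xy: "x \<in> closure (?S - {x, y})" "y \<in> closure (?S - {x, y})"
    by (simp_all add: closure_def)
  have cl: "closure (inside (?P \<union> ?R)) \<subseteq> ?P \<union> ?R \<union> inside (?P \<union> ?R)"
     "closure (inside (?Q \<union> ?R)) \<subseteq> ?Q \<union> ?R \<union> inside (?Q \<union> ?R)"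
    using p q r by (simp_all add: closure_inside_subset closed_Un closed_path_image arc_imp_path)
  have nin: "x \<notin> inside (?P \<union> ?Q)" "y \<notin> inside (?P \<union> ?Q)"
    using x y inside_no_overlap[of "?P \<union> ?Q"] by blast+
  \<comment> \<open>The open arc lies in one half of the inside, and its end on the other side of
    \<open>r\<close> would then be in the closure of the wrong half.\<close>
  consider "?S - {x, y} \<subseteq> inside (?P \<union> ?R)" | "?S - {x, y} \<subseteq> inside (?Q \<union> ?R)"
    using connectedD[OF con op] disj sub by blast
  then show False
  proof cases
    case 1
    then have "y \<in> ?P \<union> ?R \<union> inside (?P \<union> ?R)" using xy(2) cl(1) closure_mono by blast
    then show False using nin un y pq qr by blast
  next
    case 2
    then have "x \<in> ?Q \<union> ?R \<union> inside (?Q \<union> ?R)" using xy(1) cl(2) closure_mono by blast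
    then show False using nin un x pq pr by blast
  qed
qed

end

section \<open>Paths as vertex lists and their images in a drawing\<close>

fun pedges :: "'a list \<Rightarrow> 'a set set" where
  "pedges (x # y # zs) = insert {x, y} (pedges (y # zs))"
| "pedges _ = {}"

lemma pedges_append: "pedges (xs @ y # ys) = pedges (xs @ [y]) \<union> pedges (y # ys)"
  by (induction xs rule: pedges.induct) auto

lemma pedges_rev [simp]: "pedges (rev xs) = pedges xs"
proof (induction xs rule: pedges.induct)
  case (1 x y zs)
  then show ?case using pedges_append[of "rev zs" y "[x]"] by auto
qed auto

lemma pedges_subset: "e \<in> pedges xs \<Longrightarrow> e \<subseteq> set xs"
  by (induction xs rule: pedges.induct) auto

text \<open>Tells the edges of internally disjoint paths apart: each edge of the one has an end that
  the other avoids.\<close>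

lemma pedges_inner:
  assumes "e \<in> pedges (u # a @ [v])" "a \<noteq> []"
  shows "e \<inter> set a \<noteq> {}"
  using assms
proof (induction a arbitrary: u)
  case (Cons x xs)
  show ?case
  proof (cases "xs = []")
    case False
    then show ?thesis using Cons.IH[of x] Cons.prems by auto
  qed (use Cons in auto)
qed simp

definition gpath :: "'a set set \<Rightarrow> 'a list \<Rightarrow> bool" where
  "gpath E xs \<longleftrightarrow> distinct xs \<and> pedges xs \<subseteq> E"

definition theta_free :: "'a set set \<Rightarrow> bool" where
  "theta_free E \<longleftrightarrow> (\<forall>u v a b c. gpath E (u # a @ [v]) \<longrightarrow> gpath E (u # b @ [v]) \<longrightarrow> gpath E (u # c @ [v]) \<longrightarrow>
     set a \<inter> set b = {} \<longrightarrow> set a \<inter> set c = {} \<longrightarrow> set b \<inter> set c = {} \<longrightarrow> a = [] \<or> b = [] \<or> c = [])"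

definition crossing_free :: "'a set set \<Rightarrow> bool" where
  "crossing_free E \<longleftrightarrow> (\<forall>u v a b x y. gpath E (u # a @ [v]) \<longrightarrow> gpath E (u # b @ [v]) \<longrightarrow> set a \<inter> set b = {} \<longrightarrow>
     {u, v} \<in> E \<longrightarrow> x \<in> set a \<longrightarrow> y \<in> set b \<longrightarrow> {x, y} \<notin> E)"

definition pimage :: "('a set \<Rightarrow> real \<Rightarrow> complex) \<Rightarrow> 'a list \<Rightarrow> complex set" where
  "pimage g xs = (\<Union>e\<in>pedges xs. path_image (g e))"

locale drawing =
  fixes V :: "'a set" and E p g
  assumes simple: "simple_graph V E" and drawn: "plane_drawing V E p g"
begin

lemma inj: "inj_on p V"
  using drawn by (simp add: plane_drawing_def)

lemma edge_V: "e \<in> E \<Longrightarrow> e \<subseteq> V"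
  using simple by (auto simp: simple_graph_def)

text \<open>A drawing fixes only the set of the two ends of an arc, so the arc may have to be
  reversed.\<close>

lemma edge_arc:
  assumes "{x, y} \<in> E"
  shows "\<exists>c. arc c \<and> pathstart c = p x \<and> pathfinish c = p y \<and> path_image c = path_image (g {x, y})"
proof -
  have a: "arc (g {x, y})" and "{pathstart (g {x, y}), pathfinish (g {x, y})} = {p x, p y}"
    using assms drawn unfolding plane_drawing_def by auto
  then consider "pathstart (g {x, y}) = p x" "pathfinish (g {x, y}) = p y"
    | "pathstart (g {x, y}) = p y" "pathfinish (g {x, y}) = p x"
    by (auto simp: doubleton_eq_iff)
  then show ?thesis
  proof cases
    case 1
    then show ?thesis using a by blast
  next
    case 2
    then show ?thesis using arc_reversepath[OF a] by (intro exI[of _ "reversepath (g {x, y})"]) simp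
  qed
qed

lemma edges_meet:
  assumes "e \<in> E" "f \<in> E" "e \<noteq> f"
  shows "path_image (g e) \<inter> path_image (g f) = p ` (e \<inter> f)"
  using assms drawn unfolding plane_drawing_def by blast

lemma end_on_arc: "e \<in> E \<Longrightarrow> x \<in> e \<Longrightarrow> p x \<in> path_image (g e)"
  using drawn unfolding plane_drawing_def by blast

text \<open>The arcs of the edges are concatenated. The first one meets the rest only in
  \<open>p y\<close>, because no later edge contains \<open>x\<close>.\<close>

lemma path_arc:
  assumes "gpath E (x # y # zs)"
  shows "\<exists>c. arc c \<and> pathstart c = p x \<and> pathfinish c = p (last (y # zs)) \<and> path_image c = pimage g (x # y # zs)"
  using assms
proof (induction zs arbitrary: x y)
  case Nil
  then show ?case using edge_arc[of x y] by (auto simp: gpath_def pimage_def)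
next
  case (Cons z zs)
  have gp: "gpath E (y # z # zs)" and xy: "{x, y} \<in> E" and xn: "x \<notin> set (y # z # zs)"
    using Cons.prems by (auto simp: gpath_def)
  obtain c where c: "arc c" "pathstart c = p y" "pathfinish c = p (last (z # zs))" "path_image c = pimage g (y # z # zs)"
    using Cons.IH[OF gp] by blast
  obtain d where d: "arc d" "pathstart d = p x" "pathfinish d = p y" "path_image d = path_image (g {x, y})"
    using edge_arc[OF xy] by blast
  have "path_image d \<inter> path_image c \<subseteq> {p y}"
  proof
    fix t assume "t \<in> path_image d \<inter> path_image c"
    then obtain f where f: "f \<in> pedges (y # z # zs)" "t \<in> path_image (g {x, y})" "t \<in> path_image (g f)"
      unfolding c d pimage_def by blast
    have "x \<notin> f" using pedges_subset[OF f(1)] xn by blast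
    moreover have "f \<in> E" using f(1) gp by (auto simp: gpath_def)
    ultimately have "t \<in> p ` ({x, y} \<inter> f)" using edges_meet[OF xy, of f] f by blast
    then show "t \<in> {p y}" using \<open>x \<notin> f\<close> by blast
  qed
  then have "arc (d +++ c)" using c d by (intro arc_join) auto
  moreover have "path_image (d +++ c) = pimage g (x # y # z # zs)"
    using c d by (simp add: path_image_join pimage_def)
  ultimately show ?case using c d by (intro exI[of _ "d +++ c"]) simp
qed

lemma path_arc':
  assumes "gpath E (u # a @ [v])"
  shows "\<exists>c. arc c \<and> pathstart c = p u \<and> pathfinish c = p v \<and> path_image c = pimage g (u # a @ [v])"
proof (cases a)
  case Nil
  then show ?thesis using path_arc[of u v "[]"] assms by simp
next
  case (Cons y zs)
  then show ?thesis using path_arc[of u y "zs @ [v]"] assms by simp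
qed

lemma vertex_in_pimage:
  assumes "gpath E (u # a @ [v])" "w \<in> set (u # a @ [v])"
  shows "p w \<in> pimage g (u # a @ [v])"
proof -
  have "\<exists>e \<in> pedges (u # a @ [v]). w \<in> e"
    using assms(2)
  proof (induction a arbitrary: u)
    case (Cons x xs)
    then show ?case by auto
  qed auto
  then show ?thesis using assms(1) end_on_arc unfolding gpath_def pimage_def by blast
qed

text \<open>A common point lies on the arcs of two distinct edges, so it is the image of a common
  end, and the paths share only \<open>u\<close> and \<open>v\<close>.\<close>

lemma paths_meet:
  assumes "gpath E (u # a @ [v])" "gpath E (u # b @ [v])" "set a \<inter> set b = {}" "a \<noteq> []"
  shows "pimage g (u # a @ [v]) \<inter> pimage g (u # b @ [v]) = {p u, p v}"
proof
  show "{p u, p v} \<subseteq> pimage g (u # a @ [v]) \<inter> pimage g (u # b @ [v])"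
    using vertex_in_pimage[OF assms(1)] vertex_in_pimage[OF assms(2)] by simp
  show "pimage g (u # a @ [v]) \<inter> pimage g (u # b @ [v]) \<subseteq> {p u, p v}"
  proof
    fix t assume "t \<in> pimage g (u # a @ [v]) \<inter> pimage g (u # b @ [v])"
    then obtain e f where ef: "e \<in> pedges (u # a @ [v])" "t \<in> path_image (g e)"
      "f \<in> pedges (u # b @ [v])" "t \<in> path_image (g f)"
      unfolding pimage_def by blast
    have "set a \<inter> set (u # b @ [v]) = {}" using assms(1,3) by (auto simp: gpath_def)
    then have "e \<noteq> f" using pedges_inner[OF ef(1) assms(4)] pedges_subset[OF ef(3)] by blast
    then have "t \<in> p ` (e \<inter> f)" using edges_meet[of e f] ef assms(1,2) by (auto simp: gpath_def)
    moreover have "e \<inter> f \<subseteq> {u, v}"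
      using pedges_subset[OF ef(1)] pedges_subset[OF ef(3)] assms(3) by auto
    ultimately show "t \<in> {p u, p v}" by blast
  qed
qed

text \<open>The third path may be the single edge from \<open>u\<close> to \<open>v\<close>, so that
  the theta-curve results apply to chords as well.\<close>

lemma theta_paths:
  assumes gp: "gpath E (u # a @ [v])" "gpath E (u # b @ [v])" "gpath E (u # c @ [v])"
    and dj: "set a \<inter> set b = {}" "set a \<inter> set c = {}" "set b \<inter> set c = {}" and ne: "a \<noteq> []" "b \<noteq> []"
  obtains P Q R where "theta_arcs P Q R (p u) (p v)" "path_image P = pimage g (u # a @ [v])"
    "path_image Q = pimage g (u # b @ [v])" "path_image R = pimage g (u # c @ [v])"
proof -
  obtain P where P: "arc P" "pathstart P = p u" "pathfinish P = p v" "path_image P = pimage g (u # a @ [v])"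
    using path_arc'[OF gp(1)] by blast
  obtain Q where Q: "arc Q" "pathstart Q = p u" "pathfinish Q = p v" "path_image Q = pimage g (u # b @ [v])"
    using path_arc'[OF gp(2)] by blast
  obtain R where R: "arc R" "pathstart R = p u" "pathfinish R = p v" "path_image R = pimage g (u # c @ [v])"
    using path_arc'[OF gp(3)] by blast
  have "theta_arcs P Q R (p u) (p v)"
    by (rule theta_arcs.intro[OF P(1-3) Q(1-3) R(1-3)])
      (simp_all only: P Q R paths_meet[OF gp(1,2) dj(1) ne(1)] paths_meet[OF gp(1,3) dj(2) ne(1)]
        paths_meet[OF gp(2,3) dj(3) ne(2)])
  then show ?thesis using that P(4) Q(4) R(4) by blast
qed

lemma pimage_subset: "gpath E xs \<Longrightarrow> pimage g xs \<subseteq> drawing_image V E p g"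
  by (auto simp: pimage_def gpath_def drawing_image_def)

lemma path_V: "gpath E (u # a @ [v]) \<Longrightarrow> set (u # a @ [v]) \<subseteq> V"
proof (induction a arbitrary: u)
  case Nil
  then show ?case using edge_V by (auto simp: gpath_def)
next
  case (Cons x xs)
  then show ?case using edge_V[of "{u, x}"] by (auto simp: gpath_def)
qed

lemma inner_in_pimage:
  assumes "gpath E (u # a @ [v])" "w \<in> set a"
  shows "p w \<in> pimage g (u # a @ [v]) - {p u, p v}"
proof -
  have "w \<noteq> u" "w \<noteq> v" "{u, v, w} \<subseteq> V"
    using assms path_V[OF assms(1)] by (auto simp: gpath_def)
  then have "p w \<notin> {p u, p v}" using inj by (auto dest: inj_onD)
  then show ?thesis using vertex_in_pimage[OF assms(1)] assms(2) by simp
qed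

context
  assumes outer: "\<forall>v\<in>V. p v \<in> frontier (outside (drawing_image V E p g))"
begin

lemma theta_free: "theta_free E"
  unfolding theta_free_def
proof (intro allI impI)
  fix u v a b c
  assume gp: "gpath E (u # a @ [v])" "gpath E (u # b @ [v])" "gpath E (u # c @ [v])"
    and dj: "set a \<inter> set b = {}" "set a \<inter> set c = {}" "set b \<inter> set c = {}"
  show "a = [] \<or> b = [] \<or> c = []"
  proof (rule ccontr)
    assume "\<not> (a = [] \<or> b = [] \<or> c = [])"
    then obtain x y z where xyz: "x \<in> set a" "y \<in> set b" "z \<in> set c" and ne: "a \<noteq> []" "b \<noteq> []"
      by (meson list.set_sel(1))
    obtain P Q R where T: "theta_arcs P Q R (p u) (p v)" and I: "path_image P = pimage g (u # a @ [v])"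
      "path_image Q = pimage g (u # b @ [v])" "path_image R = pimage g (u # c @ [v])"
      by (rule theta_paths[OF gp dj ne])
    show False
    proof (rule theta_arcs.theta_not_all_marked[OF T, of "drawing_image V E p g" "p x" "p y" "p z"])
      show "path_image P \<union> path_image Q \<union> path_image R \<subseteq> drawing_image V E p g"
        unfolding I using pimage_subset gp by blast
      show "p x \<in> path_image P - {p u, p v}" "p y \<in> path_image Q - {p u, p v}" "p z \<in> path_image R - {p u, p v}"
        unfolding I using inner_in_pimage gp xyz by blast+
      show "p x \<in> frontier (outside (drawing_image V E p g))" "p y \<in> frontier (outside (drawing_image V E p g))"
        "p z \<in> frontier (outside (drawing_image V E p g))"
        using outer path_V[OF gp(1)] path_V[OF gp(2)] path_V[OF gp(3)] xyz by auto
    qed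
  qed
qed

text \<open>The cycle passes through outer vertices on both sides of the chord, and these serve as
  the marked points of \<open>theta_marked_inside\<close>.\<close>

lemma chord_inside:
  assumes gp: "gpath E (u # a @ [v])" "gpath E (u # b @ [v])" and dj: "set a \<inter> set b = {}"
    and uv: "{u, v} \<in> E" and x: "x \<in> set a" and y: "y \<in> set b"
  shows "path_image (g {u, v}) - {p u, p v} \<subseteq> inside (pimage g (u # a @ [v]) \<union> pimage g (u # b @ [v]))"
proof -
  have gc: "gpath E (u # [] @ [v])" using gp uv by (auto simp: gpath_def)
  have ne: "a \<noteq> []" "b \<noteq> []" using x y by auto
  obtain P Q R where T: "theta_arcs P Q R (p u) (p v)" and I: "path_image P = pimage g (u # a @ [v])"
    "path_image Q = pimage g (u # b @ [v])" "path_image R = pimage g (u # [] @ [v])"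
    by (rule theta_paths[OF gp gc dj _ _ ne]) simp_all
  have "path_image R - {p u, p v} \<subseteq> inside (path_image P \<union> path_image Q)"
  proof (rule theta_arcs.theta_marked_inside[OF T, of "drawing_image V E p g" "p x" "p y"])
    show "path_image P \<union> path_image Q \<union> path_image R \<subseteq> drawing_image V E p g"
      unfolding I using pimage_subset gp gc by blast
    show "p x \<in> path_image P - {p u, p v}" "p y \<in> path_image Q - {p u, p v}"
      unfolding I using inner_in_pimage gp x y by blast+
    show "p x \<in> frontier (outside (drawing_image V E p g))" "p y \<in> frontier (outside (drawing_image V E p g))"
      using outer path_V[OF gp(1)] path_V[OF gp(2)] x y by auto
  qed
  then show ?thesis unfolding I by (simp add: pimage_def)
qed

lemma crossing_free: "crossing_free E"
  unfolding crossing_free_def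
proof (intro allI impI notI)
  fix u v a b x y
  assume gp: "gpath E (u # a @ [v])" "gpath E (u # b @ [v])" and dj: "set a \<inter> set b = {}"
    and uv: "{u, v} \<in> E" and x: "x \<in> set a" and y: "y \<in> set b" and xy: "{x, y} \<in> E"
  obtain a1 a2 where a: "a = a1 @ x # a2" using x by (meson split_list)
  obtain b1 b2 where b: "b = b1 @ y # b2" using y by (meson split_list)
  \<comment> \<open>The same cycle is cut once more, now at \<open>x\<close> and \<open>y\<close>;
    thus both chords are seen to run inside one and the same closed curve.\<close>
  let ?c = "rev a1 @ u # b1" and ?d = "a2 @ v # rev b2"
  have ed: "pedges (x # ?c @ [y]) = pedges (u # a1 @ [x]) \<union> pedges (u # b1 @ [y])"
    "pedges (x # ?d @ [y]) = pedges (x # a2 @ [v]) \<union> pedges (y # b2 @ [v])"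
    using pedges_append[of "x # rev a1" u "b1 @ [y]"] pedges_rev[of "u # a1 @ [x]"]
      pedges_append[of "x # a2" v "rev b2 @ [y]"] pedges_rev[of "y # b2 @ [v]"] by auto
  moreover have ed': "pedges (u # a @ [v]) = pedges (u # a1 @ [x]) \<union> pedges (x # a2 @ [v])"
    "pedges (u # b @ [v]) = pedges (u # b1 @ [y]) \<union> pedges (y # b2 @ [v])"
    unfolding a b using pedges_append[of "u # a1" x "a2 @ [v]"] pedges_append[of "u # b1" y "b2 @ [v]"] by simp_all
  ultimately have gp': "gpath E (x # ?c @ [y])" "gpath E (x # ?d @ [y])"
    using gp dj a b unfolding gpath_def by auto
  have dj': "set ?c \<inter> set ?d = {}" using gp dj a b unfolding gpath_def by auto
  have same: "pimage g (x # ?c @ [y]) \<union> pimage g (x # ?d @ [y]) = pimage g (u # a @ [v]) \<union> pimage g (u # b @ [v])"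
    unfolding pimage_def ed ed' by blast
  have s_in: "path_image (g {x, y}) - {p x, p y} \<subseteq> inside (pimage g (u # a @ [v]) \<union> pimage g (u # b @ [v]))"
    using chord_inside[OF gp' dj' xy, of u v] unfolding same by simp
  have r_in: "path_image (g {u, v}) - {p u, p v} \<subseteq> inside (pimage g (u # a @ [v]) \<union> pimage g (u # b @ [v]))"
    by (rule chord_inside[OF gp dj uv x y])
  have gc: "gpath E (u # [] @ [v])" using gp uv by (auto simp: gpath_def)
  have ne: "a \<noteq> []" "b \<noteq> []" using x y by auto
  obtain P Q R where T: "theta_arcs P Q R (p u) (p v)" and I: "path_image P = pimage g (u # a @ [v])"
    "path_image Q = pimage g (u # b @ [v])" "path_image R = pimage g (u # [] @ [v])"
    by (rule theta_paths[OF gp gc dj _ _ ne]) simp_all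
  have R: "path_image R = path_image (g {u, v})" unfolding I by (simp add: pimage_def)
  obtain S where S: "arc S" "pathstart S = p x" "pathfinish S = p y" "path_image S = path_image (g {x, y})"
    using edge_arc[OF xy] by blast
  show False
  proof (rule theta_arcs.crossing_chords_not_both_inside[OF T S(1-3)])
    show "p x \<in> path_image P - {p u, p v}" "p y \<in> path_image Q - {p u, p v}"
      unfolding I using inner_in_pimage gp x y by blast+
    have "{x, y} \<inter> {u, v} = {}" using gp x y by (auto simp: gpath_def)
    then show "path_image S \<inter> path_image R = {}"
      unfolding S R using edges_meet[OF xy uv] by fastforce
    show "path_image S - {p x, p y} \<subseteq> inside (path_image P \<union> path_image Q)"
      "path_image R - {p u, p v} \<subseteq> inside (path_image P \<union> path_image Q)"
      unfolding I(1,2) R S by (rule s_in, rule r_in)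
  qed
qed

end

end

lemma outerplanar_theta_crossing_free:
  assumes "simple_graph V E" "outerplanar V E"
  shows "theta_free E" "crossing_free E"
proof -
  obtain p g where "plane_drawing V E p g" and o: "\<forall>v\<in>V. p v \<in> frontier (outside (drawing_image V E p g))"
    using assms(2) unfolding outerplanar_def by blast
  then interpret drawing V E p g using assms(1) by unfold_locales
  show "theta_free E" "crossing_free E" using theta_free[OF o] crossing_free[OF o] by blast+
qed

section \<open>Colours near a vertex\<close>

datatype colour = X0 | X1 | X2 | X3 | X4

text \<open>Distinct edges of colour \<open>c\<close> must not have ends at vertex distance at most \<open>radius c\<close>.\<close>

fun radius :: "colour \<Rightarrow> nat" where
  "radius X0 = 0" | "radius X1 = 0" | "radius X2 = 1" | "radius X3 = 1" | "radius X4 = 2"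

fun strong :: "colour \<Rightarrow> bool" where
  "strong X0 = False" | "strong X1 = False" | "strong X2 = True" | "strong X3 = True" | "strong X4 = True"

lemma radius_le_2: "radius c \<le> 2"
  by (cases c) auto

lemma radius_pos: "radius c \<ge> 1 \<Longrightarrow> strong c"
  by (cases c) auto

lemma radius_2: "radius c \<ge> 2 \<Longrightarrow> c = X4"
  by (cases c) auto

section \<open>Edge sets, balls and valid colourings\<close>

definition graph :: "'a set set \<Rightarrow> bool" where
  "graph E \<longleftrightarrow> (\<forall>e\<in>E. card e = 2)"

lemma graph_empty [simp]: "graph {}"
  by (simp add: graph_def)

lemma graph_Un [simp]: "graph (E \<union> F) \<longleftrightarrow> graph E \<and> graph F"
  by (auto simp: graph_def)

lemma graph_insert [simp]: "graph (insert {x, y} E) \<longleftrightarrow> x \<noteq> y \<and> graph E"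
  by (auto simp: graph_def card_insert_if)

lemma graph_subset: "graph E \<Longrightarrow> F \<subseteq> E \<Longrightarrow> graph F"
  by (auto simp: graph_def)

lemma graph_edge_neq: "graph E \<Longrightarrow> {x, y} \<in> E \<Longrightarrow> x \<noteq> y"
  by (auto simp: graph_def)

lemma graph_edgeE:
  assumes "graph E" "e \<in> E" "x \<in> e"
  obtains y where "e = {x, y}" "y \<noteq> x"
proof -
  have "card e = 2" using assms by (simp add: graph_def)
  then obtain a b where "e = {a, b}" "a \<noteq> b" by (auto simp: card_2_iff)
  then show ?thesis using that assms(3) by (cases "x = a") auto
qed

fun vball :: "'a set set \<Rightarrow> nat \<Rightarrow> 'a \<Rightarrow> 'a set" where
  "vball E 0 v = {v}"
| "vball E (Suc n) v = vball E n v \<union> {y. \<exists>x\<in>vball E n v. {x, y} \<in> E}"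

lemma vball_self [simp]: "v \<in> vball E n v"
  by (induction n) auto

lemma vball_le: "n \<le> m \<Longrightarrow> y \<in> vball E n v \<Longrightarrow> y \<in> vball E m v"
  by (induction m) (auto simp: le_Suc_eq)

lemma vball_trans: "y \<in> vball E n x \<Longrightarrow> z \<in> vball E m y \<Longrightarrow> z \<in> vball E (n + m) x"
proof (induction m arbitrary: z)
  case (Suc m)
  then consider "z \<in> vball E m y" | w where "w \<in> vball E m y" "{w, z} \<in> E" by auto
  then show ?case by cases (use Suc in auto)
qed simp

lemma vball_sym: "y \<in> vball E n x \<Longrightarrow> x \<in> vball E n y"
proof (induction n arbitrary: y)
  case (Suc n)
  then consider "y \<in> vball E n x" | w where "w \<in> vball E n x" "{w, y} \<in> E" by auto
  then show ?case
  proof cases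
    case 1
    show ?thesis by (rule vball_le[OF _ Suc.IH[OF 1]]) simp
  next
    case 2
    then have "w \<in> vball E 1 y" by (auto simp: insert_commute)
    from vball_trans[OF this Suc.IH[OF 2(1)]] show ?thesis by (simp only: plus_1_eq_Suc)
  qed
qed simp

lemma vball_support: "y \<in> vball E n v \<Longrightarrow> y = v \<or> y \<in> \<Union>E"
  by (induction n arbitrary: y) auto

definition cols :: "'a set set \<Rightarrow> ('a set \<Rightarrow> colour) \<Rightarrow> nat \<Rightarrow> 'a \<Rightarrow> colour set" where
  "cols E f n v = f ` {e \<in> E. e \<inter> vball E n v \<noteq> {}}"

definition valid :: "'a set set \<Rightarrow> ('a set \<Rightarrow> colour) \<Rightarrow> bool" where
  "valid E f \<longleftrightarrow> (\<forall>e\<in>E. \<forall>e'\<in>E. \<forall>x\<in>e. \<forall>y\<in>e'. e \<noteq> e' \<longrightarrow> f e = f e' \<longrightarrow> y \<notin> vball E (radius (f e)) x)"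

lemma colsI: "e \<in> E \<Longrightarrow> x \<in> e \<Longrightarrow> x \<in> vball E n v \<Longrightarrow> f e \<in> cols E f n v"
  by (auto simp: cols_def)

lemma colsE:
  assumes "c \<in> cols E f n v"
  obtains e x where "e \<in> E" "x \<in> e" "x \<in> vball E n v" "c = f e"
  using assms by (auto simp: cols_def)

lemma cols_cong: "(\<And>e. e \<in> E \<Longrightarrow> f e = h e) \<Longrightarrow> cols E f n v = cols E h n v"
  unfolding cols_def by (rule image_cong) auto

lemma valid_cong: "(\<And>e. e \<in> E \<Longrightarrow> f e = h e) \<Longrightarrow> valid E f = valid E h"
  unfolding valid_def by (intro ball_cong refl) simp

lemma cols_le: "n \<le> m \<Longrightarrow> c \<in> cols E f n v \<Longrightarrow> c \<in> cols E f m v"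
  by (elim colsE) (metis colsI vball_le)

lemma cols_empty [simp]: "cols {} f n v = {}"
  by (simp add: cols_def)

lemma valid_empty [simp]: "valid {} f"
  by (simp add: valid_def)

lemma valid_single [simp]: "valid {e} f"
  by (simp add: valid_def)

section \<open>Gluing two pieces at one vertex\<close>

locale glue =
  fixes E1 E2 :: "'a set set" and m :: 'a
  assumes meet: "\<Union>E1 \<inter> \<Union>E2 \<subseteq> {m}"
begin

text \<open>A walk that leaves \<open>E1\<close> passes through the cut vertex \<open>m\<close>,
  which splits its length into \<open>i\<close> and \<open>j\<close>. The membership clauses drive
  the induction: a step that changes sides starts at a vertex of both parts, hence at
  \<open>m\<close>.\<close>

lemma vball_cases:
  assumes "v \<in> insert m (\<Union>E1)" "y \<in> vball (E1 \<union> E2) n v"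
  shows "(y \<in> vball E1 n v \<and> y \<in> insert m (\<Union>E1)) \<or>
    (\<exists>i j. i + j \<le> n \<and> m \<in> vball E1 i v \<and> y \<in> vball E2 j m \<and> y \<in> insert m (\<Union>E2))"
  using assms(2)
proof (induction n arbitrary: y)
  case 0
  then show ?case using assms(1) by simp
next
  case (Suc n)
  then consider "y \<in> vball (E1 \<union> E2) n v" | w where "w \<in> vball (E1 \<union> E2) n v" "{w, y} \<in> E1 \<union> E2" by auto
  then show ?case
  proof cases
    case 1
    from Suc.IH[OF 1] show ?thesis
    proof
      assume "\<exists>i j. i + j \<le> n \<and> m \<in> vball E1 i v \<and> y \<in> vball E2 j m \<and> y \<in> insert m (\<Union>E2)"
      then show ?thesis by (meson le_SucI)
    qed auto
  next
    case 2
    from Suc.IH[OF 2(1)] show ?thesis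
    proof
      assume w: "w \<in> vball E1 n v \<and> w \<in> insert m (\<Union>E1)"
      show ?thesis
      proof (cases "{w, y} \<in> E1")
        case True
        then show ?thesis using w by auto
      next
        case False
        then have e: "{w, y} \<in> E2" using 2 by blast
        then have "w = m" using w meet by blast
        then have "y \<in> vball E2 1 m" "m \<in> vball E1 n v" "y \<in> \<Union>E2" using e w by auto
        then show ?thesis by (intro disjI2 exI[of _ n] exI[of _ 1]) simp
      qed
    next
      assume "\<exists>i j. i + j \<le> n \<and> m \<in> vball E1 i v \<and> w \<in> vball E2 j m \<and> w \<in> insert m (\<Union>E2)"
      then obtain i j where ij: "i + j \<le> n" "m \<in> vball E1 i v" "w \<in> vball E2 j m" "w \<in> insert m (\<Union>E2)" by blast
      show ?thesis
      proof (cases "{w, y} \<in> E2")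
        case True
        then have "y \<in> vball E2 (Suc j) m" "y \<in> \<Union>E2" using ij by auto
        moreover have "i + Suc j \<le> Suc n" using ij by simp
        ultimately show ?thesis using ij(2) by blast
      next
        case False
        then have e: "{w, y} \<in> E1" using 2 by blast
        then have "w = m" using ij meet by blast
        then have y: "y \<in> vball E1 (Suc i) v" "y \<in> \<Union>E1" using e ij by auto
        have "Suc i \<le> Suc n" using ij by simp
        from vball_le[OF this y(1)] show ?thesis using y(2) by (intro disjI1 conjI insertI2)
      qed
    qed
  qed
qed

lemma cols_cases:
  assumes "v \<in> insert m (\<Union>E1)" "c \<in> cols (E1 \<union> E2) f n v"
  shows "c \<in> cols E1 f n v \<or> (\<exists>i j. i + j \<le> n \<and> m \<in> vball E1 i v \<and> c \<in> cols E2 f j m)"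
proof -
  obtain e y where e: "e \<in> E1 \<union> E2" "y \<in> e" "y \<in> vball (E1 \<union> E2) n v" "c = f e"
    using assms(2) by (rule colsE)
  from vball_cases[OF assms(1) e(3)] show ?thesis
  proof
    assume y: "y \<in> vball E1 n v \<and> y \<in> insert m (\<Union>E1)"
    show ?thesis
    proof (cases "e \<in> E1")
      case True
      then show ?thesis using colsI[OF True e(2), of n v f] e(4) y by simp
    next
      case False
      then have "e \<in> E2" using e by blast
      then have "y = m" using y e meet by blast
      then have "f e \<in> cols E2 f 0 m" "m \<in> vball E1 n v" using \<open>e \<in> E2\<close> e y colsI[of e E2 m 0 m f] by auto
      then show ?thesis using e(4) by (intro disjI2 exI[of _ n] exI[of _ 0]) simp
    qed
  next
    assume "\<exists>i j. i + j \<le> n \<and> m \<in> vball E1 i v \<and> y \<in> vball E2 j m \<and> y \<in> insert m (\<Union>E2)"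
    then obtain i j where ij: "i + j \<le> n" "m \<in> vball E1 i v" "y \<in> vball E2 j m" "y \<in> insert m (\<Union>E2)" by blast
    show ?thesis
    proof (cases "e \<in> E2")
      case True
      from colsI[OF this e(2) ij(3), of f] show ?thesis using e(4) ij by blast
    next
      case False
      then have "e \<in> E1" using e by blast
      then have "y = m" using ij e meet by blast
      moreover have "i \<le> n" using ij by simp
      ultimately have "y \<in> vball E1 n v" using vball_le[of i n m E1 v] ij(2) by simp
      from colsI[OF \<open>e \<in> E1\<close> e(2) this, of f] show ?thesis using e(4) by simp
    qed
  qed
qed

lemma cols_at: "c \<in> cols (E1 \<union> E2) f n m \<Longrightarrow> c \<in> cols E1 f n m \<or> c \<in> cols E2 f n m"
proof -
  assume "c \<in> cols (E1 \<union> E2) f n m"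
  from cols_cases[OF insertI1 this] show ?thesis
    using cols_le[of _ n c E2 f m] by (meson add_leD2)
qed

text \<open>Cutting a short connection at \<open>m\<close> exhibits the colour on both sides, at
  distances whose sum is at most the radius.\<close>

lemma not_near_across:
  assumes compat: "\<And>i j. i + j \<le> radius (f e) \<Longrightarrow> f e \<in> cols E1 f i m \<Longrightarrow> f e \<notin> cols E2 f j m"
    and e: "e \<in> E1" "e' \<in> E2" "f e = f e'" and xy: "x \<in> e" "y \<in> e'"
  shows "y \<notin> vball (E1 \<union> E2) (radius (f e)) x"
proof
  assume "y \<in> vball (E1 \<union> E2) (radius (f e)) x"
  then consider "y \<in> vball E1 (radius (f e)) x" "y \<in> insert m (\<Union>E1)"
    | i j where "i + j \<le> radius (f e)" "m \<in> vball E1 i x" "y \<in> vball E2 j m"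
    using vball_cases[of x y "radius (f e)"] e xy by blast
  then show False
  proof cases
    case 1
    then have "y = m" using e xy meet by blast
    then have "x \<in> vball E1 (radius (f e)) m" using 1 vball_sym[of y E1 _ x] by simp
    then have "f e \<in> cols E1 f (radius (f e)) m" by (rule colsI[OF e(1) xy(1)])
    moreover have "f e' \<in> cols E2 f 0 m" using e xy \<open>y = m\<close> colsI[of e' E2 m 0 m f] by simp
    ultimately show False using compat[of "radius (f e)" 0] e by simp
  next
    case 2
    have "f e \<in> cols E1 f i m" by (rule colsI[OF e(1) xy(1) vball_sym[OF 2(2)]])
    moreover have "f e' \<in> cols E2 f j m" by (rule colsI[OF e(2) xy(2) 2(3)])
    ultimately show False using compat[OF 2(1)] e by simp
  qed
qed

text \<open>A detour through the other part has to come back to \<open>m\<close>, so gluing does not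
  shorten distances within a part.\<close>

lemma not_near_same:
  assumes "valid E1 f" "e \<in> E1" "e' \<in> E1" "e \<noteq> e'" "f e = f e'" and xy: "x \<in> e" "y \<in> e'"
  shows "y \<notin> vball (E1 \<union> E2) (radius (f e)) x"
proof
  assume "y \<in> vball (E1 \<union> E2) (radius (f e)) x"
  then consider "y \<in> vball E1 (radius (f e)) x"
    | i j where "i + j \<le> radius (f e)" "m \<in> vball E1 i x" "y \<in> insert m (\<Union>E2)"
    using vball_cases[of x y "radius (f e)"] assms xy by blast
  then have "y \<in> vball E1 (radius (f e)) x"
  proof cases
    case 2
    then have "y = m" using assms xy meet by blast
    then show ?thesis using vball_le[of i "radius (f e)"] 2 by simp
  qed
  then show False using assms unfolding valid_def by blast
qed

end

lemma glue_sym: "glue E1 E2 m \<Longrightarrow> glue E2 E1 m"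
  by (auto simp: glue_def)

lemma glue_valid:
  assumes g: "glue E1 E2 m" and v: "valid E1 f" "valid E2 f"
    and compat: "\<And>c i j. i + j \<le> radius c \<Longrightarrow> c \<in> cols E1 f i m \<Longrightarrow> c \<notin> cols E2 f j m"
  shows "valid (E1 \<union> E2) f"
  unfolding valid_def
proof (intro ballI impI)
  fix e e' x y assume e: "e \<in> E1 \<union> E2" "e' \<in> E1 \<union> E2" "e \<noteq> e'" "f e = f e'" and xy: "x \<in> e" "y \<in> e'"
  consider "e \<in> E1" "e' \<in> E1" | "e \<in> E2" "e' \<in> E2" | "e \<in> E1" "e' \<in> E2" | "e \<in> E2" "e' \<in> E1"
    using e by blast
  then show "y \<notin> vball (E1 \<union> E2) (radius (f e)) x"
  proof cases
    case 1
    then show ?thesis using glue.not_near_same[OF g v(1)] e xy by metis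
  next
    case 2
    then show ?thesis using glue.not_near_same[OF glue_sym[OF g] v(2)] e xy by (metis Un_commute)
  next
    case 3
    show ?thesis
      by (rule glue.not_near_across[OF g compat 3 e(4) xy])
  next
    case 4
    have "y \<notin> vball (E2 \<union> E1) (radius (f e)) x"
    proof (rule glue.not_near_across[OF glue_sym[OF g] _ 4 e(4) xy])
      fix i j assume "i + j \<le> radius (f e)" "f e \<in> cols E2 f i m"
      then show "f e \<notin> cols E1 f j m" using compat[of j i "f e"] by (auto simp: add.commute)
    qed
    then show ?thesis by (simp add: Un_commute)
  qed
qed

section \<open>Adding an edge between two vertices of a piece\<close>

lemma vball_close:
  assumes "y \<in> vball (insert {a, b} E) n v"
  shows "y \<in> vball E n v \<or> (\<exists>i j. i + j + 1 \<le> n \<and> a \<in> vball E i v \<and> y \<in> vball E j b) \<or>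
    (\<exists>i j. i + j + 1 \<le> n \<and> b \<in> vball E i v \<and> y \<in> vball E j a)"
  using assms
proof (induction n arbitrary: y)
  case (Suc n)
  \<comment> \<open>Here \<open>p\<close> and \<open>q\<close> are the ends of the new edge in the
    order of traversal; a walk needs that edge at most once.\<close>
  have step: "\<exists>i j. i + j + 1 \<le> Suc n \<and> p \<in> vball E i v \<and> y \<in> vball E j q"
    if hyp: "\<exists>i j. i + j + 1 \<le> n \<and> p \<in> vball E i v \<and> w \<in> vball E j q" "{w, y} \<in> E \<or> y = w" for p q w
  proof -
    obtain i j where "i + j + 1 \<le> n" "p \<in> vball E i v" "w \<in> vball E j q" using hyp(1) by blast
    moreover from this(3) have "y \<in> vball E (Suc j) q" using hyp(2) by auto
    ultimately show ?thesis by (intro exI[of _ i] exI[of _ "Suc j"]) simp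
  qed
  have extend: ?case
    if hyp: "w \<in> vball E n v \<or> (\<exists>i j. i + j + 1 \<le> n \<and> a \<in> vball E i v \<and> w \<in> vball E j b) \<or>
      (\<exists>i j. i + j + 1 \<le> n \<and> b \<in> vball E i v \<and> w \<in> vball E j a)" and wy: "{w, y} \<in> E \<or> y = w" for w
    using hyp
  proof (elim disjE)
    assume "w \<in> vball E n v"
    then have "y \<in> vball E (Suc n) v" using wy by auto
    then show ?case by (rule disjI1)
  next
    assume "\<exists>i j. i + j + 1 \<le> n \<and> a \<in> vball E i v \<and> w \<in> vball E j b"
    from step[OF this wy] show ?case by (rule disjI2[OF disjI1])
  next
    assume "\<exists>i j. i + j + 1 \<le> n \<and> b \<in> vball E i v \<and> w \<in> vball E j a"
    from step[OF this wy] show ?case by (rule disjI2[OF disjI2])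
  qed
  have self: "\<exists>i j. i + j + 1 \<le> Suc n \<and> p \<in> vball E i v \<and> p' \<in> vball E j p'" if "p \<in> vball E n v" for p p'
    using that by (intro exI[of _ n] exI[of _ 0]) simp
  consider "y \<in> vball (insert {a, b} E) n v" | w where "w \<in> vball (insert {a, b} E) n v" "{w, y} \<in> insert {a, b} E"
    using Suc.prems by auto
  then show ?case
  proof cases
    case 1
    have "y = y" ..
    from extend[OF Suc.IH[OF 1] disjI2[OF this]] show ?thesis .
  next
    case 2
    show ?thesis
    proof (cases "{w, y} \<in> E")
      case True
      from extend[OF Suc.IH[OF 2(1)] disjI1[OF True]] show ?thesis .
    next
      case False
      then have wy: "w = a \<and> y = b \<or> w = b \<and> y = a" using 2 by (auto simp: doubleton_eq_iff)
      have mid: "p \<in> vball E n v" if hyp: "\<exists>i j. i + j + 1 \<le> n \<and> p \<in> vball E i v \<and> q \<in> vball E j r" for p q r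
      proof -
        obtain i j where "i + j + 1 \<le> n" "p \<in> vball E i v" using hyp by blast
        then show ?thesis using vball_le[of i n p E v] by simp
      qed
      have "a \<in> vball E n v \<or> b \<in> vball E n v"
        using Suc.IH[OF 2(1)] wy mid[of a w b] mid[of b w a] by blast
      then show ?thesis
      proof
        assume a: "a \<in> vball E n v"
        show ?thesis using wy
        proof
          assume "w = a \<and> y = b" then show ?thesis using self[OF a] by blast
        next
          assume "w = b \<and> y = a" then show ?thesis using a by simp
        qed
      next
        assume b: "b \<in> vball E n v"
        show ?thesis using wy
        proof
          assume "w = a \<and> y = b" then show ?thesis using b by simp
        next
          assume "w = b \<and> y = a" then show ?thesis using self[OF b] by blast
        qed
      qed
    qed
  qed
qed simp

lemma vball_close_end:
  assumes "a \<in> vball (insert {a, b} E) n v \<or> b \<in> vball (insert {a, b} E) n v"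
  shows "a \<in> vball E n v \<or> b \<in> vball E n v"
proof -
  have mid: "p \<in> vball E n v" if hyp: "\<exists>i j. i + j + 1 \<le> n \<and> p \<in> vball E i v \<and> q \<in> vball E j r" for p q r
  proof -
    obtain i j where "i + j + 1 \<le> n" "p \<in> vball E i v" using hyp by blast
    then show ?thesis using vball_le[of i n p E v] by simp
  qed
  show ?thesis
    using assms vball_close[of a a b E n v] vball_close[of b a b E n v] mid[of a _ b] mid[of b _ a] by blast
qed

lemma cols_close:
  assumes "c \<in> cols (insert {a, b} E) f n v"
  shows "c \<in> cols E f n v \<or> (c = f {a, b} \<and> (a \<in> vball E n v \<or> b \<in> vball E n v)) \<or>
    (\<exists>i j. i + j + 1 \<le> n \<and> a \<in> vball E i v \<and> c \<in> cols E f j b) \<or>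
    (\<exists>i j. i + j + 1 \<le> n \<and> b \<in> vball E i v \<and> c \<in> cols E f j a)"
proof -
  obtain e y where e: "e \<in> insert {a, b} E" "y \<in> e" "y \<in> vball (insert {a, b} E) n v" "c = f e"
    using assms by (rule colsE)
  show ?thesis
  proof (cases "e \<in> E")
    case True
    have c: "c \<in> cols E f k u" if "y \<in> vball E k u" for k u
      using colsI[OF True e(2) that, of f] e(4) by simp
    show ?thesis using vball_close[OF e(3)] by (meson c)
  next
    case False
    then have "e = {a, b}" using e by blast
    then show ?thesis using vball_close_end[of a b E n v] e by blast
  qed
qed

text \<open>A conflict that arises only now comes from a walk across \<open>{a, b}\<close> or from
  the new edge itself. The assumption \<open>compat\<close> excludes the former, with the step
  across counted by the summand 1, and \<open>new\<close> the latter.\<close>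

lemma valid_close:
  assumes v: "valid E f" and new: "\<And>j. j \<le> radius (f {a, b}) \<Longrightarrow> f {a, b} \<notin> cols E f j a"
    "\<And>j. j \<le> radius (f {a, b}) \<Longrightarrow> f {a, b} \<notin> cols E f j b"
    and compat: "\<And>e e' i j x y. \<lbrakk>e \<in> E; e' \<in> E; e \<noteq> e'; f e = f e'; i + j + 1 \<le> radius (f e);
      x \<in> e; x \<in> vball E i a; y \<in> e'; y \<in> vball E j b\<rbrakk> \<Longrightarrow> False"
  shows "valid (insert {a, b} E) f"
  unfolding valid_def
proof (intro ballI impI notI)
  let ?E = "insert {a, b} E"
  fix e e' x y assume e: "e \<in> ?E" "e' \<in> ?E" "e \<noteq> e'" "f e = f e'" and xy: "x \<in> e" "y \<in> e'"
    and near: "y \<in> vball ?E (radius (f e)) x"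
  have new': False if "e1 \<in> E" "f e1 = f {a, b}" "w \<in> e1" "w \<in> vball E (radius (f e1)) a \<or> w \<in> vball E (radius (f e1)) b" for e1 w
    using that new[of "radius (f {a, b})"] colsI[of e1 E w "radius (f e1)" a f] colsI[of e1 E w "radius (f e1)" b f]
    by auto
  have new_near: False if "e1 \<in> E" "f e1 = f {a, b}" "w \<in> e1" "p \<in> {a, b}" "w \<in> vball ?E (radius (f e1)) p" for e1 w p
  proof -
    have "p \<in> vball ?E (radius (f e1)) w" using that vball_sym by metis
    then have "a \<in> vball E (radius (f e1)) w \<or> b \<in> vball E (radius (f e1)) w"
      using vball_close_end[of a b E _ w] that(4) by blast
    then have "w \<in> vball E (radius (f e1)) a \<or> w \<in> vball E (radius (f e1)) b"
      using vball_sym[of a E _ w] vball_sym[of b E _ w] by blast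
    then show False by (rule new'[OF that(1-3)])
  qed
  consider "e \<in> E" "e' \<in> E" | "e = {a, b}" "e' \<in> E" | "e \<in> E" "e' = {a, b}" using e by blast
  then show False
  proof cases
    case 1
    from vball_close[OF near] show False
    proof (elim disjE exE conjE)
      assume "y \<in> vball E (radius (f e)) x"
      then show False using v[unfolded valid_def, rule_format, OF 1 xy e(3,4)] by simp
    next
      fix i j assume ij: "i + j + 1 \<le> radius (f e)" "a \<in> vball E i x" "y \<in> vball E j b"
      show False
        by (rule compat[OF 1 e(3,4) ij(1) xy(1) vball_sym[OF ij(2)] xy(2) ij(3)])
    next
      fix i j assume ij: "i + j + 1 \<le> radius (f e)" "b \<in> vball E i x" "y \<in> vball E j a"
      then have "j + i + 1 \<le> radius (f e')" using e by simp
      then show False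
        by (rule compat[OF 1(2,1) e(3)[symmetric] e(4)[symmetric] _ xy(2) ij(3) xy(1) vball_sym[OF ij(2)]])
    qed
  next
    case 2
    show False
      by (rule new_near[of e' y x]) (use 2 e xy near in auto)
  next
    case 3
    show False
      by (rule new_near[of e x y]) (use 3 e xy vball_sym[OF near] in auto)
  qed
qed

text \<open>The sets \<open>K\<close> and \<open>S\<close> and the flag \<open>z\<close> are upper bounds for the colours at distance 0, 1 and 2 from \<open>v\<close>; colours
  at distance 1 matter only if their radius is positive, and at distance 2 only \<open>X4\<close> matters.\<close>

definition info :: "'a set set \<Rightarrow> ('a set \<Rightarrow> colour) \<Rightarrow> 'a \<Rightarrow> colour set \<Rightarrow> colour set \<Rightarrow> bool \<Rightarrow> bool" where
  "info E f v K S z \<longleftrightarrow> cols E f 0 v \<subseteq> K \<and> (\<forall>c\<in>cols E f 1 v. strong c \<longrightarrow> c \<in> K \<union> S) \<and>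
     (X4 \<in> cols E f 2 v \<longrightarrow> z \<or> X4 \<in> K \<union> S)"

text \<open>The clauses run through the ways in which one colour can occur on both sides at
  distances with sum at most its radius: sum 0 concerns every colour, sum 1 the
  \<open>strong\<close> ones, and sum 2 only \<open>X4\<close>.\<close>

definition compat :: "colour set \<Rightarrow> colour set \<Rightarrow> bool \<Rightarrow> colour set \<Rightarrow> colour set \<Rightarrow> bool \<Rightarrow> bool" where
  "compat K S z K' S' z' \<longleftrightarrow> K \<inter> K' = {} \<and> (\<forall>c. strong c \<longrightarrow> \<not> (c \<in> K \<and> c \<in> S') \<and> \<not> (c \<in> S \<and> c \<in> K')) \<and>
     \<not> (X4 \<in> S \<and> X4 \<in> S') \<and> \<not> (z \<and> X4 \<in> K') \<and> \<not> (z' \<and> X4 \<in> K)"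

lemma compat_cols:
  assumes "info E1 f m K S z" "info E2 f m K' S' z'" "compat K S z K' S' z'"
    "i + j \<le> radius c" "c \<in> cols E1 f i m"
  shows "c \<notin> cols E2 f j m"
proof -
  have "i + j \<le> 2" using assms(4) radius_le_2[of c] by linarith
  then have cases: "i = 0 \<and> j = 0 \<or> i = 1 \<and> j = 0 \<or> i = 0 \<and> j = 1 \<or> i = 1 \<and> j = 1 \<or> i = 2 \<and> j = 0 \<or> i = 0 \<and> j = 2"
    by presburger
  have strong: "strong c" if "1 \<le> i + j" by (rule radius_pos[OF order_trans[OF that assms(4)]])
  have four: "c = X4" if "2 \<le> i + j" by (rule radius_2[OF order_trans[OF that assms(4)]])
  have I1: "cols E1 f 0 m \<subseteq> K" "\<And>d. d \<in> cols E1 f 1 m \<Longrightarrow> strong d \<Longrightarrow> d \<in> K \<union> S"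
    "X4 \<in> cols E1 f 2 m \<Longrightarrow> z \<or> X4 \<in> K \<union> S"
    using assms(1) by (simp_all add: info_def)
  have I2: "cols E2 f 0 m \<subseteq> K'" "\<And>d. d \<in> cols E2 f 1 m \<Longrightarrow> strong d \<Longrightarrow> d \<in> K' \<union> S'"
    "X4 \<in> cols E2 f 2 m \<Longrightarrow> z' \<or> X4 \<in> K' \<union> S'"
    using assms(2) by (simp_all add: info_def)
  have I3: "K \<inter> K' = {}" "\<And>d. strong d \<Longrightarrow> \<not> (d \<in> K \<and> d \<in> S')" "\<And>d. strong d \<Longrightarrow> \<not> (d \<in> S \<and> d \<in> K')"
    "\<not> (X4 \<in> S \<and> X4 \<in> S')" "\<not> (z \<and> X4 \<in> K')" "\<not> (z' \<and> X4 \<in> K)"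
    using assms(3) by (simp_all add: compat_def)
  have "strong X4" by simp
  from cases show ?thesis
  proof (elim disjE conjE)
    assume ij: "i = 0" "j = 0"
    show ?thesis using I1(1) I2(1) I3(1) assms(5) unfolding ij by blast
  next
    assume ij: "i = 1" "j = 0"
    then have "strong c" using strong by simp
    then show ?thesis using I1(2)[of c] I2(1) I3(1) I3(3)[of c] assms(5) unfolding ij by blast
  next
    assume ij: "i = 0" "j = 1"
    then have "strong c" using strong by simp
    then show ?thesis using I1(1) I2(2)[of c] I3(1) I3(2)[of c] assms(5) unfolding ij by blast
  next
    assume ij: "i = 1" "j = 1"
    then have c: "c = X4" using four by simp
    show ?thesis using I1(2)[of X4] I2(2)[of X4] I3(1,4) I3(2,3)[of X4] assms(5) \<open>strong X4\<close> unfolding ij c by blast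
  next
    assume ij: "i = 2" "j = 0"
    then have c: "c = X4" using four by simp
    show ?thesis using I1(3) I2(1) I3(1,5) I3(3)[of X4] assms(5) \<open>strong X4\<close> unfolding ij c by blast
  next
    assume ij: "i = 0" "j = 2"
    then have c: "c = X4" using four by simp
    show ?thesis using I1(1) I2(3) I3(1,6) I3(2)[of X4] assms(5) \<open>strong X4\<close> unfolding ij c by blast
  qed
qed

lemma info_cong: "(\<And>e. e \<in> E \<Longrightarrow> f e = h e) \<Longrightarrow> info E f v K S z = info E h v K S z"
  using cols_cong[of E f h] by (simp add: info_def)


section \<open>Boundary conditions\<close>

text \<open>A leg \<open>(k, s, z)\<close> describes a piece at an end of degree one: \<open>k\<close> is the colour of the last edge, \<open>s\<close> the only colour of
  positive radius allowed on the edges next to it (none if \<open>s = X0\<close>), and \<open>z\<close> tells whether \<open>X4\<close> may occur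
  on the edges after these.\<close>

type_synonym leg = "colour \<times> colour \<times> bool"

text \<open>The colours \<open>X0\<close> and \<open>X1\<close> have equal radius, and so have
  \<open>X2\<close> and \<open>X3\<close>. The lists below are written up to these exchanges;
  \<open>symmetrize\<close> expands them, and the checks run on the expanded lists.\<close>

fun swap :: "bool \<Rightarrow> bool \<Rightarrow> colour \<Rightarrow> colour" where
  "swap p q X0 = (if p then X1 else X0)" | "swap p q X1 = (if p then X0 else X1)"
| "swap p q X2 = (if q then X3 else X2)" | "swap p q X3 = (if q then X2 else X3)"
| "swap p q X4 = X4"

text \<open>A middle entry that is not \<open>strong\<close> says only that no colour of positive
  radius is allowed there; it is normalised to \<open>X0\<close> instead of being exchanged.\<close>

fun swap_leg :: "bool \<Rightarrow> bool \<Rightarrow> leg \<Rightarrow> leg" where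
  "swap_leg p q (k, s, z) = (swap p q k, (if strong s then swap p q s else X0), z)"

definition symmetrize :: "(leg \<times> leg) list \<Rightarrow> (leg \<times> leg) list" where
  "symmetrize xs = [(swap_leg p q L, swap_leg p q R). (L, R) \<leftarrow> xs, p \<leftarrow> [False, True], q \<leftarrow> [False, True]]"

text \<open>The following lists were found by computer search: the pairs of legs realised by the possible words, with
  superfluous pairs deleted as long as the lists remained closed under the operations below. \<open>legs0\<close> belongs to words
  with one inner vertex; a longer word realises all pairs of \<open>legs1\<close>, \<open>legs2\<close> or \<open>legs3\<close>. The list
  \<open>legs1\<close> also serves for a word closed up by a chord, with the two edges leaving the ends of the chord.\<close>

definition bridge_legs :: "leg list" where
  "bridge_legs = [(X0, X2, False), (X0, X3, False), (X1, X2, False), (X1, X3, False), (X2, X0, False), (X3, X0, False), (X4, X0, False)]"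

definition edge_legs :: "(leg \<times> leg) list" where
  "edge_legs = [((k, X0, False), (k, X0, False)). k \<leftarrow> [X0, X1, X2, X3, X4]]"

definition legs0 :: "(leg \<times> leg) list" where
  "legs0 = symmetrize [
    ((X0, X2, False), (X1, X2, False)),
    ((X0, X2, False), (X2, X0, False)),
    ((X0, X4, False), (X1, X4, False)),
    ((X0, X4, False), (X4, X0, False)),
    ((X2, X0, True), (X0, X2, False)),
    ((X2, X4, False), (X4, X2, False)),
    ((X4, X0, False), (X0, X4, False)),
    ((X4, X2, False), (X2, X4, False))]"

definition legs1 :: "(leg \<times> leg) list" where
  "legs1 = symmetrize [
    ((X0, X2, False), (X1, X2, False)),
    ((X0, X2, False), (X3, X0, True)),
    ((X0, X2, True), (X0, X4, False)),
    ((X0, X2, True), (X4, X0, False)),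
    ((X0, X4, False), (X0, X2, True)),
    ((X0, X4, False), (X1, X4, False)),
    ((X0, X4, False), (X2, X0, True)),
    ((X2, X0, True), (X0, X3, False)),
    ((X2, X0, True), (X0, X4, False)),
    ((X2, X3, True), (X4, X0, False)),
    ((X4, X0, False), (X0, X2, True)),
    ((X4, X0, False), (X2, X3, True))]"

definition legs2 :: "(leg \<times> leg) list" where
  "legs2 = symmetrize [
    ((X0, X2, False), (X0, X4, False)),
    ((X0, X2, False), (X1, X3, False)),
    ((X0, X2, False), (X2, X0, True)),
    ((X0, X2, False), (X4, X0, False)),
    ((X0, X2, True), (X1, X2, True)),
    ((X0, X4, False), (X0, X2, False)),
    ((X0, X4, False), (X2, X0, True)),
    ((X2, X0, True), (X0, X2, True)),
    ((X2, X0, True), (X0, X3, False)),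
    ((X2, X0, True), (X0, X4, False)),
    ((X2, X0, True), (X4, X0, False)),
    ((X4, X0, False), (X0, X2, True)),
    ((X4, X0, False), (X2, X0, True))]"

definition legs3 :: "(leg \<times> leg) list" where
  "legs3 = symmetrize [
    ((X0, X2, False), (X0, X4, False)),
    ((X0, X2, False), (X1, X3, False)),
    ((X0, X2, False), (X3, X0, True)),
    ((X0, X2, False), (X4, X0, False)),
    ((X0, X2, True), (X1, X2, True)),
    ((X0, X4, False), (X0, X2, False)),
    ((X0, X4, False), (X2, X0, True)),
    ((X2, X0, True), (X0, X2, False)),
    ((X2, X0, True), (X0, X4, False)),
    ((X2, X0, True), (X2, X0, False)),
    ((X2, X0, True), (X4, X0, False)),
    ((X4, X0, False), (X0, X2, True)),
    ((X4, X0, False), (X2, X0, False))]"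

text \<open>The third clause of \<open>info\<close> for \<open>K = {k}\<close> and
  \<open>S = {s}\<close>: \<open>X4\<close> may occur within distance 2. An \<open>X4\<close>
  allowed nearer by counts as well, because balls are cumulative.\<close>

fun wide :: "leg \<Rightarrow> bool" where
  "wide (k, s, z) \<longleftrightarrow> z \<or> k = X4 \<or> s = X4"

fun legs_fit :: "leg \<Rightarrow> leg \<Rightarrow> bool" where
  "legs_fit (k, s, z) (l, t, y) \<longleftrightarrow> k \<noteq> l \<and> (strong k \<longrightarrow> k \<noteq> t) \<and> (strong l \<longrightarrow> l \<noteq> s) \<and>
     \<not> (s = X4 \<and> t = X4) \<and> \<not> (z \<and> l = X4) \<and> \<not> (y \<and> k = X4)"

text \<open>The order of relaxation: a colouring with the first leg also has the second, so that one
  realised pair can serve for a less restrictive one.\<close>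

fun weaker :: "leg \<Rightarrow> leg \<Rightarrow> bool" where
  "weaker (k, s, z) p' \<longleftrightarrow> (case p' of (k', s', z') \<Rightarrow>
     k = k' \<and> (strong s \<longrightarrow> s = s') \<and> (wide (k, s, z) \<longrightarrow> wide p'))"

text \<open>The first leg is that of an edge added at a vertex where pieces with the other two legs meet.\<close>

fun joins :: "leg \<Rightarrow> leg \<Rightarrow> leg \<Rightarrow> bool" where
  "joins (e, s, z) (k, t, y) (k', t', y') \<longleftrightarrow> legs_fit (k, t, y) (k', t', y') \<and>
     e \<noteq> k \<and> e \<noteq> k' \<and> (strong e \<longrightarrow> e \<noteq> t \<and> e \<noteq> t') \<and> \<not> (e = X4 \<and> (y \<or> y')) \<and>
     (strong k \<longrightarrow> k = s) \<and> (strong k' \<longrightarrow> k' = s) \<and> (t = X4 \<or> t' = X4 \<longrightarrow> wide (e, s, z))"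

text \<open>Effect of a bridge with leg \<open>(k, s, z)\<close> and an edge of colour \<open>x\<close>, both added at distance \<open>n\<close> from the left end, on the
  leg \<open>L\<close> there.\<close>

fun left_ok :: "nat \<Rightarrow> leg \<Rightarrow> leg \<Rightarrow> leg \<Rightarrow> colour \<Rightarrow> bool" where
  "left_ok n L L' (k, s, z) x \<longleftrightarrow> weaker L L' \<and>
     (n \<le> 2 \<longrightarrow> (k = X4 \<or> x = X4 \<longrightarrow> wide L')) \<and>
     (n \<le> 1 \<longrightarrow> (s = X4 \<longrightarrow> wide L') \<and> (strong k \<longrightarrow> k = fst (snd L')) \<and> (strong x \<longrightarrow> x = fst (snd L')))"

section \<open>The finite checks\<close>

definition check_fork :: bool where
  "check_fork \<longleftrightarrow> list_all (\<lambda>p. list_ex (\<lambda>L. list_ex (\<lambda>R. joins p L R) bridge_legs) bridge_legs) bridge_legs"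

definition check_cycle :: "(leg \<times> leg) list \<Rightarrow> bool" where
  "check_cycle F \<longleftrightarrow> list_all (\<lambda>p. list_ex (\<lambda>(L, R). joins p L R) F) bridge_legs"

text \<open>\<open>R'\<close> is the leg at the outer end of the edge to be added where the word and
  a bridge meet. The left leg may be relaxed, and has to allow whatever the bridge and that edge
  bring into its range.\<close>

definition check_pend :: "nat \<Rightarrow> (leg \<times> leg) list \<Rightarrow> (leg \<times> leg) list \<Rightarrow> bool" where
  "check_pend n F F' \<longleftrightarrow> list_all (\<lambda>(L', R'). list_ex (\<lambda>(L, R).
     weaker L L' \<and> list_ex (\<lambda>b. joins R' R b \<and> left_ok n L L' b (fst R')) bridge_legs) F) F'"

text \<open>A chord of colour \<open>d\<close> joins the ends of a word; \<open>l\<close> and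
  \<open>x\<close> are the colours of the edges that leave its ends on the outside. The first two
  lines concern the chord, the next two the outer edges, and the last two say that the outer legs
  cover everything they see. When \<open>tri\<close> holds, the inner vertex is the third corner of
  a triangle, and \<open>s2\<close> may be the colour of the very edge coloured \<open>k1\<close>;
  hence the exemption.\<close>

fun block_ok :: "bool \<Rightarrow> leg \<Rightarrow> leg \<Rightarrow> leg \<Rightarrow> leg \<Rightarrow> colour \<Rightarrow> bool" where
  "block_ok tri (l, sL, zL) (x, sR, zR) (k1, s1, z1) (k2, s2, z2) d \<longleftrightarrow>
     d \<noteq> k1 \<and> d \<noteq> k2 \<and> (strong d \<longrightarrow> d \<noteq> s1 \<and> d \<noteq> s2) \<and> \<not> (d = X4 \<and> (z1 \<or> z2)) \<and>
     (strong k1 \<longrightarrow> k1 \<noteq> k2) \<and> (\<not> tri \<longrightarrow> \<not> (k1 = X4 \<and> s2 = X4) \<and> \<not> (k2 = X4 \<and> s1 = X4)) \<and>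
     l \<noteq> k1 \<and> l \<noteq> d \<and> (strong l \<longrightarrow> l \<noteq> s1 \<and> l \<noteq> k2 \<and> l \<noteq> x) \<and> \<not> (l = X4 \<and> (z1 \<or> s2 = X4)) \<and>
     x \<noteq> k2 \<and> x \<noteq> d \<and> (strong x \<longrightarrow> x \<noteq> s2 \<and> x \<noteq> k1) \<and> \<not> (x = X4 \<and> (z2 \<or> s1 = X4)) \<and>
     (strong k1 \<longrightarrow> k1 = sL) \<and> (strong d \<longrightarrow> d = sL \<and> d = sR) \<and> (strong k2 \<longrightarrow> k2 = sR) \<and>
     (s1 = X4 \<or> k2 = X4 \<or> x = X4 \<longrightarrow> wide (l, sL, zL)) \<and> (s2 = X4 \<or> k1 = X4 \<or> l = X4 \<longrightarrow> wide (x, sR, zR))"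

definition check_block :: "bool \<Rightarrow> (leg \<times> leg) list \<Rightarrow> (leg \<times> leg) list \<Rightarrow> bool" where
  "check_block tri F I \<longleftrightarrow> list_all (\<lambda>(P, Q). list_ex (\<lambda>(p, q).
     list_ex (\<lambda>d. block_ok tri P Q p q d) [X0, X1, X2, X3, X4]) F) I"

text \<open>The last edge of the word, of colour \<open>l\<close>, is at the same time the edge that
  leaves the block, described by the leg \<open>P\<close> there. At their common vertex
  \<open>sP\<close> is the only \<open>strong\<close> colour the block can show, so it is compared
  with the entries \<open>s\<close> and \<open>z\<close> of the word.\<close>

fun chord_ok :: "nat \<Rightarrow> leg \<Rightarrow> leg \<Rightarrow> leg \<Rightarrow> leg \<Rightarrow> bool" where
  "chord_ok n L L' (l, s, z) (l', sP, zP) \<longleftrightarrow> weaker L L' \<and> l = l' \<and> (strong s \<longrightarrow> s \<noteq> sP) \<and>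
     \<not> (s = X4 \<and> wide (l', sP, zP)) \<and> \<not> (z \<and> sP = X4) \<and> (n \<le> 2 \<longrightarrow> sP = X4 \<longrightarrow> wide L')"

definition check_chord :: "nat \<Rightarrow> (leg \<times> leg) list \<Rightarrow> (leg \<times> leg) list \<Rightarrow> (leg \<times> leg) list \<Rightarrow> bool" where
  "check_chord n F I F' \<longleftrightarrow> list_all (\<lambda>(L', R'). list_ex (\<lambda>(L, R).
     weaker L L' \<and> list_ex (\<lambda>(P, Q). chord_ok n L L' R P \<and> weaker Q R') I) F) F'"

text \<open>A bridge takes \<open>legs1\<close> to \<open>legs3\<close>, \<open>legs3\<close> to
  \<open>legs2\<close> and \<open>legs2\<close> back to \<open>legs1\<close>. A block closed by a
  chord is always described by \<open>legs1\<close>; attaching it takes \<open>legs0\<close> to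
  \<open>legs2\<close> and the longer lists to \<open>legs1\<close>. The numbers bound the distance
  of the ends from below, and 3 stands for all larger values since no radius exceeds 2.\<close>

lemma checks:
  shows "check_fork"
    and "check_cycle legs1" "check_cycle legs2" "check_cycle legs3"
    and "check_pend 1 edge_legs legs0" "check_pend 2 legs0 legs1"
    and "check_pend 3 legs1 legs3" "check_pend 3 legs2 legs1" "check_pend 3 legs3 legs2"
    and "check_block True legs0 legs1" "check_block False legs1 legs1" "check_block False legs2 legs1"
      "check_block False legs3 legs1"
    and "check_chord 2 legs0 legs1 legs2" "check_chord 3 legs1 legs1 legs1" "check_chord 3 legs2 legs1 legs1"
      "check_chord 3 legs3 legs1 legs1"
  by code_simp+

section \<open>Assembling colourings\<close>

text \<open>A lone edge of colour \<open>x\<close> has the data \<open>{x}\<close>,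
  \<open>{}\<close>, \<open>False\<close> at its ends, so adding an edge is a case of gluing two
  pieces.\<close>

abbreviation admissible :: "colour \<Rightarrow> colour set \<Rightarrow> colour set \<Rightarrow> bool \<Rightarrow> bool" where
  "admissible x K S z \<equiv> compat {x} {} False K S z"

lemma admissible_iff: "admissible x K S z \<longleftrightarrow> x \<notin> K \<and> (strong x \<longrightarrow> x \<notin> S) \<and> \<not> (z \<and> x = X4)"
  by (auto simp: compat_def)

lemma infoD:
  assumes "info E f v K S z"
  shows "c \<in> cols E f 0 v \<Longrightarrow> c \<in> K" "c \<in> cols E f 1 v \<Longrightarrow> strong c \<Longrightarrow> c \<in> K \<or> c \<in> S"
    "X4 \<in> cols E f 2 v \<Longrightarrow> z \<or> X4 \<in> K \<or> X4 \<in> S"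
  using assms by (auto simp: info_def)

lemma infoI:
  assumes "\<And>c. c \<in> cols E f 0 v \<Longrightarrow> c \<in> K" "\<And>c. c \<in> cols E f 1 v \<Longrightarrow> strong c \<Longrightarrow> c \<in> K \<or> c \<in> S"
    "X4 \<in> cols E f 2 v \<Longrightarrow> z \<or> X4 \<in> K \<or> X4 \<in> S"
  shows "info E f v K S z"
  using assms by (auto simp: info_def)

lemma cols_single: "c \<in> cols {e} f n v \<Longrightarrow> c = f e"
  by (auto simp: cols_def)

lemma admissible_cols:
  assumes "info E f v K S z" "admissible d K S z" "j \<le> radius d"
  shows "d \<notin> cols E f j v"
proof -
  have j: "j \<le> 2" using assms(3) radius_le_2[of d] by linarith
  have o: "d \<notin> K" "strong d \<Longrightarrow> d \<notin> S" "\<not> (z \<and> d = X4)" using assms(2) by (auto simp: admissible_iff)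
  consider "j = 0" | "j = 1" | "j = 2" using j by linarith
  then show ?thesis
  proof cases
    case 1
    then show ?thesis using infoD(1)[OF assms(1)] o(1) by metis
  next
    case 2
    then have "strong d" using assms(3) radius_pos by blast
    then show ?thesis using infoD(2)[OF assms(1)] o(1,2) 2 by metis
  next
    case 3
    then have d: "d = X4" using assms(3) by (intro radius_2) simp
    then have "X4 \<notin> K" "X4 \<notin> S" "\<not> z" using o by auto
    then show ?thesis using infoD(3)[OF assms(1)] 3 d by metis
  qed
qed

lemma glue_colouring:
  assumes g: "glue E1 E2 m" "graph E1" and v: "valid E1 f1" "valid E2 f2"
    and i: "info E1 f1 m K S z" "info E2 f2 m K' S' z'" and c: "compat K S z K' S' z'"
  obtains f where "valid (E1 \<union> E2) f" "\<forall>e\<in>E1. f e = f1 e" "\<forall>e\<in>E2. f e = f2 e"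
proof -
  define f where "f = (\<lambda>e. if e \<in> E1 then f1 e else f2 e)"
  have disj: "E1 \<inter> E2 = {}"
  proof (rule ccontr)
    assume "E1 \<inter> E2 \<noteq> {}"
    then obtain e where e: "e \<in> E1" "e \<in> E2" by blast
    then have "e \<subseteq> {m}" using g(1) by (auto simp: glue_def)
    moreover have "card e = 2" using g(2) e by (simp add: graph_def)
    ultimately show False using card_mono[of "{m}" e] by simp
  qed
  have f1: "\<And>e. e \<in> E1 \<Longrightarrow> f e = f1 e" by (simp add: f_def)
  have f2: "\<And>e. e \<in> E2 \<Longrightarrow> f e = f2 e" using disj by (auto simp: f_def)
  have i': "info E1 f m K S z" "info E2 f m K' S' z'" using i by (simp_all add: info_cong[OF f1] info_cong[OF f2])
  have "valid (E1 \<union> E2) f"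
  proof (rule glue_valid[OF g(1)])
    show "valid E1 f" "valid E2 f" using v by (simp_all add: valid_cong[OF f1] valid_cong[OF f2])
  qed (rule compat_cols[OF i' c])
  then show ?thesis using that f1 f2 by simp
qed

lemma glue_info_at:
  assumes g: "glue E1 E2 m" and i: "info E1 f m K S z" "info E2 f m K' S' z'"
  shows "info (E1 \<union> E2) f m (K \<union> K') (S \<union> S') (z \<or> z')"
proof (rule infoI)
  fix c
  show "c \<in> cols (E1 \<union> E2) f 0 m \<Longrightarrow> c \<in> K \<union> K'"
    using glue.cols_at[OF g, of c f 0] infoD(1)[OF i(1)] infoD(1)[OF i(2)] by blast
  show "c \<in> cols (E1 \<union> E2) f 1 m \<Longrightarrow> strong c \<Longrightarrow> c \<in> K \<union> K' \<or> c \<in> S \<union> S'"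
    using glue.cols_at[OF g, of c f 1] infoD(2)[OF i(1)] infoD(2)[OF i(2)] by blast
  show "X4 \<in> cols (E1 \<union> E2) f 2 m \<Longrightarrow> (z \<or> z') \<or> X4 \<in> K \<union> K' \<or> X4 \<in> S \<union> S'"
    using glue.cols_at[OF g, of X4 f 2] infoD(3)[OF i(1)] infoD(3)[OF i(2)] by blast
qed

text \<open>Seen from the new vertex \<open>t\<close> everything is one step further away:
  \<open>K\<close> moves to distance 1, and of \<open>S\<close> only \<open>X4\<close> still
  matters. The last clause serves the other end of a word, whose view gains at most the new
  edge.\<close>

lemma fresh_edge:
  assumes v: "valid E f" and i: "info E f m K S y" and ok: "admissible x K S y" and t: "t \<notin> \<Union>E" "t \<noteq> m"
  obtains f' where "valid (insert {m, t} E) f'" "info (insert {m, t} E) f' t {x} K (X4 \<in> S)"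
    "\<forall>n. \<forall>v\<in>\<Union>E. \<forall>c\<in>cols (insert {m, t} E) f' n v. c \<in> cols E f n v \<or> c = x \<and> m \<in> vball E n v"
proof -
  let ?e = "{m, t}"
  have g: "glue {?e} E m" using t by (auto simp: glue_def)
  have "info {?e} (\<lambda>_. x) m {x} {} False"
    by (rule infoI) (auto dest: cols_single)
  from glue_colouring[OF g _ _ v this i ok] t(2) obtain f' where v': "valid ({?e} \<union> E) f'"
    and x': "\<forall>e\<in>{?e}. f' e = x" and E': "\<forall>e\<in>E. f' e = f e" by auto
  have f': "valid ({?e} \<union> E) f'" "f' ?e = x" "\<And>e. e \<in> E \<Longrightarrow> f' e = f e" using v' x' E' by simp_all
  have cE: "cols E f' n v = cols E f n v" for n v by (rule cols_cong[OF f'(3)])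
  have un: "insert ?e E = {?e} \<union> E" by simp
  show ?thesis
  proof (rule that)
    show "valid (insert ?e E) f'" using f'(1) by simp
    have at_t: "c = x \<or> (\<exists>j. j + 1 \<le> n \<and> c \<in> cols E f j m)" if c: "c \<in> cols (insert ?e E) f' n t" for c n
    proof -
      have tin: "t \<in> insert m (\<Union>{?e})" by simp
      from glue.cols_cases[OF g tin c[unfolded un]] show ?thesis
      proof
        assume "c \<in> cols {?e} f' n t" then show ?thesis using cols_single[of c ?e f' n t] f'(2) by simp
      next
        assume "\<exists>i j. i + j \<le> n \<and> m \<in> vball {?e} i t \<and> c \<in> cols E f' j m"
        then obtain i j where ij: "i + j \<le> n" "m \<in> vball {?e} i t" "c \<in> cols E f j m" using cE by blast
        have "i \<noteq> 0" using ij(2) t(2) by (cases i) auto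
        then have "j + 1 \<le> n" using ij(1) by simp
        then show ?thesis using ij(3) by blast
      qed
    qed
    show "info (insert ?e E) f' t {x} K (X4 \<in> S)"
    proof (rule infoI)
      fix c
      show "c \<in> cols (insert ?e E) f' 0 t \<Longrightarrow> c \<in> {x}" using at_t[of c 0] by simp
      show "c \<in> {x} \<or> c \<in> K" if "c \<in> cols (insert ?e E) f' 1 t"
        using at_t[OF that] infoD(1)[OF i, of c] by auto
      show "X4 \<in> S \<or> X4 \<in> {x} \<or> X4 \<in> K" if c: "X4 \<in> cols (insert ?e E) f' 2 t"
      proof -
        have "X4 = x \<or> X4 \<in> cols E f 1 m"
          using at_t[OF c] cols_le[of _ 1 X4 E f m] by fastforce
        then show ?thesis using infoD(2)[OF i, of X4] by auto
      qed
    qed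
    have "c \<in> cols E f n v \<or> c = x \<and> m \<in> vball E n v"
      if vE: "v \<in> \<Union>E" and c: "c \<in> cols (insert ?e E) f' n v" for n v c
    proof -
      have vin: "v \<in> insert m (\<Union>E)" using vE by simp
      have "c \<in> cols (E \<union> {?e}) f' n v" using c by simp
      from glue.cols_cases[OF glue_sym[OF g] vin this]
      show ?thesis
      proof
        assume "\<exists>i j. i + j \<le> n \<and> m \<in> vball E i v \<and> c \<in> cols {?e} f' j m"
        then obtain i j where ij: "i + j \<le> n" "m \<in> vball E i v" "c \<in> cols {?e} f' j m" by blast
        have "c = x" using cols_single[OF ij(3)] f'(2) by simp
        moreover have "m \<in> vball E n v" using vball_le[OF _ ij(2)] ij(1) by simp
        ultimately show ?thesis by blast
      qed (simp add: cE)
    qed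
    then show "\<forall>n. \<forall>v\<in>\<Union>E. \<forall>c\<in>cols (insert ?e E) f' n v. c \<in> cols E f n v \<or> c = x \<and> m \<in> vball E n v" by blast
  qed
qed

text \<open>In use the edge set is a word with one inner vertex \<open>v\<close>, which the edge
  \<open>{a, b}\<close> closes to a triangle.\<close>

definition sole_common :: "'a set set \<Rightarrow> 'a \<Rightarrow> 'a \<Rightarrow> bool" where
  "sole_common E a b \<longleftrightarrow> (\<exists>v. \<forall>e\<in>E. a \<in> e \<or> b \<in> e \<longrightarrow> v \<in> e)"

text \<open>If \<open>a\<close> and \<open>b\<close> have a common neighbour \<open>v\<close> and no other, then the edges at \<open>a\<close> and the edges
  at distance at most one from \<open>b\<close> were already close to each other before the edge \<open>{a, b}\<close> was added.\<close>

lemma sole_common_near: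
  assumes tri: "sole_common E a b" and v: "valid E f" and e: "e \<in> E" "e' \<in> E" "e \<noteq> e'" "f e = f e'" "f e = X4"
    and x: "x \<in> e" "x \<in> vball E 1 a" and b: "b \<in> e'"
  shows False
proof -
  obtain v where w: "\<And>e. e \<in> E \<Longrightarrow> a \<in> e \<or> b \<in> e \<Longrightarrow> v \<in> e" using tri by (auto simp: sole_common_def)
  have ve': "v \<in> e'" using w e b by blast
  have "x = v \<or> {x, v} \<in> E \<or> v \<in> e"
  proof (cases "x = a")
    case True
    then show ?thesis using w e x by blast
  next
    case False
    then have ax: "{a, x} \<in> E" using x by auto
    then have "v \<in> {a, x}" using w by blast
    then show ?thesis using ax by (auto simp: insert_commute)
  qed
  then obtain u where "u \<in> e" "v \<in> vball E 1 u" using x(1) by auto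
  then have "v \<in> vball E (radius (f e)) u" using e(5) vball_le[of 1 2 v E u] by simp
  then show False using v e \<open>u \<in> e\<close> ve' unfolding valid_def by blast
qed

lemma sole_common_sym: "sole_common E a b \<Longrightarrow> sole_common E b a"
  by (auto simp: sole_common_def disj_commute)

text \<open>The ends now see each other across the new edge, one step further away:
  \<open>K2\<close> joins the colours at distance 1 from \<open>a\<close>, an \<open>X4\<close> in
  \<open>S2\<close> those at distance 2, and conversely.\<close>

lemma close_edge:
  assumes v: "valid E f" and ia: "info E f a K1 S1 z1" and ib: "info E f b K2 S2 z2"
    and ok: "admissible d K1 S1 z1" "admissible d K2 S2 z2"
    and K: "\<And>c. strong c \<Longrightarrow> c \<in> K1 \<Longrightarrow> c \<notin> K2"
    and S: "sole_common E a b \<or> \<not> (X4 \<in> K1 \<and> X4 \<in> S2) \<and> \<not> (X4 \<in> S1 \<and> X4 \<in> K2)"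
    and ab: "b \<notin> vball E 1 a"
  obtains f' where "valid (insert {a, b} E) f'"
    "info (insert {a, b} E) f' a (insert d K1) (S1 \<union> K2) (z1 \<or> X4 \<in> S2)"
    "info (insert {a, b} E) f' b (insert d K2) (S2 \<union> K1) (z2 \<or> X4 \<in> S1)"
proof -
  define f' where "f' = f({a, b} := d)"
  have notE: "{a, b} \<notin> E" using ab by auto
  have d: "f' {a, b} = d" and f': "\<And>e. e \<in> E \<Longrightarrow> f' e = f e" using notE by (auto simp: f'_def)
  have vf': "valid E f'" using v by (simp add: valid_cong[OF f'])
  have ia': "info E f' a K1 S1 z1" and ib': "info E f' b K2 S2 z2" using ia ib by (simp_all add: info_cong[OF f'])
  show ?thesis
  proof (rule that)
    show "valid (insert {a, b} E) f'"
    proof (rule valid_close[OF vf'])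
      show "f' {a, b} \<notin> cols E f' j a" if "j \<le> radius (f' {a, b})" for j
        using admissible_cols[OF ia' ok(1)] that d by simp
      show "f' {a, b} \<notin> cols E f' j b" if "j \<le> radius (f' {a, b})" for j
        using admissible_cols[OF ib' ok(2)] that d by simp
      fix e e' i j x y
      assume e: "e \<in> E" "e' \<in> E" "e \<noteq> e'" "f' e = f' e'" and ij: "i + j + 1 \<le> radius (f' e)"
        and x: "x \<in> e" "x \<in> vball E i a" and y: "y \<in> e'" "y \<in> vball E j b"
      have st: "strong (f' e)" using ij by (intro radius_pos) simp
      have c1: "f' e \<in> cols E f' i a" by (rule colsI[OF e(1) x])
      have c2: "f' e \<in> cols E f' j b" using colsI[OF e(2) y, of f'] e(4) by simp
      \<comment> \<open>The step across the new edge uses up one of at most two, so two old edges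
        can conflict only at distances 0 and 0 or, with colour \<open>X4\<close>, at distances 0 and
        1.\<close>
      have "i + j \<le> 1" using ij radius_le_2[of "f' e"] by linarith
      then consider "i = 0 \<and> j = 0" | "i = 1 \<and> j = 0" | "i = 0 \<and> j = 1" by linarith
      then show False
      proof cases
        case 1
        then show ?thesis using infoD(1)[OF ia' c1[simplified 1]] infoD(1)[OF ib' c2[simplified 1]] K[OF st] by blast
      next
        case 2
        have four: "f' e = X4" using ij 2 by (intro radius_2) simp
        have i1: "i = 1" and j0: "j = 0" using 2 by auto
        have yb: "y = b" using y j0 by simp
        have "X4 \<in> K1 \<or> X4 \<in> S1" using infoD(2)[OF ia' c1[unfolded i1] st] four by simp
        moreover have "X4 \<in> K2" using infoD(1)[OF ib' c2[unfolded j0]] four by simp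
        moreover have "X4 \<notin> K1" using K[of X4] \<open>X4 \<in> K2\<close> by auto
        ultimately have "sole_common E a b" using S by blast
        then show ?thesis using sole_common_near[OF _ vf' e four x(1)] x y yb i1 by blast
      next
        case 3
        have four: "f' e = X4" using ij 3 by (intro radius_2) simp
        have i0: "i = 0" and j1: "j = 1" using 3 by auto
        have xa: "x = a" using x i0 by simp
        have four': "f' e' = X4" using four e by simp
        have "X4 \<in> K2 \<or> X4 \<in> S2" using infoD(2)[OF ib' c2[unfolded j1] st] four by simp
        moreover have "X4 \<in> K1" using infoD(1)[OF ia' c1[unfolded i0]] four by simp
        moreover have "X4 \<notin> K2" using K[of X4] \<open>X4 \<in> K1\<close> by auto
        ultimately have "sole_common E b a" using S sole_common_sym[of E a b] by blast
        then show ?thesis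
          using sole_common_near[OF _ vf' e(2,1) e(3)[symmetric] e(4)[symmetric] four' y(1)] x y xa j1 by blast
      qed
    qed
    have main: "info (insert {p, q} E) f' p (insert d K) (S \<union> K') (z \<or> X4 \<in> S')"
      if pq: "{p, q} = {a, b}" and i: "info E f' p K S z" "info E f' q K' S' z'" for p q K S z K' S' z'
    proof -
      have fd: "f' {p, q} = d" using pq d by simp
      have cases: "c \<in> cols E f' n p \<or> c = d \<or> (\<exists>j. j + 1 \<le> n \<and> c \<in> cols E f' j q)"
        if "c \<in> cols (insert {p, q} E) f' n p" for c n
      proof -
        from cols_close[OF that] show ?thesis
        proof (elim disjE exE conjE)
          fix i j assume "i + j + 1 \<le> n" "c \<in> cols E f' j q"
          then show ?thesis by (intro disjI2 exI[of _ j]) simp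
        next
          fix i j assume "i + j + 1 \<le> n" "c \<in> cols E f' j p"
          then show ?thesis using cols_le[of j n c E f' p] by simp
        qed (use fd in auto)
      qed
      show ?thesis
      proof (rule infoI)
        fix c
        show "c \<in> insert d K" if "c \<in> cols (insert {p, q} E) f' 0 p"
          using cases[OF that] infoD(1)[OF i(1), of c] by auto
        show "c \<in> insert d K \<or> c \<in> S \<union> K'" if "c \<in> cols (insert {p, q} E) f' 1 p" "strong c"
          using cases[OF that(1)] infoD(2)[OF i(1), of c] infoD(1)[OF i(2), of c] that(2) by auto
        show "(z \<or> X4 \<in> S') \<or> X4 \<in> insert d K \<or> X4 \<in> S \<union> K'" if c: "X4 \<in> cols (insert {p, q} E) f' 2 p"
        proof -
          have "X4 \<in> cols E f' 2 p \<or> X4 = d \<or> X4 \<in> cols E f' 1 q"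
            using cases[OF c] cols_le[of _ 1 X4 E f' q] by fastforce
          then show ?thesis using infoD(3)[OF i(1)] infoD(2)[OF i(2), of X4] by auto
        qed
      qed
    qed
    show "info (insert {a, b} E) f' a (insert d K1) (S1 \<union> K2) (z1 \<or> X4 \<in> S2)" by (rule main[OF refl ia' ib'])
    show "info (insert {a, b} E) f' b (insert d K2) (S2 \<union> K1) (z2 \<or> X4 \<in> S1)"
      using main[of b a, OF insert_commute ib' ia'] by (simp add: insert_commute)
  qed
qed

text \<open>Read at the inner end of a new edge of colour \<open>x\<close>, this says that
  \<open>(x, s, z)\<close> describes the piece from the outer end, from where \<open>K\<close> is
  one step away and \<open>S\<close> two; \<open>fits_leg\<close> makes this precise.\<close>

fun fits :: "leg \<Rightarrow> colour set \<Rightarrow> colour set \<Rightarrow> bool" where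
  "fits (x, s, z) K S \<longleftrightarrow> (\<forall>c\<in>K. strong c \<longrightarrow> c = x \<or> c = s) \<and> (X4 \<in> S \<longrightarrow> wide (x, s, z))"

fun leg :: "'a set set \<Rightarrow> ('a set \<Rightarrow> colour) \<Rightarrow> 'a \<Rightarrow> leg \<Rightarrow> bool" where
  "leg E f v (k, s, z) \<longleftrightarrow> info E f v {k} {s} z"

text \<open>The condition on the leg at \<open>s\<close> once an edge of colour \<open>x\<close> is added at \<open>m\<close>.\<close>

fun left_leg :: "'a set set \<Rightarrow> ('a set \<Rightarrow> colour) \<Rightarrow> 'a \<Rightarrow> 'a \<Rightarrow> colour \<Rightarrow> leg \<Rightarrow> bool" where
  "left_leg E f s m x (k, t, z) \<longleftrightarrow> (\<forall>c\<in>cols E f 0 s. c = k) \<and>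
     (\<forall>c. strong c \<longrightarrow> c \<in> cols E f 1 s \<or> c = x \<and> m \<in> vball E 1 s \<longrightarrow> c = k \<or> c = t) \<and>
     (X4 \<in> cols E f 2 s \<or> x = X4 \<and> m \<in> vball E 2 s \<longrightarrow> wide (k, t, z))"

definition far :: "nat \<Rightarrow> 'a set set \<Rightarrow> 'a \<Rightarrow> 'a \<Rightarrow> bool" where
  "far n E s t \<longleftrightarrow> (\<forall>i. t \<in> vball E i s \<longrightarrow> n \<le> i)"

text \<open>A bridge piece is seen from the outer end of the bridge, and \<open>good_root E w\<close> concerns the same piece without the bridge. In
  \<open>good_open\<close> the last edge of the word, which would leave \<open>m\<close>, is missing, so that it may also be used to close a cycle.\<close>

definition good_bridge :: "'a set set \<Rightarrow> 'a \<Rightarrow> bool" where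
  "good_bridge E u \<longleftrightarrow> (\<forall>p\<in>set bridge_legs. \<exists>f. valid E f \<and> leg E f u p)"

definition good_root :: "'a set set \<Rightarrow> 'a \<Rightarrow> bool" where
  "good_root E w \<longleftrightarrow> (\<forall>p\<in>set bridge_legs. \<exists>f K S y. valid E f \<and> info E f w K S y \<and> admissible (fst p) K S y \<and> fits p K S)"

definition good_word :: "nat \<Rightarrow> 'a set set \<Rightarrow> 'a \<Rightarrow> 'a \<Rightarrow> (leg \<times> leg) list \<Rightarrow> bool" where
  "good_word n E s t F \<longleftrightarrow> graph E \<and> s \<in> \<Union>E \<and> t \<in> \<Union>E \<and> far n E s t \<and>
     (\<forall>(L, R)\<in>set F. \<exists>f. valid E f \<and> leg E f s L \<and> leg E f t R)"

definition open_colouring ::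
    "'a set set \<Rightarrow> ('a set \<Rightarrow> colour) \<Rightarrow> 'a \<Rightarrow> 'a \<Rightarrow> leg \<Rightarrow> leg \<Rightarrow> bool" where
  "open_colouring E f s m L R \<longleftrightarrow> valid E f \<and> left_leg E f s m (fst R) L \<and>
     (\<exists>K S y. info E f m K S y \<and> admissible (fst R) K S y \<and> fits R K S)"

definition good_open :: "nat \<Rightarrow> 'a set set \<Rightarrow> 'a \<Rightarrow> 'a \<Rightarrow> (leg \<times> leg) list \<Rightarrow> bool" where
  "good_open n E s m F \<longleftrightarrow> graph E \<and> s \<in> \<Union>E \<and> m \<in> \<Union>E \<and> far n E s m \<and>
     (\<forall>(L, R)\<in>set F. \<exists>f. open_colouring E f s m L R)"

definition block_colouring ::
    "'a set set \<Rightarrow> ('a set \<Rightarrow> colour) \<Rightarrow> 'a \<Rightarrow> 'a \<Rightarrow> leg \<Rightarrow> leg \<Rightarrow> bool" where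
  "block_colouring E f m m' P Q \<longleftrightarrow> valid E f \<and> (strong (fst P) \<longrightarrow> fst P \<noteq> fst Q) \<and>
     (\<exists>K S y. info E f m K S y \<and> admissible (fst P) K S y \<and> fits P K (insert (fst Q) S)) \<and>
     (\<exists>K S y. info E f m' K S y \<and> admissible (fst Q) K S y \<and> fits Q K (insert (fst P) S))"

definition good_block :: "'a set set \<Rightarrow> 'a \<Rightarrow> 'a \<Rightarrow> (leg \<times> leg) list \<Rightarrow> bool" where
  "good_block E m m' I \<longleftrightarrow> graph E \<and> m \<in> \<Union>E \<and> m' \<in> \<Union>E \<and> m \<noteq> m' \<and>
     (\<forall>(P, Q)\<in>set I. \<exists>f. block_colouring E f m m' P Q)"

lemma legs_fit_compat: "legs_fit (k, s, z) (l, t, y) \<Longrightarrow> compat {k} {s} z {l} {t} y"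
  by (auto simp: compat_def)

lemma joinsD:
  assumes "joins (e, s, z) (k, t, y) (k', t', y')"
  shows "legs_fit (k, t, y) (k', t', y')" "admissible e {k, k'} {t, t'} (y \<or> y')" "fits (e, s, z) {k, k'} {t, t'}"
  using assms by (auto simp: admissible_iff)

lemma leg_info: "leg E f v p \<longleftrightarrow> info E f v {fst p} {fst (snd p)} (snd (snd p))"
  by (cases p) simp

lemma fits_leg:
  assumes "info E f v {x} K (X4 \<in> S)" "fits p K S" "fst p = x"
  shows "leg E f v p"
proof -
  obtain s z where p: "p = (x, s, z)" using assms(3) by (cases p) auto
  have "info E f v {x} {s} z"
  proof (rule infoI)
    fix c
    show "c \<in> cols E f 0 v \<Longrightarrow> c \<in> {x}" using infoD(1)[OF assms(1)] .
    show "c \<in> {x} \<or> c \<in> {s}" if "c \<in> cols E f 1 v" "strong c"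
      using infoD(2)[OF assms(1) that] assms(2) that(2) p by auto
    show "z \<or> X4 \<in> {x} \<or> X4 \<in> {s}" if "X4 \<in> cols E f 2 v"
      using infoD(3)[OF assms(1) that] assms(2) p by auto
  qed
  then show ?thesis by (simp add: p)
qed

text \<open>Legs are only upper bounds, so a missing bridge counts as a bridge piece. This covers
  cycle vertices of degree two and roots with fewer than two branches.\<close>

lemma good_bridge_empty: "good_bridge {} u"
  by (auto simp: good_bridge_def leg_info info_def)

lemma good_bridge_root:
  assumes "good_root E w" "u \<notin> \<Union>E" "u \<noteq> w"
  shows "good_bridge (insert {w, u} E) u"
  unfolding good_bridge_def
proof
  fix p assume "p \<in> set bridge_legs"
  then obtain f K S y where f: "valid E f" "info E f w K S y" "admissible (fst p) K S y" "fits p K S"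
    using assms(1) unfolding good_root_def by blast
  obtain f' where f': "valid (insert {w, u} E) f'" "info (insert {w, u} E) f' u {fst p} K (X4 \<in> S)"
    "\<forall>n. \<forall>v\<in>\<Union>E. \<forall>c\<in>cols (insert {w, u} E) f' n v. c \<in> cols E f n v \<or> c = fst p \<and> w \<in> vball E n v"
    by (rule fresh_edge[OF f(1-3) assms(2,3)])
  show "\<exists>f. valid (insert {w, u} E) f \<and> leg (insert {w, u} E) f u p"
    using f'(1) fits_leg[OF f'(2) f(4) refl] by (intro exI conjI)
qed

lemma good_root_fork:
  assumes g: "glue E H w" "graph E" and B: "good_bridge E w" "good_bridge H w"
  shows "good_root (E \<union> H) w"
  unfolding good_root_def
proof
  fix p assume p: "p \<in> set bridge_legs"
  obtain L R where LR: "L \<in> set bridge_legs" "R \<in> set bridge_legs" "joins p L R"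
    using checks(1) p unfolding check_fork_def list_all_iff list_ex_iff by blast
  obtain k t y where L: "L = (k, t, y)" by (cases L)
  obtain k' t' y' where R: "R = (k', t', y')" by (cases R)
  obtain e s z where P: "p = (e, s, z)" by (cases p)
  note J = joinsD[OF LR(3)[unfolded L R P]]
  obtain f1 where f1: "valid E f1" "info E f1 w {k} {t} y" using B(1) LR(1) L unfolding good_bridge_def by auto
  obtain f2 where f2: "valid H f2" "info H f2 w {k'} {t'} y'" using B(2) LR(2) R unfolding good_bridge_def by auto
  obtain f where f: "valid (E \<union> H) f" "\<forall>e\<in>E. f e = f1 e" "\<forall>e\<in>H. f e = f2 e"
    by (rule glue_colouring[OF g f1(1) f2(1) f1(2) f2(2) legs_fit_compat[OF J(1)]])
  have "info E f w {k} {t} y" "info H f w {k'} {t'} y'"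
    using f1(2) f2(2) by (simp_all add: info_cong[OF bspec[OF f(2)]] info_cong[OF bspec[OF f(3)]])
  from glue_info_at[OF g(1) this] have "info (E \<union> H) f w {k, k'} {t, t'} (y \<or> y')" by (simp add: insert_commute)
  then show "\<exists>f K S y. valid (E \<union> H) f \<and> info (E \<union> H) f w K S y \<and> admissible (fst p) K S y \<and> fits p K S"
    using f(1) J(2,3) P by auto
qed

text \<open>Completes a vertex of degree three by its last piece. This occurs once in each
  component, at the vertex from which it is taken apart.\<close>

lemma good_root_bridge_colourable:
  assumes g: "glue E H w" "graph E" and T: "good_root E w" and B: "good_bridge H w"
  shows "\<exists>f. valid (E \<union> H) f"
proof -
  \<comment> \<open>With this leg the bridge has no colour of positive radius next to its edge of
    colour \<open>X2\<close>, so \<open>admissible\<close> already yields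
    \<open>compat\<close>.\<close>
  have p: "(X2, X0, False) \<in> set bridge_legs" by (simp add: bridge_legs_def)
  obtain f1 K S y where f1: "valid E f1" "info E f1 w K S y" "admissible X2 K S y" "fits (X2, X0, False) K S"
    using T p unfolding good_root_def by fastforce
  obtain f2 where f2: "valid H f2" "info H f2 w {X2} {X0} False"
    using B p unfolding good_bridge_def by fastforce
  have "compat K S y {X2} {X0} False"
    using f1(3,4) unfolding compat_def by auto
  from glue_colouring[OF g f1(1) f2(1) f1(2) f2(2) this] show ?thesis by blast
qed

lemma far_glue:
  assumes g: "glue E H m" and s: "s \<in> \<Union>E" and fr: "far n E s m" and t: "t \<in> \<Union>H" "t \<noteq> m"
  shows "far (Suc n) (E \<union> H) s t"
  unfolding far_def
proof (intro allI impI)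
  fix i assume t': "t \<in> vball (E \<union> H) i s"
  have "t \<notin> \<Union>E" using t g by (auto simp: glue_def)
  moreover have "s \<in> insert m (\<Union>E)" using s by simp
  ultimately obtain a b where ab: "a + b \<le> i" "m \<in> vball E a s" "t \<in> vball H b m"
    using glue.vball_cases[OF g _ t'] t(2) by blast
  have "b \<noteq> 0" using ab(3) t(2) by (cases b) auto
  then show "Suc n \<le> i" using ab fr unfolding far_def by fastforce
qed

lemma far_glue_at:
  assumes g: "glue E H m" and s: "s \<in> \<Union>E" and fr: "far n E s m"
  shows "far n (E \<union> H) s m"
  unfolding far_def
proof (intro allI impI)
  fix i assume t': "m \<in> vball (E \<union> H) i s"
  have "s \<in> insert m (\<Union>E)" using s by simp
  from glue.vball_cases[OF g this t'] show "n \<le> i"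
    using fr unfolding far_def by (meson add_leD1 order_trans)
qed

lemma good_open_fresh:
  assumes Q: "good_open n E s m F" and t: "t \<notin> \<Union>E" "t \<noteq> m" and n: "n \<ge> 1"
  shows "good_word (Suc n) (insert {m, t} E) s t F"
proof -
  let ?E = "insert {m, t} E"
  have Q': "graph E" "s \<in> \<Union>E" "m \<in> \<Union>E" "far n E s m" using Q by (auto simp: good_open_def)
  have g: "glue E {{m, t}} m" using t by (auto simp: glue_def)
  have un: "E \<union> {{m, t}} = ?E" by simp
  show ?thesis
    unfolding good_word_def
  proof (intro conjI ballI)
    show "graph ?E" "s \<in> \<Union>?E" "t \<in> \<Union>?E" using Q' t by auto
    show "far (Suc n) ?E s t" using far_glue[OF g Q'(2,4), of t] t un by simp
    fix LR assume LR: "LR \<in> set F"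
    obtain L R where lr: "LR = (L, R)" by (cases LR)
    obtain k a z where L: "L = (k, a, z)" by (cases L)
    obtain f K S y where f: "valid E f" "info E f m K S y" "admissible (fst R) K S y" "fits R K S"
        "left_leg E f s m (fst R) L"
      using Q LR lr unfolding good_open_def open_colouring_def by blast
    obtain f' where f': "valid ?E f'" "info ?E f' t {fst R} K (X4 \<in> S)"
      and old: "\<forall>n. \<forall>v\<in>\<Union>E. \<forall>c\<in>cols ?E f' n v. c \<in> cols E f n v \<or> c = fst R \<and> m \<in> vball E n v"
      by (rule fresh_edge[OF f(1-3) t])
    have r: "leg ?E f' t R" by (rule fits_leg[OF f'(2) f(4) refl])
    \<comment> \<open>The bound \<open>n \<ge> 1\<close> keeps the new edge from being an edge at
      \<open>s\<close>.\<close>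
    have m0: "m \<notin> vball E 0 s" using Q'(4) n unfolding far_def by fastforce
    have "info ?E f' s {k} {a} z"
    proof (rule infoI)
      fix c
      show "c \<in> {k}" if "c \<in> cols ?E f' 0 s"
        using old[rule_format, OF Q'(2) that] m0 f(5) unfolding L by auto
      show "c \<in> {k} \<or> c \<in> {a}" if "c \<in> cols ?E f' 1 s" "strong c"
        using old[rule_format, OF Q'(2) that(1)] f(5) that(2) unfolding L left_leg.simps by blast
      show "z \<or> X4 \<in> {k} \<or> X4 \<in> {a}" if "X4 \<in> cols ?E f' 2 s"
        using old[rule_format, OF Q'(2) that] f(5) unfolding L left_leg.simps wide.simps by auto
    qed
    then show "case LR of (L, R) \<Rightarrow> \<exists>f. valid ?E f \<and> leg ?E f s L \<and> leg ?E f t R"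
      using f'(1) r lr L by auto
  qed
qed

lemma weakerD:
  assumes "weaker (k, s, z) (k', s', z')"
  shows "k = k'" "strong s \<Longrightarrow> s = s'" "wide (k, s, z) \<Longrightarrow> wide (k', s', z')"
  using assms by auto

lemma good_open_pend:
  assumes W: "good_word n E s m F" and B: "good_bridge H m" and g: "glue E H m" and H: "graph H" and n: "n \<ge> 1"
    and chk: "check_pend n F F'"
  shows "good_open n (E \<union> H) s m F'"
proof -
  have W': "graph E" "s \<in> \<Union>E" "m \<in> \<Union>E" "far n E s m" using W by (auto simp: good_word_def)
  have fr: "far n (E \<union> H) s m" by (rule far_glue_at[OF g W'(2,4)])
  show ?thesis
    unfolding good_open_def
  proof (intro conjI ballI)
    show "graph (E \<union> H)" "s \<in> \<Union>(E \<union> H)" "m \<in> \<Union>(E \<union> H)" using W' H by auto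
    show "far n (E \<union> H) s m" by (rule fr)
    fix LR' assume "LR' \<in> set F'"
    moreover obtain L' R' where lr': "LR' = (L', R')" by (cases LR')
    ultimately have "list_ex (\<lambda>(L, R). weaker L L' \<and> list_ex (\<lambda>b. joins R' R b \<and> left_ok n L L' b (fst R')) bridge_legs) F"
      using chk unfolding check_pend_def list_all_iff by fastforce
    then obtain L R b where LR: "(L, R) \<in> set F" "b \<in> set bridge_legs" "joins R' R b" "left_ok n L L' b (fst R')"
      unfolding list_ex_iff by fastforce
    obtain k t y where R: "R = (k, t, y)" by (cases R)
    obtain k' t' y' where b: "b = (k', t', y')" by (cases b)
    obtain x a z where R': "R' = (x, a, z)" by (cases R')
    obtain kl sl zl where L: "L = (kl, sl, zl)" by (cases L)
    obtain kl' sl' zl' where L': "L' = (kl', sl', zl')" by (cases L')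
    note J = joinsD[OF LR(3)[unfolded R b R']]
    obtain f1 where f1: "valid E f1" "info E f1 s {kl} {sl} zl" "info E f1 m {k} {t} y"
      using W LR(1) R L unfolding good_word_def by fastforce
    obtain f2 where f2: "valid H f2" "info H f2 m {k'} {t'} y'" using B LR(2) b unfolding good_bridge_def by auto
    obtain f where f: "valid (E \<union> H) f" "\<forall>e\<in>E. f e = f1 e" "\<forall>e\<in>H. f e = f2 e"
      by (rule glue_colouring[OF g W'(1) f1(1) f2(1) f1(3) f2(2) legs_fit_compat[OF J(1)]])
    have iE: "info E f m {k} {t} y" and iH: "info H f m {k'} {t'} y'" and iS: "info E f s {kl} {sl} zl"
      using f1 f2(2) by (simp_all add: info_cong[OF bspec[OF f(2)]] info_cong[OF bspec[OF f(3)]])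
    from glue_info_at[OF g iE iH] have im: "info (E \<union> H) f m {k, k'} {t, t'} (y \<or> y')" by (simp add: insert_commute)
    \<comment> \<open>The bridge piece is seen from \<open>s\<close> only through \<open>m\<close>,
      hence from a distance of at least \<open>n\<close>.\<close>
    have old: "c \<in> cols E f j s \<or> (\<exists>i' j'. i' + j' \<le> j \<and> n \<le> i' \<and> c \<in> cols H f j' m)"
      if "c \<in> cols (E \<union> H) f j s" for c j
    proof -
      have "s \<in> insert m (\<Union>E)" using W'(2) by simp
      from glue.cols_cases[OF g this that] show ?thesis using W'(4) unfolding far_def by blast
    qed
    have lo: "weaker (kl, sl, zl) (kl', sl', zl')" "n \<le> 2 \<Longrightarrow> k' = X4 \<or> x = X4 \<Longrightarrow> wide L'"
      "n \<le> 1 \<Longrightarrow> t' = X4 \<Longrightarrow> wide L'" "n \<le> 1 \<Longrightarrow> strong k' \<Longrightarrow> k' = sl'" "n \<le> 1 \<Longrightarrow> strong x \<Longrightarrow> x = sl'"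
      using LR(4) unfolding L L' b R' by (auto simp del: weaker.simps wide.simps)
    note wk = weakerD[OF lo(1)]
    have "left_leg (E \<union> H) f s m x L'"
      unfolding L' left_leg.simps
    proof (intro conjI ballI allI impI)
      fix c assume "c \<in> cols (E \<union> H) f 0 s"
      from old[OF this] have "c \<in> cols E f 0 s" using n by auto
      then show "c = kl'" using infoD(1)[OF iS] wk(1) by blast
    next
      fix c assume st: "strong c" and c: "c \<in> cols (E \<union> H) f 1 s \<or> c = x \<and> m \<in> vball (E \<union> H) 1 s"
      then consider "c \<in> cols E f 1 s" | i' j' where "i' + j' \<le> 1" "n \<le> i'" "c \<in> cols H f j' m"
        | "c = x" "m \<in> vball (E \<union> H) 1 s" using old[of c 1] by blast
      then show "c = kl' \<or> c = sl'"
      proof cases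
        case 1
        then show ?thesis using infoD(2)[OF iS 1 st] wk(1) wk(2) st by auto
      next
        case 2
        then have "j' = 0" "n \<le> 1" using n by auto
        then have "c = k'" using infoD(1)[OF iH] 2 by blast
        then show ?thesis using lo(4)[OF \<open>n \<le> 1\<close>] st by blast
      next
        case 3
        then have "n \<le> 1" using fr unfolding far_def by blast
        then show ?thesis using lo(5) st 3 by blast
      qed
    next
      assume c: "X4 \<in> cols (E \<union> H) f 2 s \<or> x = X4 \<and> m \<in> vball (E \<union> H) 2 s"
      then consider "X4 \<in> cols E f 2 s" | i' j' where "i' + j' \<le> 2" "n \<le> i'" "X4 \<in> cols H f j' m"
        | "x = X4" "m \<in> vball (E \<union> H) 2 s" using old[of X4 2] by blast
      then have "wide L'"
      proof cases
        case 1
        then have "wide (kl, sl, zl)" using infoD(3)[OF iS] by auto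
        then show ?thesis using wk(3) L' by simp
      next
        case 2
        then consider "j' = 0" "n \<le> 2" | "j' = 1" "n \<le> 1" using n by linarith
        then show ?thesis
        proof cases
          case 1
          then have "k' = X4" using infoD(1)[OF iH, of X4] \<open>X4 \<in> cols H f j' m\<close> by simp
          then show ?thesis using lo(2) 1 by blast
        next
          case j: 2
          then have "X4 = k' \<or> X4 = t'" using infoD(2)[OF iH, of X4] \<open>X4 \<in> cols H f j' m\<close> by auto
          then show ?thesis using lo(2,3) j by auto
        qed
      next
        case 3
        then have "n \<le> 2" using fr unfolding far_def by blast
        then show ?thesis using lo(2) 3 by blast
      qed
      then show "wide (kl', sl', zl')" by (simp add: L')
    qed
    then have "open_colouring (E \<union> H) f s m L' R'"
      using f(1) im J(2,3) unfolding open_colouring_def R' fst_conv by blast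
    then show "case LR' of (L, R) \<Rightarrow> \<exists>f. open_colouring (E \<union> H) f s m L R" using lr' by auto
  qed
qed

text \<open>The closing edge is the missing last edge of the open word, so its leg \<open>R\<close>
  has already been prescribed. At \<open>s\<close> it meets the beginning of the word like a second
  piece with leg \<open>R\<close>, which is why the condition is \<open>joins\<close>.\<close>

lemma good_root_cycle:
  assumes Q: "good_open n E s m F" and n: "n \<ge> 2" and chk: "check_cycle F"
  shows "good_root (insert {s, m} E) s"
  unfolding good_root_def
proof
  let ?E = "insert {s, m} E"
  have Q': "graph E" "s \<in> \<Union>E" "m \<in> \<Union>E" "far n E s m" using Q by (auto simp: good_open_def)
  have m1: "m \<notin> vball E 1 s" using Q'(4) n unfolding far_def by fastforce
  fix p assume "p \<in> set bridge_legs"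
  then have "list_ex (\<lambda>(L, R). joins p L R) F"
    using chk unfolding check_cycle_def list_all_iff by blast
  then obtain L R where LR: "(L, R) \<in> set F" "joins p L R" unfolding list_ex_iff by fastforce
  obtain k t y where L: "L = (k, t, y)" by (cases L)
  obtain x a z where R: "R = (x, a, z)" by (cases R)
  obtain e b w where P: "p = (e, b, w)" by (cases p)
  note J = LR(2)[unfolded L R P]
  obtain f K S q where f: "valid E f" "info E f m K S q" "admissible x K S q" "fits (x, a, z) K S" "left_leg E f s m x (k, t, y)"
    using Q LR(1) unfolding good_open_def open_colouring_def L R by fastforce
  have iS: "info E f s {k} {t} y"
    by (rule infoI) (use f(5) in auto)
  have K: "c = x \<or> c = a" if "c \<in> K" "strong c" for c using f(4) that by auto
  have S: "z \<or> x = X4 \<or> a = X4" if "X4 \<in> S" using f(4) that by auto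
  obtain f' where f': "valid ?E f'" "info ?E f' s (insert x {k}) ({t} \<union> K) (y \<or> X4 \<in> S)"
    "info ?E f' m (insert x K) (S \<union> {k}) (q \<or> X4 \<in> {t})"
  proof (rule close_edge[OF f(1) iS f(2) _ f(3) _ _ m1])
    show "admissible x {k} {t} y" using J by (auto simp: admissible_iff)
    show "c \<notin> K" if "strong c" "c \<in> {k}" for c
      using K[of c] that J by auto
    show "sole_common E s m \<or> \<not> (X4 \<in> {k} \<and> X4 \<in> S) \<and> \<not> (X4 \<in> {t} \<and> X4 \<in> K)"
    proof (intro disjI2 conjI notI)
      assume "X4 \<in> {k} \<and> X4 \<in> S"
      then show False using S J by auto
    next
      assume "X4 \<in> {t} \<and> X4 \<in> K"
      then show False using K[of X4] J by auto
    qed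
  qed
  have e: "e \<noteq> k" "e \<noteq> x" "strong e \<Longrightarrow> e \<noteq> t" "strong e \<Longrightarrow> e \<noteq> a" "\<not> (e = X4 \<and> y)" "\<not> (e = X4 \<and> z)"
    using J by simp_all
  have "admissible e (insert x {k}) ({t} \<union> K) (y \<or> X4 \<in> S)"
    unfolding admissible_iff
  proof (intro conjI impI notI)
    assume "e \<in> insert x {k}" then show False using e by simp
  next
    assume "strong e" "e \<in> {t} \<union> K" then show False using e K[of e] by blast
  next
    assume h: "(y \<or> X4 \<in> S) \<and> e = X4"
    then have "z \<or> x = X4 \<or> a = X4" using e(5) S by blast
    then show False using e h by auto
  qed
  moreover have "fits p (insert x {k}) ({t} \<union> K)"
  proof -
    have j: "strong k \<Longrightarrow> k = b" "strong x \<Longrightarrow> x = b" "t = X4 \<or> a = X4 \<Longrightarrow> wide (e, b, w)"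
      using J by simp_all
    have "wide (e, b, w)" if "X4 \<in> {t} \<union> K"
    proof -
      have "t = X4 \<or> a = X4 \<or> x = X4" using that K[of X4] by auto
      then show ?thesis using j by auto
    qed
    then show ?thesis using j(1,2) unfolding P by auto
  qed
  ultimately show "\<exists>f K S y. valid ?E f \<and> info ?E f s K S y \<and> admissible (fst p) K S y \<and> fits p K S"
    using f'(1,2) unfolding P fst_conv by blast
qed

text \<open>Only the chord is coloured here, with \<open>d\<close>. The edges that leave the block
  at \<open>m\<close> and \<open>m'\<close> are merely announced by \<open>P\<close> and
  \<open>Q\<close>, together with the requirement that they get along with each other.\<close>

lemma good_block_block:
  assumes W: "good_word n E m m' F" and n: "n \<ge> 2" and chk: "check_block tri F I" and tri: "tri \<Longrightarrow> sole_common E m m'"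
  shows "good_block (insert {m, m'} E) m m' I"
  unfolding good_block_def
proof (intro conjI ballI)
  let ?E = "insert {m, m'} E"
  have W': "graph E" "m \<in> \<Union>E" "m' \<in> \<Union>E" "far n E m m'" using W by (auto simp: good_word_def)
  have m1: "m' \<notin> vball E 1 m" using W'(4) n unfolding far_def by fastforce
  then show "m \<noteq> m'" by auto
  then show "graph ?E" "m \<in> \<Union>?E" "m' \<in> \<Union>?E" using W' by auto
  fix PQ assume "PQ \<in> set I"
  moreover obtain P Q where pq: "PQ = (P, Q)" by (cases PQ)
  ultimately have "list_ex (\<lambda>(p, q). list_ex (\<lambda>d. block_ok tri P Q p q d) [X0, X1, X2, X3, X4]) F"
    using chk unfolding check_block_def list_all_iff by fastforce
  then obtain p q d where pqd: "(p, q) \<in> set F" "block_ok tri P Q p q d" unfolding list_ex_iff by fastforce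
  obtain l sL zL where P: "P = (l, sL, zL)" by (cases P)
  obtain x sR zR where Q: "Q = (x, sR, zR)" by (cases Q)
  obtain k1 s1 z1 where p: "p = (k1, s1, z1)" by (cases p)
  obtain k2 s2 z2 where q: "q = (k2, s2, z2)" by (cases q)
  obtain f where f: "valid E f" "info E f m {k1} {s1} z1" "info E f m' {k2} {s2} z2"
    using W pqd(1) p q unfolding good_word_def by fastforce
  note b = pqd(2)[unfolded P Q p q block_ok.simps]
  have d: "d \<noteq> k1" "d \<noteq> k2" "strong d \<longrightarrow> d \<noteq> s1 \<and> d \<noteq> s2" "\<not> (d = X4 \<and> (z1 \<or> z2))"
    and k: "strong k1 \<longrightarrow> k1 \<noteq> k2" and nt: "\<not> tri \<longrightarrow> \<not> (k1 = X4 \<and> s2 = X4) \<and> \<not> (k2 = X4 \<and> s1 = X4)"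
    and l: "l \<noteq> k1" "l \<noteq> d" "strong l \<longrightarrow> l \<noteq> s1 \<and> l \<noteq> k2 \<and> l \<noteq> x" "\<not> (l = X4 \<and> (z1 \<or> s2 = X4))"
    and x: "x \<noteq> k2" "x \<noteq> d" "strong x \<longrightarrow> x \<noteq> s2 \<and> x \<noteq> k1" "\<not> (x = X4 \<and> (z2 \<or> s1 = X4))"
    and ft: "strong k1 \<longrightarrow> k1 = sL" "strong d \<longrightarrow> d = sL \<and> d = sR" "strong k2 \<longrightarrow> k2 = sR"
     "s1 = X4 \<or> k2 = X4 \<or> x = X4 \<longrightarrow> wide (l, sL, zL)" "s2 = X4 \<or> k1 = X4 \<or> l = X4 \<longrightarrow> wide (x, sR, zR)"
    by (insert b, (elim conjE, assumption)+)
  obtain f' where f': "valid ?E f'" "info ?E f' m (insert d {k1}) ({s1} \<union> {k2}) (z1 \<or> X4 \<in> {s2})"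
    "info ?E f' m' (insert d {k2}) ({s2} \<union> {k1}) (z2 \<or> X4 \<in> {s1})"
  proof (rule close_edge[OF f _ _ _ _ m1])
    show "admissible d {k1} {s1} z1" "admissible d {k2} {s2} z2" using d unfolding admissible_iff by blast+
    show "c \<notin> {k2}" if "strong c" "c \<in> {k1}" for c using k that by blast
    show "sole_common E m m' \<or> \<not> (X4 \<in> {k1} \<and> X4 \<in> {s2}) \<and> \<not> (X4 \<in> {s1} \<and> X4 \<in> {k2})"
      using nt tri by blast
  qed
  have "admissible l (insert d {k1}) ({s1} \<union> {k2}) (z1 \<or> X4 \<in> {s2})"
    using l unfolding admissible_iff by blast
  moreover have "admissible x (insert d {k2}) ({s2} \<union> {k1}) (z2 \<or> X4 \<in> {s1})"
    using x unfolding admissible_iff by blast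
  moreover have "fits P (insert d {k1}) (insert x ({s1} \<union> {k2}))"
    using ft(1,2,4) unfolding P fits.simps by blast
  moreover have "fits Q (insert d {k2}) (insert l ({s2} \<union> {k1}))"
    using ft(2,3,5) unfolding Q fits.simps by blast
  moreover have "strong l \<longrightarrow> l \<noteq> x" using l by blast
  ultimately have "block_colouring ?E f' m m' P Q"
    using f' unfolding block_colouring_def P Q fst_conv by blast
  then show "case PQ of (P, Q) \<Rightarrow> \<exists>f. block_colouring ?E f m m' P Q" using pq by auto
qed

lemma good_open_chord:
  assumes W: "good_word n E s m F" and I: "good_block B m m' I" and g: "glue E B m" and n: "n \<ge> 2"
    and chk: "check_chord n F I F'"
  shows "good_open (Suc n) (E \<union> B) s m' F'"
proof -
  have W': "graph E" "s \<in> \<Union>E" "m \<in> \<Union>E" "far n E s m" using W by (auto simp: good_word_def)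
  have I': "graph B" "m \<in> \<Union>B" "m' \<in> \<Union>B" "m \<noteq> m'" using I by (auto simp: good_block_def)
  have fr: "far (Suc n) (E \<union> B) s m'" using far_glue[OF g W'(2,4) I'(3)] I'(4) by simp
  have gs: "glue B E m" by (rule glue_sym[OF g])
  show ?thesis
    unfolding good_open_def
  proof (intro conjI ballI)
    show "graph (E \<union> B)" "s \<in> \<Union>(E \<union> B)" "m' \<in> \<Union>(E \<union> B)" using W' I' by auto
    show "far (Suc n) (E \<union> B) s m'" by (rule fr)
    fix LR' assume "LR' \<in> set F'"
    moreover obtain L' R' where lr': "LR' = (L', R')" by (cases LR')
    ultimately have "list_ex (\<lambda>(L, R). weaker L L' \<and> list_ex (\<lambda>(P, Q). chord_ok n L L' R P \<and> weaker Q R') I) F"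
      using chk unfolding check_chord_def list_all_iff by fastforce
    then obtain L R P Q where LR: "(L, R) \<in> set F" "(P, Q) \<in> set I" "chord_ok n L L' R P" "weaker Q R'"
      unfolding list_ex_iff by fastforce
    obtain kl sl zl where L: "L = (kl, sl, zl)" by (cases L)
    obtain kl' sl' zl' where L': "L' = (kl', sl', zl')" by (cases L')
    obtain l' sP zP where P: "P = (l', sP, zP)" by (cases P)
    obtain l s' z where R0: "R = (l, s', z)" by (cases R)
    obtain x sQ zQ where Q: "Q = (x, sQ, zQ)" by (cases Q)
    obtain x' sR zR where R': "R' = (x', sR, zR)" by (cases R')
    have ch: "l = l'" "strong s' \<Longrightarrow> s' \<noteq> sP" "s' = X4 \<Longrightarrow> \<not> wide P" "z \<Longrightarrow> sP \<noteq> X4" "weaker L L'"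
      "n \<le> 2 \<Longrightarrow> sP = X4 \<Longrightarrow> wide L'"
      using LR(3) unfolding L P R0 by (auto simp del: weaker.simps wide.simps)
    have R: "R = (l', s', z)" using R0 ch(1) by simp
    note wl = weakerD[OF ch(5)[unfolded L L']]
    note wr = weakerD[OF LR(4)[unfolded Q R']]
    obtain f1 where f1: "valid E f1" "info E f1 s {kl} {sl} zl" "info E f1 m {l'} {s'} z"
      using W LR(1) unfolding good_word_def L R by fastforce
    obtain f2 K S y K' S' y' where f2: "valid B f2" "info B f2 m K S y" "info B f2 m' K' S' y'"
        "admissible l' K S y" "admissible x K' S' y'" "fits P K (insert x S)" "fits Q K' (insert l' S')" "strong l' \<longrightarrow> l' \<noteq> x"
      using I LR(2) unfolding good_block_def block_colouring_def P Q by fastforce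
    \<comment> \<open>The leg \<open>P\<close> allows \<open>l'\<close> and \<open>sP\<close> at
      \<open>m\<close>, and \<open>l'\<close> is taken by the edge that arrives from the
      word.\<close>
    have K: "c = sP" if "c \<in> K" "strong c" for c
      using f2(4,6) that unfolding P admissible_iff by auto
    have wP: "wide P" if "X4 \<in> insert x S" using f2(6) that unfolding P by auto
    have ok_l: "l' \<notin> K" "strong l' \<Longrightarrow> l' \<notin> S" "\<not> (y \<and> l' = X4)" using f2(4) by (auto simp: admissible_iff)
    have ok_x: "x \<notin> K'" "strong x \<Longrightarrow> x \<notin> S'" "\<not> (y' \<and> x = X4)" using f2(5) by (auto simp: admissible_iff)
    have "compat {l'} {s'} z K S y"
      unfolding compat_def
    proof (intro conjI allI impI notI)
      show "{l'} \<inter> K = {}" using ok_l by simp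
      fix c assume c: "strong c"
      show False if "c \<in> {l'} \<and> c \<in> S" using ok_l(2) that c by auto
      show False if "c \<in> {s'} \<and> c \<in> K" using K[of c] ch(2) that c by auto
    next
      assume "X4 \<in> {s'} \<and> X4 \<in> S" then show False using ch(3) wP by auto
    next
      assume "z \<and> X4 \<in> K" then show False using ch(4) K[of X4] by auto
    next
      assume "y \<and> X4 \<in> {l'}" then show False using ok_l(3) by auto
    qed
    from glue_colouring[OF g W'(1) f1(1) f2(1) f1(3) f2(2) this]
    obtain f where f: "valid (E \<union> B) f" "\<forall>e\<in>E. f e = f1 e" "\<forall>e\<in>B. f e = f2 e" .
    have iE: "info E f m {l'} {s'} z" and iS: "info E f s {kl} {sl} zl"
      and iB: "info B f m K S y" and iB': "info B f m' K' S' y'"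
      using f1 f2(2,3) by (simp_all add: info_cong[OF bspec[OF f(2)]] info_cong[OF bspec[OF f(3)]])
    have at_m': "c \<in> cols B f j m' \<or> (\<exists>j'. j' + 1 \<le> j \<and> c \<in> cols E f j' m)" if "c \<in> cols (E \<union> B) f j m'" for c j
    proof -
      have "m' \<in> insert m (\<Union>B)" using I'(3) by simp
      from glue.cols_cases[OF gs this that[unfolded Un_commute[of E B]]] show ?thesis
      proof (elim disjE exE conjE)
        fix a b assume ab: "a + b \<le> j" "m \<in> vball B a m'" "c \<in> cols E f b m"
        then have "a \<noteq> 0" using I'(4) by (cases a) auto
        then have "b + 1 \<le> j" using ab(1) by simp
        then show ?thesis using ab(3) by blast
      qed simp
    qed
    have im': "info (E \<union> B) f m' K' (insert l' S') (y' \<or> s' = X4)"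
    proof (rule infoI)
      fix c
      show "c \<in> K'" if "c \<in> cols (E \<union> B) f 0 m'" using at_m'[OF that] infoD(1)[OF iB', of c] by auto
      show "c \<in> K' \<or> c \<in> insert l' S'" if "c \<in> cols (E \<union> B) f 1 m'" "strong c"
        using at_m'[OF that(1)] infoD(2)[OF iB', of c] infoD(1)[OF iE, of c] that(2) by auto
      show "(y' \<or> s' = X4) \<or> X4 \<in> K' \<or> X4 \<in> insert l' S'" if c: "X4 \<in> cols (E \<union> B) f 2 m'"
      proof -
        have "X4 \<in> cols B f 2 m' \<or> X4 \<in> cols E f 1 m"
          using at_m'[OF c] cols_le[of _ 1 X4 E f m] by fastforce
        then show ?thesis using infoD(3)[OF iB'] infoD(2)[OF iE, of X4] by auto
      qed
    qed
    have admissible': "admissible x K' (insert l' S') (y' \<or> s' = X4)"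
    proof -
      have "\<not> (s' = X4 \<and> x = X4)" using ch(3) wP by auto
      then show ?thesis using ok_x f2(8) by (auto simp: admissible_iff)
    qed
    have fits': "fits R' K' (insert l' S')"
      unfolding R' fits.simps
    proof (intro conjI ballI impI)
      fix c assume c: "c \<in> K'" "strong c"
      then have "c = x \<or> c = sQ" using f2(7) unfolding Q by auto
      then show "c = x' \<or> c = sR" using wr(1) wr(2) c(2) by auto
    next
      assume "X4 \<in> insert l' S'"
      then have "wide (x, sQ, zQ)" using f2(7) unfolding Q fits.simps by blast
      then show "wide (x', sR, zR)" by (rule wr(3))
    qed
    have far': "\<not> m' \<in> vball (E \<union> B) j s" if "j \<le> 2" for j
      using fr n that unfolding far_def by fastforce
    \<comment> \<open>As \<open>n \<ge> 2\<close>, the block shows within distance 2 of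
      \<open>s\<close> at most its edges at \<open>m\<close>, and these only if
      \<open>n = 2\<close>.\<close>
    have old: "c \<in> cols E f j s \<or> j = 2 \<and> n \<le> 2 \<and> c \<in> cols B f 0 m"
      if c: "c \<in> cols (E \<union> B) f j s" and j: "j \<le> 2" for c j
    proof -
      have "s \<in> insert m (\<Union>E)" using W'(2) by simp
      from glue.cols_cases[OF g this c] show ?thesis
      proof (elim disjE exE conjE)
        fix a b assume ab: "a + b \<le> j" "m \<in> vball E a s" "c \<in> cols B f b m"
        then have "n \<le> a" using W'(4) unfolding far_def by blast
        then have "b = 0" "j = 2" "n \<le> 2" using ab(1) j n by linarith+
        then show ?thesis using ab(3) by blast
      qed simp
    qed
    have "left_leg (E \<union> B) f s m' x L'"
      unfolding L' left_leg.simps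
    proof (intro conjI ballI allI impI)
      fix c assume "c \<in> cols (E \<union> B) f 0 s"
      then have "c \<in> cols E f 0 s" using old[of c 0] by simp
      then show "c = kl'" using infoD(1)[OF iS] wl(1) by blast
    next
      fix c assume st: "strong c" and c: "c \<in> cols (E \<union> B) f 1 s \<or> c = x \<and> m' \<in> vball (E \<union> B) 1 s"
      then have "c \<in> cols E f 1 s" using old[of c 1] far'[of 1] by auto
      then show "c = kl' \<or> c = sl'" using infoD(2)[OF iS _ st] wl(1) wl(2) st by blast
    next
      assume c: "X4 \<in> cols (E \<union> B) f 2 s \<or> x = X4 \<and> m' \<in> vball (E \<union> B) 2 s"
      then have "X4 \<in> cols E f 2 s \<or> n \<le> 2 \<and> X4 \<in> cols B f 0 m" using old[of X4 2] far'[of 2] by blast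
      then show "wide (kl', sl', zl')"
      proof
        assume "X4 \<in> cols E f 2 s"
        then have "wide (kl, sl, zl)" using infoD(3)[OF iS] by auto
        then show ?thesis by (rule wl(3))
      next
        assume a: "n \<le> 2 \<and> X4 \<in> cols B f 0 m"
        then have "X4 \<in> K" using infoD(1)[OF iB] by blast
        then have "sP = X4" using K[of X4] by simp
        then show ?thesis using ch(6) a L' by simp
      qed
    qed
    then have "open_colouring (E \<union> B) f s m' L' R'"
      using f(1) im' admissible' fits' wr(1) unfolding open_colouring_def R' fst_conv by blast
    then show "case LR' of (L, R) \<Rightarrow> \<exists>f. open_colouring (E \<union> B) f s m' L R" using lr' by auto
  qed
qed

text \<open>The word is a single edge, which is also the edge that leaves the block at
  \<open>m\<close>; so the pairs announced by the block are taken over unchanged.\<close>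

lemma good_open_edge_chord:
  assumes I: "good_block B m m' I" and s: "s \<notin> \<Union>B" "s \<noteq> m"
  shows "good_open 2 (insert {m, s} B) s m' I"
proof -
  let ?E = "insert {m, s} B"
  have I': "graph B" "m \<in> \<Union>B" "m' \<in> \<Union>B" "m \<noteq> m'" using I by (auto simp: good_block_def)
  have g: "glue {{m, s}} B m" using s by (auto simp: glue_def)
  have un: "?E = {{m, s}} \<union> B" by simp
  have fe: "far 1 {{m, s}} s m"
    unfolding far_def
  proof (intro allI impI)
    fix i assume "m \<in> vball {{m, s}} i s"
    then show "1 \<le> i" using s(2) by (cases i) auto
  qed
  have "far (Suc 1) ({{m, s}} \<union> B) s m'" by (rule far_glue[OF g _ fe I'(3) I'(4)[symmetric]]) simp
  then have fr: "far 2 ?E s m'" by (simp only: un Suc_1)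
  show ?thesis
    unfolding good_open_def
  proof (intro conjI ballI)
    show "graph ?E" "s \<in> \<Union>?E" "m' \<in> \<Union>?E" using I' s by auto
    show "far 2 ?E s m'" by (rule fr)
    fix PQ assume PQ: "PQ \<in> set I"
    obtain P Q where pq: "PQ = (P, Q)" by (cases PQ)
    obtain l sP zP where P: "P = (l, sP, zP)" by (cases P)
    obtain x sQ zQ where Q: "Q = (x, sQ, zQ)" by (cases Q)
    obtain f2 K S y K' S' y' where f2: "valid B f2" "info B f2 m K S y" "info B f2 m' K' S' y'"
        "admissible l K S y" "admissible x K' S' y'" "fits P K (insert x S)" "fits Q K' (insert l S')" "strong l \<longrightarrow> l \<noteq> x"
      using I PQ unfolding good_block_def block_colouring_def pq P Q by fastforce
    have ie: "info {{m, s}} (\<lambda>_. l) m {l} {} False"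
      by (rule infoI) (auto dest: cols_single)
    have ge: "graph {{m, s}}" using s by simp
    obtain f where f: "valid ({{m, s}} \<union> B) f" "\<forall>e\<in>{{m, s}}. f e = l" "\<forall>e\<in>B. f e = f2 e"
      by (rule glue_colouring[OF g ge valid_single f2(1) ie f2(2,4)])
    have iB: "info B f m K S y" and iB': "info B f m' K' S' y'"
      using f2(2,3) by (simp_all add: info_cong[OF bspec[OF f(3)]])
    have fl: "f {m, s} = l" using f(2) by simp
    have at_m': "c \<in> cols B f j m' \<or> 1 \<le> j \<and> c = l" if c: "c \<in> cols ?E f j m'" for c j
    proof -
      have "m' \<in> insert m (\<Union>B)" using I'(3) by simp
      from glue.cols_cases[OF glue_sym[OF g] this c[unfolded un Un_commute[of _ B]]] show ?thesis
      proof (elim disjE exE conjE)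
        fix a b assume ab: "a + b \<le> j" "m \<in> vball B a m'" "c \<in> cols {{m, s}} f b m"
        then have "a \<noteq> 0" using I'(4) by (cases a) auto
        then have "1 \<le> j" using ab(1) by simp
        then show ?thesis using cols_single[OF ab(3)] fl by simp
      qed simp
    qed
    have im': "info ?E f m' K' (insert l S') y'"
    proof (rule infoI)
      fix c
      show "c \<in> K'" if "c \<in> cols ?E f 0 m'" using at_m'[OF that] infoD(1)[OF iB', of c] by auto
      show "c \<in> K' \<or> c \<in> insert l S'" if "c \<in> cols ?E f 1 m'" "strong c"
        using at_m'[OF that(1)] infoD(2)[OF iB', of c] that(2) by auto
      show "y' \<or> X4 \<in> K' \<or> X4 \<in> insert l S'" if "X4 \<in> cols ?E f 2 m'"
        using at_m'[OF that] infoD(3)[OF iB'] by auto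
    qed
    have admissible': "admissible x K' (insert l S') y'" using f2(5,8) by (auto simp: admissible_iff)
    have old: "c = l \<or> (\<exists>b. b + 1 \<le> j \<and> c \<in> cols B f b m)" if c: "c \<in> cols ?E f j s" for c j
    proof -
      have "s \<in> insert m (\<Union>{{m, s}})" by simp
      from glue.cols_cases[OF g this c[unfolded un]] show ?thesis
      proof (elim disjE exE conjE)
        assume "c \<in> cols {{m, s}} f j s"
        then show ?thesis using cols_single fl by fastforce
      next
        fix a b assume ab: "a + b \<le> j" "m \<in> vball {{m, s}} a s" "c \<in> cols B f b m"
        then have "1 \<le> a" using fe unfolding far_def by blast
        then have "b + 1 \<le> j" using ab(1) by simp
        then show ?thesis using ab(3) by blast
      qed
    qed
    have "left_leg ?E f s m' x P"
      unfolding P left_leg.simps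
    proof (intro conjI ballI allI impI)
      fix c assume "c \<in> cols ?E f 0 s"
      then show "c = l" using old[of c 0] by simp
    next
      fix c assume st: "strong c" and c: "c \<in> cols ?E f 1 s \<or> c = x \<and> m' \<in> vball ?E 1 s"
      have "\<not> m' \<in> vball ?E 1 s" using fr unfolding far_def by fastforce
      then have "c = l \<or> c \<in> cols B f 0 m" using old[of c 1] c by auto
      then have "c = l \<or> c \<in> K" using infoD(1)[OF iB] by blast
      then show "c = l \<or> c = sP" using f2(6) st unfolding P by auto
    next
      assume c: "X4 \<in> cols ?E f 2 s \<or> x = X4 \<and> m' \<in> vball ?E 2 s"
      show "wide (l, sP, zP)"
      proof (cases "x = X4")
        case True
        then show ?thesis using f2(6) unfolding P fits.simps by blast
      next
        case False
        then have "X4 = l \<or> X4 \<in> cols B f 1 m"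
          using c old[of X4 2] cols_le[of _ 1 X4 B f m] by fastforce
        then have "X4 = l \<or> X4 \<in> K \<or> X4 \<in> S" using infoD(2)[OF iB, of X4] by auto
        then show ?thesis using f2(6) unfolding P by auto
      qed
    qed
    then have "open_colouring ?E f s m' P Q"
      using f(1) im' admissible' f2(7) unfolding open_colouring_def un[symmetric] Q fst_conv by blast
    then show "case PQ of (L, R) \<Rightarrow> \<exists>f. open_colouring ?E f s m' L R" using pq by auto
  qed
qed

lemma good_word_edge:
  assumes "s \<noteq> t"
  shows "good_word 1 {{s, t}} s t edge_legs"
  unfolding good_word_def
proof (intro conjI ballI)
  show "graph {{s, t}}" "s \<in> \<Union>{{s, t}}" "t \<in> \<Union>{{s, t}}" using assms by auto
  show "far 1 {{s, t}} s t"
    unfolding far_def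
  proof (intro allI impI)
    fix i assume "t \<in> vball {{s, t}} i s"
    then show "1 \<le> i" using assms by (cases i) auto
  qed
  fix LR assume "LR \<in> set edge_legs"
  then obtain k where k: "LR = ((k, X0, False), (k, X0, False))" by (auto simp: edge_legs_def)
  have "info {{s, t}} (\<lambda>_. k) v {k} {X0} False" for v
    by (rule infoI) (auto dest: cols_single)
  then show "case LR of (L, R) \<Rightarrow> \<exists>f. valid {{s, t}} f \<and> leg {{s, t}} f s L \<and> leg {{s, t}} f t R"
    using k by auto
qed

section \<open>Chorded cycles\<close>

text \<open>The cases are a single edge, one inner vertex, and ends at distance at least 3, beyond
  which the exact distance is forgotten. The second case remembers that a chord between the ends
  would close a triangle.\<close>

definition word :: "'a set set \<Rightarrow> 'a \<Rightarrow> 'a \<Rightarrow> bool" where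
  "word E s t \<longleftrightarrow> s \<noteq> t \<and> E = {{s, t}} \<or> good_word 2 E s t legs0 \<and> sole_common E s t \<or>
     (\<exists>F\<in>{legs1, legs2, legs3}. good_word 3 E s t F)"

text \<open>In the first case there is just an edge with a bridge piece at \<open>m\<close>: it can
  be continued but not closed, as \<open>{s, m}\<close> is already present. Its clause on the edges
  at \<open>s\<close> turns into \<open>sole_common\<close> with the next edge.\<close>

definition open_word :: "'a set set \<Rightarrow> 'a \<Rightarrow> 'a \<Rightarrow> bool" where
  "open_word E s m \<longleftrightarrow> good_open 1 E s m legs0 \<and> {s, m} \<in> E \<and> (\<forall>e\<in>E. s \<in> e \<longrightarrow> m \<in> e) \<or>
     (\<exists>n\<ge>2. \<exists>F\<in>{legs1, legs2, legs3}. good_open n E s m F)"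

lemma far_le: "far n E s t \<Longrightarrow> n' \<le> n \<Longrightarrow> far n' E s t"
  by (auto simp: far_def)

lemma good_word_le: "good_word n E s t F \<Longrightarrow> n' \<le> n \<Longrightarrow> good_word n' E s t F"
  using far_le by (auto simp: good_word_def)

lemma open_word_pend:
  assumes w: "word E s m" and B: "good_bridge H m" "graph H" and g: "glue E H m"
  shows "open_word (E \<union> H) s m"
  using w unfolding word_def
proof (elim disjE conjE bexE)
  assume "s \<noteq> m" and E: "E = {{s, m}}"
  then have W: "good_word 1 E s m edge_legs" using good_word_edge by simp
  have "good_open 1 (E \<union> H) s m legs0"
    by (rule good_open_pend[OF W B(1) g B(2) _ checks(5)]) simp
  moreover have "s \<notin> \<Union>H" using g E \<open>s \<noteq> m\<close> by (auto simp: glue_def)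
  ultimately show ?thesis using E unfolding open_word_def by auto
next
  assume W: "good_word 2 E s m legs0"
  have "good_open 2 (E \<union> H) s m legs1"
    by (rule good_open_pend[OF W B(1) g B(2) _ checks(6)]) simp
  then show ?thesis unfolding open_word_def by blast
next
  fix F assume F: "F \<in> {legs1, legs2, legs3}" and W: "good_word 3 E s m F"
  have "\<exists>F'\<in>{legs1, legs2, legs3}. check_pend 3 F F'" using F checks(7,8,9) by blast
  then obtain F' where F': "F' \<in> {legs1, legs2, legs3}" "check_pend 3 F F'" by blast
  have "good_open 3 (E \<union> H) s m F'"
    by (rule good_open_pend[OF W B(1) g B(2) _ F'(2)]) simp
  then show ?thesis using F'(1) unfolding open_word_def by (intro disjI2 exI[of _ 3]) auto
qed

lemma word_block:
  assumes w: "word E m m'" and nE: "{m, m'} \<notin> E"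
  shows "good_block (insert {m, m'} E) m m' legs1"
  using w unfolding word_def
proof (elim disjE conjE bexE)
  assume "E = {{m, m'}}"
  then show ?thesis using nE by simp
next
  assume W: "good_word 2 E m m' legs0" and t: "sole_common E m m'"
  show ?thesis by (rule good_block_block[OF W _ checks(10)]) (use t in simp_all)
next
  fix F assume F: "F \<in> {legs1, legs2, legs3}" and W: "good_word 3 E m m' F"
  have chk: "check_block False F legs1" using F checks(11,12,13) by blast
  show ?thesis by (rule good_block_block[OF W _ chk]) simp_all
qed

lemma open_word_chord:
  assumes w: "word E s m" and I: "good_block B m m' legs1" and g: "glue E B m"
  shows "open_word (E \<union> B) s m'"
  using w unfolding word_def
proof (elim disjE conjE bexE)
  assume "s \<noteq> m" and E: "E = {{s, m}}"
  moreover have "s \<notin> \<Union>B" using g E \<open>s \<noteq> m\<close> by (auto simp: glue_def)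
  ultimately have "good_open 2 (insert {m, s} B) s m' legs1" using good_open_edge_chord[OF I] by blast
  moreover have "insert {m, s} B = E \<union> B" using E by (auto simp: insert_commute)
  ultimately show ?thesis unfolding open_word_def by auto
next
  assume W: "good_word 2 E s m legs0"
  have "good_open (Suc 2) (E \<union> B) s m' legs2"
    by (rule good_open_chord[OF W I g _ checks(14)]) simp
  then show ?thesis unfolding open_word_def by (intro disjI2 exI[of _ "Suc 2"]) auto
next
  fix F assume F: "F \<in> {legs1, legs2, legs3}" and W: "good_word 3 E s m F"
  have chk: "check_chord 3 F legs1 legs1" using F checks(15,16,17) by blast
  have "good_open (Suc 3) (E \<union> B) s m' legs1"
    by (rule good_open_chord[OF W I g _ chk]) simp
  then show ?thesis unfolding open_word_def by (intro disjI2 exI[of _ "Suc 3"]) auto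
qed

lemma word_fresh:
  assumes w: "open_word E s m" and t: "t \<notin> \<Union>E" "t \<noteq> m"
  shows "word (insert {m, t} E) s t"
  using w unfolding open_word_def
proof (elim disjE conjE bexE exE)
  assume Q: "good_open 1 E s m legs0" and e: "{s, m} \<in> E" "\<forall>e\<in>E. s \<in> e \<longrightarrow> m \<in> e"
  have "good_word (Suc 1) (insert {m, t} E) s t legs0" by (rule good_open_fresh[OF Q t]) simp
  moreover have "sole_common (insert {m, t} E) s t"
    unfolding sole_common_def using e(2) t by (intro exI[of _ m]) auto
  ultimately show ?thesis unfolding word_def by (simp add: numeral_2_eq_2)
next
  fix n F assume n: "n \<ge> 2" and F: "F \<in> {legs1, legs2, legs3}" and Q: "good_open n E s m F"
  have "good_word (Suc n) (insert {m, t} E) s t F" by (rule good_open_fresh[OF Q t]) (use n in simp)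
  then have "good_word 3 (insert {m, t} E) s t F" by (rule good_word_le) (use n in simp)
  then show ?thesis using F unfolding word_def by blast
qed

lemma open_word_close:
  assumes w: "open_word E s m" and nE: "{s, m} \<notin> E"
  shows "good_root (insert {s, m} E) s"
  using w unfolding open_word_def
proof (elim disjE conjE bexE exE)
  fix n F assume n: "n \<ge> 2" and F: "F \<in> {legs1, legs2, legs3}" and Q: "good_open n E s m F"
  have chk: "check_cycle F" using F checks(2,3,4) by blast
  show ?thesis by (rule good_root_cycle[OF Q n chk])
qed (use nE in simp)

section \<open>A cycle with noncrossing chords and bridges, cut open at one vertex\<close>

locale chorded_cycle =
  fixes c :: "nat \<Rightarrow> 'a" and n :: nat and chord :: "nat \<Rightarrow> nat \<Rightarrow> bool" and H :: "nat \<Rightarrow> 'a set set"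
  assumes inj: "inj_on c {..<n}"
    and H_graph: "\<And>k. graph (H k)"
    and H_good: "\<And>k. k < n \<Longrightarrow> good_bridge (H k) (c k)"
    and H_disjoint: "\<And>k l. k < n \<Longrightarrow> l < n \<Longrightarrow> k \<noteq> l \<Longrightarrow> \<Union>(H k) \<inter> \<Union>(H l) = {}"
    and H_cycle: "\<And>k l. k < n \<Longrightarrow> l < n \<Longrightarrow> c l \<in> \<Union>(H k) \<Longrightarrow> l = k"
    and chord_less: "\<And>i j. chord i j \<Longrightarrow> i < n"
    and chord_sym: "\<And>i j. chord i j \<Longrightarrow> chord j i"
    and chord_Suc: "\<And>i j. chord i j \<Longrightarrow> j \<noteq> Suc i \<and> j \<noteq> i"
    and chord_unique: "\<And>i j k. chord i j \<Longrightarrow> chord i k \<Longrightarrow> j = k"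
    and chord_H: "\<And>i j. chord i j \<Longrightarrow> H i = {}"
    and noncrossing: "\<And>i j k l. chord i j \<Longrightarrow> chord k l \<Longrightarrow> i < k \<Longrightarrow> k < j \<Longrightarrow> i < l \<and> l < j"
begin

text \<open>The path edge that ends in \<open>c j\<close> is missing. For \<open>j = n\<close> the
  edge from \<open>c (n - 1)\<close> back to \<open>c 0\<close> takes its place, so no vertex with
  index \<open>n\<close> is required. Chords and bridge pieces at \<open>c i\<close> are left to the
  surrounding assembly.\<close>

definition open_edges :: "nat \<Rightarrow> nat \<Rightarrow> 'a set set" where
  "open_edges i j = {{c k, c (Suc k)} | k. i \<le> k \<and> Suc k < j} \<union>
     {{c a, c b} | a b. chord a b \<and> i < a \<and> a < j \<and> i < b \<and> b < j} \<union> (\<Union>k\<in>{i<..<j}. H k)"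

definition word_edges :: "nat \<Rightarrow> nat \<Rightarrow> 'a set set" where
  "word_edges i j = {{c k, c (Suc k)} | k. i \<le> k \<and> k < j} \<union>
     {{c a, c b} | a b. chord a b \<and> i < a \<and> a < j \<and> i < b \<and> b < j} \<union> (\<Union>k\<in>{i<..<j}. H k)"

definition closed_interval :: "nat \<Rightarrow> nat \<Rightarrow> bool" where
  "closed_interval i j \<longleftrightarrow> (\<forall>a b. chord a b \<longrightarrow> i < a \<longrightarrow> a < j \<longrightarrow> i < b \<and> b < j)"

lemma c_eq: "k < n \<Longrightarrow> l < n \<Longrightarrow> c k = c l \<longleftrightarrow> k = l"
  using inj by (auto dest: inj_onD)

lemma word_edges_cases [consumes 1, case_names path chord hang]:
  assumes "e \<in> word_edges i j"
  obtains k where "i \<le> k" "k < j" "e = {c k, c (Suc k)}"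
    | a b where "chord a b" "i < a" "a < j" "i < b" "b < j" "e = {c a, c b}"
    | k where "i < k" "k < j" "e \<in> H k"
  using assms unfolding word_edges_def Un_iff UN_iff mem_Collect_eq by (elim disjE exE conjE bexE) auto

lemma open_edges_cases [consumes 1, case_names path chord hang]:
  assumes "e \<in> open_edges i j"
  obtains k where "i \<le> k" "Suc k < j" "e = {c k, c (Suc k)}"
    | a b where "chord a b" "i < a" "a < j" "i < b" "b < j" "e = {c a, c b}"
    | k where "i < k" "k < j" "e \<in> H k"
  using assms unfolding open_edges_def Un_iff UN_iff mem_Collect_eq by (elim disjE exE conjE bexE) auto

lemma word_edges_vertices:
  assumes "v \<in> \<Union>(word_edges i j)"
  shows "(\<exists>k. i \<le> k \<and> k \<le> j \<and> v = c k) \<or> (\<exists>k. i < k \<and> k < j \<and> v \<in> \<Union>(H k))"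
proof -
  obtain e where e: "e \<in> word_edges i j" "v \<in> e" using assms by blast
  from e(1) show ?thesis
  proof (cases rule: word_edges_cases)
    case (path k)
    then have "v = c k \<or> v = c (Suc k)" "i \<le> k \<and> k \<le> j" "i \<le> Suc k \<and> Suc k \<le> j" using e(2) by auto
    then show ?thesis by blast
  next
    case (chord a b)
    then have "v = c a \<or> v = c b" "i \<le> a \<and> a \<le> j" "i \<le> b \<and> b \<le> j" using e(2) by auto
    then show ?thesis by blast
  next
    case (hang k)
    then show ?thesis using e(2) by blast
  qed
qed

lemma open_edges_vertices:
  assumes "v \<in> \<Union>(open_edges i j)"
  shows "(\<exists>k. i \<le> k \<and> k < j \<and> v = c k) \<or> (\<exists>k. i < k \<and> k < j \<and> v \<in> \<Union>(H k))"
proof -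
  obtain e where e: "e \<in> open_edges i j" "v \<in> e" using assms by blast
  from e(1) show ?thesis
  proof (cases rule: open_edges_cases)
    case (path k)
    then have "v = c k \<or> v = c (Suc k)" "i \<le> k \<and> k < j" "i \<le> Suc k \<and> Suc k < j" using e(2) by auto
    then show ?thesis by blast
  next
    case (chord a b)
    then have "v = c a \<or> v = c b" "i \<le> a \<and> a < j" "i \<le> b \<and> b < j" using e(2) by auto
    then show ?thesis by blast
  next
    case (hang k)
    then show ?thesis using e(2) by blast
  qed
qed

text \<open>Ensures that the chord by which a word is closed up is a new edge.\<close>

lemma edge_in_word_edges:
  assumes "{c k, c m} \<in> word_edges k m" "Suc k < m" "m < n"
  shows False
proof -
  have kn: "k < n" using assms by simp
  from assms(1) show False
  proof (cases rule: word_edges_cases)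
    case (path l)
    then have "l < n" "Suc l < n" using assms by auto
    then show False using path assms kn by (auto simp: doubleton_eq_iff c_eq)
  next
    case (chord a b)
    then have "a < n" "b < n" using assms by auto
    then show False using chord assms kn by (auto simp: doubleton_eq_iff c_eq)
  next
    case (hang l)
    then have "c k \<in> \<Union>(H l)" by blast
    then have "k = l" using H_cycle[of l k] hang assms kn by simp
    then show False using hang by simp
  qed
qed

lemma glue_word_edges_H:
  assumes "i < m" "m < n"
  shows "glue (word_edges i m) (H m) (c m)"
  unfolding glue_def
proof
  fix v assume v: "v \<in> \<Union>(word_edges i m) \<inter> \<Union>(H m)"
  then consider k where "i \<le> k" "k \<le> m" "v = c k" | k where "i < k" "k < m" "v \<in> \<Union>(H k)"
    using word_edges_vertices by blast
  then show "v \<in> {c m}"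
  proof cases
    case 1
    then show ?thesis using H_cycle[of m k] v assms by auto
  next
    case 2
    then show ?thesis using H_disjoint[of k m] v assms by auto
  qed
qed

lemma glue_word_edges_word_edges:
  assumes "i < k" "k < m" "m < n" "H k = {}"
  shows "glue (word_edges i k) (insert {c k, c m} (word_edges k m)) (c k)"
  unfolding glue_def
proof
  fix v assume v: "v \<in> \<Union>(word_edges i k) \<inter> \<Union>(insert {c k, c m} (word_edges k m))"
  then have 1: "(\<exists>l. i \<le> l \<and> l \<le> k \<and> v = c l) \<or> (\<exists>l. i < l \<and> l < k \<and> v \<in> \<Union>(H l))"
    using word_edges_vertices by blast
  have 2: "(\<exists>l. k \<le> l \<and> l \<le> m \<and> v = c l) \<or> (\<exists>l. k < l \<and> l < m \<and> v \<in> \<Union>(H l))"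
  proof -
    have "v = c k \<or> v = c m \<or> v \<in> \<Union>(word_edges k m)" using v by auto
    then show ?thesis
    proof (elim disjE)
      assume "v = c k"
      then show ?thesis using assms(2) by (intro disjI1 exI[of _ k]) simp
    next
      assume "v = c m"
      then show ?thesis using assms(2) by (intro disjI1 exI[of _ m]) simp
    qed (rule word_edges_vertices)
  qed
  from 1 show "v \<in> {c k}"
  proof (elim disjE exE conjE)
    fix l assume l: "i \<le> l" "l \<le> k" "v = c l"
    from 2 show ?thesis
    proof (elim disjE exE conjE)
      fix l' assume "k \<le> l'" "l' \<le> m" "v = c l'"
      then have "l = l'" using l assms c_eq[of l l'] by simp
      then show ?thesis using l \<open>k \<le> l'\<close> by simp
    next
      fix l' assume "k < l'" "l' < m" "v \<in> \<Union>(H l')"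
      then show ?thesis using l assms H_cycle[of l' l] by simp
    qed
  next
    fix l assume l: "i < l" "l < k" "v \<in> \<Union>(H l)"
    from 2 show ?thesis
    proof (elim disjE exE conjE)
      fix l' assume "k \<le> l'" "l' \<le> m" "v = c l'"
      then show ?thesis using l assms H_cycle[of l l'] by simp
    next
      fix l' assume l': "k < l'" "l' < m" "v \<in> \<Union>(H l')"
      then have "\<Union>(H l) \<inter> \<Union>(H l') = {}" using l assms by (intro H_disjoint) auto
      then show ?thesis using l l' by blast
    qed
  qed
qed

lemma open_edges_pend:
  assumes "i < m" "\<And>b. \<not> chord m b"
  shows "open_edges i (Suc m) = word_edges i m \<union> H m"
proof -
  have m: "\<not> chord b m" for b using assms(2) chord_sym by blast
  have a: "a < m" if "chord a b" "a < Suc m" for a b using that assms(2) by (cases "a = m") auto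
  have b: "b < m" if "chord a b" "b < Suc m" for a b using that m by (cases "b = m") auto
  have "{{c a, c b} | a b. chord a b \<and> i < a \<and> a < Suc m \<and> i < b \<and> b < Suc m} =
    {{c a, c b} | a b. chord a b \<and> i < a \<and> a < m \<and> i < b \<and> b < m}"
    using a b less_SucI by blast
  moreover have "{i<..<Suc m} = insert m {i<..<m}" using assms(1) by auto
  ultimately show ?thesis unfolding open_edges_def word_edges_def by (simp add: Un_assoc Un_commute[of "H m"])
qed

text \<open>Since chords do not cross and no vertex has two of them, the chord from \<open>m\<close>
  back to \<open>k\<close> separates the others into those before \<open>k\<close> and those below
  it.\<close>

lemma open_edges_chord:
  assumes "i < k" "Suc k < m" "chord m k" "closed_interval i (Suc m)"
  shows "open_edges i (Suc m) = word_edges i k \<union> insert {c k, c m} (word_edges k m)"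
    "closed_interval i k" "closed_interval k m"
proof -
  have km: "chord k m" using assms(3) chord_sym by blast
  have Hk: "H k = {}" "H m = {}" using chord_H km assms(3) by blast+
  have inner: "k < b \<and> b < m" if "chord a b" "k < a" "a < m" for a b
    using noncrossing[OF km that(1)] that by blast
  then show "closed_interval k m" unfolding closed_interval_def by blast
  have left: "i < b \<and> b < k" if ab: "chord a b" "i < a" "a < k" for a b
  proof -
    have b: "i < b" "b < Suc m" using assms(4) ab assms(2) unfolding closed_interval_def by auto
    have "b \<noteq> k" using chord_unique[OF km, of a] chord_sym[OF ab(1)] ab assms(2) by auto
    moreover have "b \<noteq> m" using chord_unique[OF assms(3), of a] chord_sym[OF ab(1)] ab by auto
    moreover have "\<not> (k < b \<and> b < m)" using inner[OF chord_sym[OF ab(1)]] ab by auto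
    ultimately show ?thesis using b by auto
  qed
  then show "closed_interval i k" unfolding closed_interval_def by blast
  have three: "(a = k \<and> b = m) \<or> (a = m \<and> b = k) \<or> (i < a \<and> a < k \<and> i < b \<and> b < k) \<or> (k < a \<and> a < m \<and> k < b \<and> b < m)"
    if ab: "chord a b" "i < a" "a < Suc m" for a b
  proof -
    consider "a < k" | "a = k" | "k < a" "a < m" | "a = m" using ab by linarith
    then show ?thesis
    proof cases
      case 1 then show ?thesis using left ab by blast
    next
      case 2 then show ?thesis using chord_unique[OF km] ab by blast
    next
      case 3 then show ?thesis using inner ab by blast
    next
      case 4 then show ?thesis using chord_unique[OF assms(3)] ab by blast
    qed
  qed
  show "open_edges i (Suc m) = word_edges i k \<union> insert {c k, c m} (word_edges k m)"
  proof
    show "open_edges i (Suc m) \<subseteq> word_edges i k \<union> insert {c k, c m} (word_edges k m)"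
    proof
      fix e assume "e \<in> open_edges i (Suc m)"
      then show "e \<in> word_edges i k \<union> insert {c k, c m} (word_edges k m)"
      proof (cases rule: open_edges_cases)
        case 1: (path l)
        show ?thesis
        proof (cases "l < k")
          case True then have "e \<in> word_edges i k" using 1 unfolding word_edges_def by blast
          then show ?thesis by blast
        next
          case False then have "k \<le> l" "l < m" using 1 by auto
          then have "e \<in> word_edges k m" using 1(3) unfolding word_edges_def by blast
          then show ?thesis by blast
        qed
      next
        case 2: (chord a b)
        from three[OF 2(1-3)] show ?thesis
        proof (elim disjE conjE)
          assume "i < a" "a < k" "i < b" "b < k"
          then have "e \<in> word_edges i k" using 2 unfolding word_edges_def by blast
          then show ?thesis by blast
        next
          assume "k < a" "a < m" "k < b" "b < m"
          then have "e \<in> word_edges k m" using 2 unfolding word_edges_def by blast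
          then show ?thesis by blast
        qed (use 2 in \<open>auto simp: insert_commute\<close>)
      next
        case 3: (hang l)
        then have "l \<noteq> k" "l \<noteq> m" using Hk by auto
        then consider "l < k" | "k < l" "l < m" using 3 by linarith
        then show ?thesis
        proof cases
          case 1
          then have "e \<in> word_edges i k" using 3 unfolding word_edges_def by auto
          then show ?thesis by blast
        next
          case 2
          then have "e \<in> word_edges k m" using 3 unfolding word_edges_def by auto
          then show ?thesis by blast
        qed
      qed
    qed
    have "word_edges i k \<subseteq> open_edges i (Suc m)"
    proof -
      have "{{c l, c (Suc l)} | l. i \<le> l \<and> l < k} \<subseteq> {{c l, c (Suc l)} | l. i \<le> l \<and> Suc l < Suc m}"
        using assms(2) by fastforce
      moreover have "{{c a, c b} | a b. chord a b \<and> i < a \<and> a < k \<and> i < b \<and> b < k} \<subseteq>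
          {{c a, c b} | a b. chord a b \<and> i < a \<and> a < Suc m \<and> i < b \<and> b < Suc m}"
        using assms(2) by fastforce
      moreover have "(\<Union>l\<in>{i<..<k}. H l) \<subseteq> (\<Union>l\<in>{i<..<Suc m}. H l)" using assms(2) by fastforce
      ultimately show ?thesis unfolding word_edges_def open_edges_def by (intro Un_mono)
    qed
    moreover have "word_edges k m \<subseteq> open_edges i (Suc m)"
    proof -
      have "{{c l, c (Suc l)} | l. k \<le> l \<and> l < m} \<subseteq> {{c l, c (Suc l)} | l. i \<le> l \<and> Suc l < Suc m}"
        using assms(1) by fastforce
      moreover have "{{c a, c b} | a b. chord a b \<and> k < a \<and> a < m \<and> k < b \<and> b < m} \<subseteq>
          {{c a, c b} | a b. chord a b \<and> i < a \<and> a < Suc m \<and> i < b \<and> b < Suc m}"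
        using assms(1) by fastforce
      moreover have "(\<Union>l\<in>{k<..<m}. H l) \<subseteq> (\<Union>l\<in>{i<..<Suc m}. H l)" using assms(1) by fastforce
      ultimately show ?thesis unfolding word_edges_def open_edges_def by (intro Un_mono)
    qed
    moreover have "{c k, c m} \<in> open_edges i (Suc m)"
    proof -
      have "{c k, c m} \<in> {{c a, c b} | a b. chord a b \<and> i < a \<and> a < Suc m \<and> i < b \<and> b < Suc m}"
        by (intro CollectI exI[of _ k] exI[of _ m]) (use km assms(1,2) in simp)
      then show ?thesis unfolding open_edges_def by simp
    qed
    ultimately show "word_edges i k \<union> insert {c k, c m} (word_edges k m) \<subseteq> open_edges i (Suc m)" by blast
  qed
qed

lemma word_edges_open_edges:
  assumes "i < m" "m' = Suc m"
  shows "word_edges i m' = insert {c m, c m'} (open_edges i m')"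
proof -
  have "{{c k, c (Suc k)} | k. i \<le> k \<and> k < m'} = insert {c m, c m'} {{c k, c (Suc k)} | k. i \<le> k \<and> Suc k < m'}"
    using assms by (auto simp: less_Suc_eq)
  then show ?thesis unfolding word_edges_def open_edges_def by simp
qed

text \<open>The last vertex \<open>m\<close> decides. Without a chord it carries a bridge piece,
  possibly empty; otherwise its chord goes back to some \<open>k\<close> and closes up the shorter
  word from \<open>k\<close> to \<open>m\<close>. Only \<open>m < n\<close> is assumed, so this
  applies to the whole cycle as well.\<close>

lemma open_word_open_edges:
  assumes "i < m" "m < n" "closed_interval i (Suc m)"
    and IH: "\<And>k l. i \<le> k \<Longrightarrow> k < l \<Longrightarrow> l \<le> m \<Longrightarrow> closed_interval k l \<Longrightarrow> word (word_edges k l) (c k) (c l)"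
  shows "open_word (open_edges i (Suc m)) (c i) (c m)"
proof (cases "\<exists>k. chord m k")
  case False
  have "closed_interval i m"
    unfolding closed_interval_def
  proof (intro allI impI)
    fix a b assume ab: "chord a b" "i < a" "a < m"
    then have "i < b" "b < Suc m" using assms(3) unfolding closed_interval_def by auto
    moreover have "b \<noteq> m" using chord_sym[OF ab(1)] False by blast
    ultimately show "i < b \<and> b < m" by simp
  qed
  then have "word (word_edges i m) (c i) (c m)" using IH assms(1) by blast
  then show ?thesis
    unfolding open_edges_pend[OF assms(1), OF False[unfolded not_ex, rule_format]]
    by (rule open_word_pend[OF _ H_good H_graph glue_word_edges_H]) (use assms in auto)
next
  case True
  then obtain k where k: "chord m k" by blast
  have ik: "i < k" "k < Suc m" using assms(3) k assms(1) unfolding closed_interval_def by blast+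
  have sk: "Suc k < m" using chord_Suc[OF k] chord_Suc[OF chord_sym[OF k]] ik by linarith
  note O = open_edges_chord[OF ik(1) sk k assms(3)]
  have w1: "word (word_edges i k) (c i) (c k)" using IH[of i k] O(2) ik sk by simp
  have w2: "word (word_edges k m) (c k) (c m)" using IH[of k m] O(3) ik sk by simp
  have "good_block (insert {c k, c m} (word_edges k m)) (c k) (c m) legs1"
    by (rule word_block[OF w2]) (use edge_in_word_edges sk assms in blast)
  from open_word_chord[OF w1 this glue_word_edges_word_edges] show ?thesis
    unfolding O(1) using ik sk assms chord_H[OF chord_sym[OF k]] by simp
qed

lemma word_word_edges: "i < j \<Longrightarrow> j < n \<Longrightarrow> closed_interval i j \<Longrightarrow> word (word_edges i j) (c i) (c j)"
proof (induction "j - i" arbitrary: i j rule: less_induct)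
  case less
  show ?case
  proof (cases "j = Suc i")
    case True
    have "word_edges i j = {{c i, c j}}" unfolding word_edges_def True by (auto simp: less_Suc_eq)
    moreover have "c i \<noteq> c j" using less.prems c_eq[of i j] by simp
    ultimately show ?thesis unfolding word_def by simp
  next
    case False
    define m where "m = j - 1"
    have m: "j = Suc m" "i < m" using False less.prems by (auto simp: m_def)
    have "open_word (open_edges i (Suc m)) (c i) (c m)"
    proof (rule open_word_open_edges)
      show "i < m" "m < n" "closed_interval i (Suc m)" using m less.prems by auto
      fix k l assume "i \<le> k" "k < l" "l \<le> m" "closed_interval k l"
      then show "word (word_edges k l) (c k) (c l)" using less.hyps[of l k] less.prems m by simp
    qed
    then have "word (insert {c m, c j} (open_edges i j)) (c i) (c j)"
      unfolding m(1)[symmetric]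
    proof (rule word_fresh)
      show "c j \<noteq> c m" using m less.prems c_eq[of j m] by simp
      show "c j \<notin> \<Union>(open_edges i j)"
      proof
        assume "c j \<in> \<Union>(open_edges i j)"
        from open_edges_vertices[OF this] show False
        proof (elim disjE exE conjE)
          fix k assume "i \<le> k" "k < j" "c j = c k"
          then show False using less.prems c_eq[of j k] by simp
        next
          fix k assume "i < k" "k < j" "c j \<in> \<Union>(H k)"
          then show False using less.prems H_cycle[of k j] by simp
        qed
      qed
    qed
    then show ?thesis using word_edges_open_edges[OF m(2,1)] by simp
  qed
qed

text \<open>The cycle is cut open at index 0. Because no chord starts there, the whole range is a
  closed interval.\<close>

lemma good_root_chorded_cycle:
  assumes n: "n \<ge> 3" and c0: "\<And>b. \<not> chord 0 b"
  shows "good_root (insert {c 0, c (n - 1)} (open_edges 0 n)) (c 0)"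
proof -
  have n1: "Suc (n - 1) = n" using n by simp
  have cl: "closed_interval 0 n"
    unfolding closed_interval_def
  proof (intro allI impI)
    fix a b assume "chord a b"
    then have ba: "chord b a" by (rule chord_sym)
    have "b \<noteq> 0" using ba c0[of a] by (cases "b = 0") simp_all
    then show "0 < b \<and> b < n" using chord_less[OF ba] by simp
  qed
  have "open_word (open_edges 0 (Suc (n - 1))) (c 0) (c (n - 1))"
    by (rule open_word_open_edges) (use n cl n1 word_word_edges in auto)
  then have "open_word (open_edges 0 n) (c 0) (c (n - 1))" by (simp only: n1)
  then show ?thesis
  proof (rule open_word_close)
    show "{c 0, c (n - 1)} \<notin> open_edges 0 n"
    proof
      assume "{c 0, c (n - 1)} \<in> open_edges 0 n"
      then show False
      proof (cases rule: open_edges_cases)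
        case (path l)
        then show False using n by (auto simp: doubleton_eq_iff c_eq)
      next
        case (chord a b)
        then show False using n by (auto simp: doubleton_eq_iff c_eq)
      next
        case (hang l)
        then have "c 0 \<in> \<Union>(H l)" by blast
        then show False using H_cycle[of l 0] hang n by simp
      qed
    qed
  qed
qed

end

section \<open>Maximal cycles\<close>

lemma pedges_append_ne:
  "xs \<noteq> [] \<Longrightarrow> ys \<noteq> [] \<Longrightarrow> pedges (xs @ ys) = pedges xs \<union> insert {last xs, hd ys} (pedges ys)"
proof (induction xs rule: pedges.induct)
  case ("2_2" v)
  then show ?case by (cases ys) auto
qed auto

lemma pedges_nth: "pedges xs = {{xs ! i, xs ! Suc i} | i. Suc i < length xs}"
proof (induction xs rule: pedges.induct)
  case (1 x y zs)
  have "{{(x # y # zs) ! i, (x # y # zs) ! Suc i} | i. Suc i < length (x # y # zs)} =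
    insert {x, y} {{(y # zs) ! i, (y # zs) ! Suc i} | i. Suc i < length (y # zs)}" (is "?A = insert _ ?B")
  proof (intro equalityI subsetI)
    fix e assume "e \<in> ?A"
    then obtain i where i: "Suc i < length (x # y # zs)" "e = {(x # y # zs) ! i, (x # y # zs) ! Suc i}" by blast
    then show "e \<in> insert {x, y} ?B" by (cases i) auto
  next
    fix e assume "e \<in> insert {x, y} ?B"
    then consider "e = {x, y}" | i where "Suc i < length (y # zs)" "e = {(y # zs) ! i, (y # zs) ! Suc i}" by blast
    then show "e \<in> ?A"
    proof cases
      case 1
      then show ?thesis by (intro CollectI exI[of _ 0]) simp
    next
      case 2
      then show ?thesis by (intro CollectI exI[of _ "Suc i"]) simp
    qed
  qed
  then show ?case using 1 by simp
qed auto

lemma theta_free_subset: "theta_free E \<Longrightarrow> F \<subseteq> E \<Longrightarrow> theta_free F"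
  unfolding theta_free_def gpath_def by (meson order_trans)

lemma crossing_free_subset: "crossing_free E \<Longrightarrow> F \<subseteq> E \<Longrightarrow> crossing_free F"
  unfolding crossing_free_def gpath_def by (meson order_trans subsetD)

section \<open>Cycles as vertex lists and their ears\<close>

definition cedges :: "'a list \<Rightarrow> 'a set set" where
  "cedges cs = insert {last cs, hd cs} (pedges cs)"

definition cycle :: "'a set set \<Rightarrow> 'a list \<Rightarrow> bool" where
  "cycle E cs \<longleftrightarrow> distinct cs \<and> 3 \<le> length cs \<and> cedges cs \<subseteq> E"

lemma cedges_rotate:
  assumes "xs \<noteq> []" "ys \<noteq> []"
  shows "cedges (ys @ xs) = cedges (xs @ ys)"
  using assms by (auto simp: cedges_def pedges_append_ne)

lemma cycle_rotate:
  assumes "cycle E cs" "w \<in> set cs"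
  obtains ds where "cycle E (w # ds)" "set (w # ds) = set cs" "cedges (w # ds) = cedges cs"
proof -
  obtain xs ys where cs: "cs = xs @ w # ys" using assms(2) by (meson split_list)
  have "cedges ((w # ys) @ xs) = cedges cs"
    using cedges_rotate[of xs "w # ys"] by (cases "xs = []") (simp_all add: cs)
  moreover from this have "cycle E (w # ys @ xs)" using assms(1) unfolding cycle_def cs by auto
  ultimately show ?thesis using that[of "ys @ xs"] by (auto simp: cs)
qed

text \<open>Brings a cycle into the form in which \<open>theta_free\<close> and
  \<open>crossing_free\<close> speak of it, as two paths between the same two vertices.\<close>

lemma cycle_arcs:
  assumes "cycle E (xs @ u # ys @ v # zs)"
  shows "gpath E (u # ys @ [v])" "gpath E (u # rev (zs @ xs) @ [v])" "set ys \<inter> set (rev (zs @ xs)) = {}"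
proof -
  let ?cs = "xs @ u # ys @ v # zs"
  have d: "distinct ?cs" and e: "cedges ?cs \<subseteq> E" using assms by (auto simp: cycle_def)
  have p: "pedges ?cs \<subseteq> E" and l: "{last ?cs, hd ?cs} \<in> E" using e by (auto simp: cedges_def)
  have 1: "pedges ?cs = pedges (xs @ [u]) \<union> pedges (u # ys @ v # zs)" by (rule pedges_append)
  have 2: "pedges (u # ys @ v # zs) = pedges (u # ys @ [v]) \<union> pedges (v # zs)"
    using pedges_append[of "u # ys" v zs] by simp
  show "gpath E (u # ys @ [v])" using d p 1 2 by (auto simp: gpath_def)
  have "pedges ((v # zs) @ (xs @ [u])) = pedges (v # zs) \<union> insert {last (v # zs), hd (xs @ [u])} (pedges (xs @ [u]))"
    by (rule pedges_append_ne) simp_all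
  moreover have "last ?cs = last (v # zs)" "hd ?cs = hd (xs @ [u])" by (simp, cases xs) auto
  ultimately have "pedges ((v # zs) @ (xs @ [u])) \<subseteq> E" using p 1 2 l by auto
  moreover have "rev ((v # zs) @ (xs @ [u])) = u # rev (zs @ xs) @ [v]" by simp
  ultimately have "pedges (u # rev (zs @ xs) @ [v]) \<subseteq> E" using pedges_rev[of "(v # zs) @ (xs @ [u])"] by metis
  then show "gpath E (u # rev (zs @ xs) @ [v])" using d by (auto simp: gpath_def)
  show "set ys \<inter> set (rev (zs @ xs)) = {}" using d by auto
qed

lemma split_two:
  assumes "distinct cs" "u \<in> set cs" "v \<in> set cs" "u \<noteq> v"
  obtains xs ys zs where "cs = xs @ u # ys @ v # zs" | xs ys zs where "cs = xs @ v # ys @ u # zs"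
proof -
  obtain xs ws where cs: "cs = xs @ u # ws" using assms(2) by (meson split_list)
  then consider "v \<in> set ws" | "v \<in> set xs" using assms(3,4) by auto
  then show ?thesis
  proof cases
    case 1
    then obtain ys zs where "ws = ys @ v # zs" by (meson split_list)
    then show ?thesis using that(1) cs by simp
  next
    case 2
    then obtain ys zs where "xs = ys @ v # zs" by (meson split_list)
    then show ?thesis using that(2)[of ys zs ws] cs by simp
  qed
qed

text \<open>Maximality refers to the vertex sets, so different cycles on the same vertices may all
  be maximal.\<close>

definition maximal_cycle :: "'a set set \<Rightarrow> 'a list \<Rightarrow> bool" where
  "maximal_cycle E cs \<longleftrightarrow> cycle E cs \<and> (\<forall>ds. cycle E ds \<longrightarrow> set cs \<subseteq> set ds \<longrightarrow> set ds = set cs)"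

text \<open>If both parts of the cycle have inner vertices, the ear completes a theta. Otherwise one
  part is a single edge, and replacing it by the ear gives a larger cycle.\<close>

lemma no_ear_ordered:
  assumes th: "theta_free E" and mx: "maximal_cycle E (xs @ u # ys @ v # zs)"
    and p: "gpath E (u # p @ [v])" "p \<noteq> []" "set p \<inter> set (xs @ u # ys @ v # zs) = {}"
  shows False
proof -
  let ?cs = "xs @ u # ys @ v # zs"
  have cy: "cycle E ?cs" using mx by (simp add: maximal_cycle_def)
  have d: "distinct ?cs" and e: "pedges ?cs \<subseteq> E" "{last ?cs, hd ?cs} \<in> E" using cy by (auto simp: cycle_def cedges_def)
  have dp: "distinct p" and ep: "pedges (u # p @ [v]) \<subseteq> E" using p(1) by (auto simp: gpath_def)
  have new: False if "cycle E ds" "set ds = set p \<union> set ?cs" for ds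
  proof -
    have "set ds = set ?cs" using mx that unfolding maximal_cycle_def by auto
    then have "set p \<subseteq> set ?cs" using that(2) by auto
    then show False using p(2,3) by (cases p) auto
  qed
  note A = cycle_arcs[OF cy]
  have "ys = [] \<or> rev (zs @ xs) = [] \<or> p = []"
    using th[unfolded theta_free_def, rule_format, OF A(1,2) p(1) A(3)] p(3) by auto
  then consider "ys = []" | "zs = []" "xs = []" using p(2) by auto
  then show False
  proof cases
    case 1
    let ?ds = "xs @ u # p @ v # zs"
    have "pedges ?ds = pedges (xs @ [u]) \<union> (pedges (u # p @ [v]) \<union> pedges (v # zs))"
      using pedges_append[of xs u "p @ v # zs"] pedges_append[of "u # p" v zs] by simp
    moreover have "pedges ?cs = pedges (xs @ [u]) \<union> (pedges (u # ys @ [v]) \<union> pedges (v # zs))"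
      using pedges_append[of xs u "ys @ v # zs"] pedges_append[of "u # ys" v zs] by simp
    moreover have "last ?ds = last ?cs" "hd ?ds = hd ?cs" by (simp, cases xs) auto
    ultimately have "cedges ?ds \<subseteq> E" using e ep by (auto simp: cedges_def)
    moreover have "distinct ?ds" using d dp p(3) by auto
    moreover have "3 \<le> length ?ds" using p(2) by (cases p) auto
    ultimately have "cycle E ?ds" by (simp add: cycle_def)
    then show False by (rule new) (auto simp: 1)
  next
    \<comment> \<open>Now the edge between \<open>u\<close> and \<open>v\<close> is the one that
      joins the end of the list to its beginning.\<close>
    case 2
    let ?ds = "(u # ys @ [v]) @ rev p"
    have "pedges ?ds = pedges (u # ys @ [v]) \<union> insert {last (u # ys @ [v]), hd (rev p)} (pedges (rev p))"
      by (rule pedges_append_ne) (use p(2) in auto)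
    moreover have "pedges (u # p @ [v]) = pedges [u] \<union> insert {last [u], hd (p @ [v])} (pedges (p @ [v]))"
      using pedges_append_ne[of "[u]" "p @ [v]"] by simp
    moreover have "pedges (p @ [v]) = pedges p \<union> insert {last p, hd [v]} (pedges [v])"
      by (rule pedges_append_ne) (use p(2) in auto)
    ultimately have "cedges ?ds \<subseteq> E"
      using ep e(1) p(2) 2 by (auto simp: cedges_def hd_rev last_rev insert_commute)
    moreover have "distinct ?ds" using d dp p(3) 2 by auto
    moreover have "3 \<le> length ?ds" using p(2) by (cases p) auto
    ultimately have "cycle E ?ds" by (simp add: cycle_def)
    then show False by (rule new) (auto simp: 2)
  qed
qed

lemma no_ear:
  assumes th: "theta_free E" and mx: "maximal_cycle E cs" and uv: "u \<in> set cs" "v \<in> set cs" "u \<noteq> v"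
    and p: "gpath E (u # p @ [v])" "p \<noteq> []" "set p \<inter> set cs = {}"
  shows False
proof -
  have "distinct cs" using mx by (simp add: maximal_cycle_def cycle_def)
  then show False
  proof (rule split_two[OF _ uv])
    fix xs ys zs assume cs: "cs = xs @ u # ys @ v # zs"
    show False by (rule no_ear_ordered[OF th mx[unfolded cs] p(1,2) p(3)[unfolded cs]])
  next
    fix xs ys zs assume cs: "cs = xs @ v # ys @ u # zs"
    have "pedges (v # rev p @ [u]) = pedges (u # p @ [v])" using pedges_rev[of "u # p @ [v]"] by simp
    then have "gpath E (v # rev p @ [u])" using p(1) by (auto simp: gpath_def)
    then show False by (rule no_ear_ordered[OF th mx[unfolded cs]]) (use p(2,3) cs in auto)
  qed
qed

section \<open>Components off a vertex set and the parts that hang on it\<close>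

definition avoiding :: "'a set set \<Rightarrow> 'a set \<Rightarrow> ('a \<times> 'a) set" where
  "avoiding E X = {(a, b). {a, b} \<in> E \<and> a \<notin> X \<and> b \<notin> X}"

definition avoid_comp :: "'a set set \<Rightarrow> 'a set \<Rightarrow> 'a \<Rightarrow> 'a set" where
  "avoid_comp E X y = {z. (y, z) \<in> (avoiding E X)\<^sup>*}"

lemma avoid_comp_self [simp]: "y \<in> avoid_comp E X y"
  by (simp add: avoid_comp_def)

lemma avoid_comp_sym: "z \<in> avoid_comp E X y \<Longrightarrow> y \<in> avoid_comp E X z"
proof -
  have "sym (avoiding E X)" by (auto simp: avoiding_def sym_def insert_commute)
  then show "z \<in> avoid_comp E X y \<Longrightarrow> y \<in> avoid_comp E X z"
    unfolding avoid_comp_def using sym_rtrancl by (auto dest: symD)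
qed

lemma avoid_comp_trans: "z \<in> avoid_comp E X y \<Longrightarrow> w \<in> avoid_comp E X z \<Longrightarrow> w \<in> avoid_comp E X y"
  by (auto simp: avoid_comp_def)

lemma avoid_comp_step: "z \<in> avoid_comp E X y \<Longrightarrow> {z, w} \<in> E \<Longrightarrow> z \<notin> X \<Longrightarrow> w \<notin> X \<Longrightarrow> w \<in> avoid_comp E X y"
  unfolding avoid_comp_def by (auto simp: avoiding_def intro: rtrancl_into_rtrancl)

lemma avoid_comp_avoids:
  assumes "z \<in> avoid_comp E X y" "y \<notin> X"
  shows "z \<notin> X"
proof -
  have "(y, z) \<in> (avoiding E X)\<^sup>*" using assms(1) by (simp add: avoid_comp_def)
  then show ?thesis using assms(2) by induction (auto simp: avoiding_def)
qed

text \<open>The path is built step by step along the reachability relation; when a vertex would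
  repeat, the loop is cut off.\<close>

lemma avoid_comp_path:
  assumes "z \<in> avoid_comp E X y" "y \<notin> X"
  shows "\<exists>p. p \<noteq> [] \<and> hd p = y \<and> last p = z \<and> gpath E p \<and> set p \<inter> X = {}"
proof -
  have "(y, z) \<in> (avoiding E X)\<^sup>*" using assms(1) by (simp add: avoid_comp_def)
  then show ?thesis
  proof induction
    case base
    then show ?case using assms(2) by (intro exI[of _ "[y]"]) (simp add: gpath_def)
  next
    case (step z w)
    then obtain p where p: "p \<noteq> []" "hd p = y" "last p = z" "gpath E p" "set p \<inter> X = {}" by blast
    have zw: "{z, w} \<in> E" "w \<notin> X" using step by (auto simp: avoiding_def)
    show ?case
    proof (cases "w \<in> set p")
      case True
      then obtain p1 p2 where p12: "p = p1 @ w # p2" by (meson split_list)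
      have "gpath E (p1 @ [w])" using p(4) pedges_append[of p1 w p2] by (auto simp: gpath_def p12)
      moreover have "hd (p1 @ [w]) = y" using p(2) p12 by (cases p1) auto
      ultimately show ?thesis using p(5) p12 by (intro exI[of _ "p1 @ [w]"]) auto
    next
      case False
      have "pedges (p @ [w]) = pedges p \<union> insert {last p, hd [w]} (pedges [w])"
        by (rule pedges_append_ne) (use p(1) in auto)
      then have "gpath E (p @ [w])" using p(3,4) zw(1) False by (auto simp: gpath_def)
      then show ?thesis using p(1,2,5) zw(2) by (intro exI[of _ "p @ [w]"]) auto
    qed
  qed
qed

text \<open>Edges that merely meet the component belong to the part as well, so that the connecting
  bridge is included.\<close>

definition hang :: "'a set set \<Rightarrow> 'a set \<Rightarrow> 'a \<Rightarrow> 'a set set" where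
  "hang E X y = {e \<in> E. e \<inter> avoid_comp E X y \<noteq> {}}"

lemma hang_vertex:
  assumes gE: "graph E" and e: "e \<in> hang E X y" "v \<in> e" and y: "y \<notin> X"
  shows "v \<in> avoid_comp E X y \<or> v \<in> X \<and> (\<exists>z\<in>avoid_comp E X y. {v, z} \<in> E)"
proof -
  obtain z where z: "e \<in> E" "z \<in> e" "z \<in> avoid_comp E X y" using e(1) by (auto simp: hang_def)
  show ?thesis
  proof (cases "v = z")
    case False
    then have "e = {z, v}" using graph_edgeE[OF gE z(1,2)] e(2) by auto
    moreover have "z \<notin> X" by (rule avoid_comp_avoids[OF z(3) y])
    ultimately show ?thesis using z avoid_comp_step[OF z(3), of v] by (auto simp: insert_commute)
  qed (use z in simp)
qed

text \<open>From here on the drawing is replaced by its two consequences for paths, which pass to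
  subsets of the edges; the induction runs over edge sets.\<close>

definition subcubic_outerplanar :: "'a set set \<Rightarrow> bool" where
  "subcubic_outerplanar E \<longleftrightarrow> finite E \<and> graph E \<and> (\<forall>v. degree E v \<le> 3) \<and> theta_free E \<and> crossing_free E"

lemma degree_mono: "finite E \<Longrightarrow> F \<subseteq> E \<Longrightarrow> degree F v \<le> degree E v"
  unfolding degree_def by (intro card_mono) auto

lemma subcubic_outerplanar_subset:
  assumes "subcubic_outerplanar E" "F \<subseteq> E"
  shows "subcubic_outerplanar F"
  using assms degree_mono[of E F] theta_free_subset[of E F] crossing_free_subset[of E F] graph_subset[of E F] finite_subset[of F E]
  unfolding subcubic_outerplanar_def by (meson order_trans)

definition adj :: "'a set set \<Rightarrow> ('a \<times> 'a) set" where
  "adj E = {(a, b). {a, b} \<in> E}"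

text \<open>A condition on edges only: the empty graph is connected from every vertex, as happens
  beyond a bridge that leads to a leaf.\<close>

definition connected_from :: "'a set set \<Rightarrow> 'a \<Rightarrow> bool" where
  "connected_from E w \<longleftrightarrow> (\<forall>e\<in>E. \<exists>v\<in>e. (w, v) \<in> (adj E)\<^sup>*)"

lemma reach_hang:
  assumes "(w, v) \<in> (adj E)\<^sup>*" "w \<in> X"
  shows "v \<in> X \<or> (\<exists>x\<in>X. \<exists>y. y \<notin> X \<and> {x, y} \<in> E \<and> v \<in> avoid_comp E X y)"
  using assms(1)
proof induction
  case (step b a)
  have ba: "{b, a} \<in> E" using step by (simp add: adj_def)
  show ?case
  proof (cases "a \<in> X")
    case False
    from step.IH show ?thesis
    proof
      assume "b \<in> X"
      then show ?thesis using ba False by (intro disjI2 bexI[of _ b] exI[of _ a]) simp_all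
    next
      assume "\<exists>x\<in>X. \<exists>y. y \<notin> X \<and> {x, y} \<in> E \<and> b \<in> avoid_comp E X y"
      then obtain x y where xy: "x \<in> X" "y \<notin> X" "{x, y} \<in> E" "b \<in> avoid_comp E X y" by blast
      have "b \<notin> X" by (rule avoid_comp_avoids[OF xy(4,2)])
      then have "a \<in> avoid_comp E X y" using avoid_comp_step[OF xy(4) ba] False by blast
      then show ?thesis using xy by blast
    qed
  qed simp
qed (use assms(2) in simp)

lemma edge_inside_or_hang:
  assumes gE: "graph E" and cn: "connected_from E w" "w \<in> X" and e: "e \<in> E"
  shows "e \<subseteq> X \<or> (\<exists>x\<in>X. \<exists>y. y \<notin> X \<and> {x, y} \<in> E \<and> e \<in> hang E X y)"
proof (cases "e \<subseteq> X")
  case False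
  then obtain a where a: "a \<in> e" "a \<notin> X" by blast
  obtain v where v: "v \<in> e" "(w, v) \<in> (adj E)\<^sup>*" using cn(1) e by (auto simp: connected_from_def)
  have "(w, a) \<in> (adj E)\<^sup>*"
  proof (cases "a = v")
    case False
    then have "{v, a} \<in> E" using graph_edgeE[OF gE e v(1)] a(1) e by auto
    then show ?thesis using v(2) by (auto simp: adj_def intro: rtrancl_into_rtrancl)
  qed (use v in simp)
  from reach_hang[OF this cn(2)] a(2) obtain x y where "x \<in> X" "y \<notin> X" "{x, y} \<in> E" "a \<in> avoid_comp E X y" by blast
  then show ?thesis using a(1) e unfolding hang_def by blast
qed simp

text \<open>By \<open>attach\<close>, \<open>{x, y}\<close> is the only edge between the component
  of \<open>y\<close> and \<open>X\<close>. Deleting it leaves a smaller graph in which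
  \<open>y\<close> has degree at most two, so the induction hypothesis applies.\<close>

lemma good_bridge_hang:
  fixes E :: "'a set set"
  assumes so: "subcubic_outerplanar E" and xy: "x \<in> X" "y \<notin> X" "{x, y} \<in> E"
    and attach: "\<And>z x'. z \<in> avoid_comp E X y \<Longrightarrow> x' \<in> X \<Longrightarrow> {x', z} \<in> E \<Longrightarrow> x' = x \<and> z = y"
    and IH: "\<And>(F :: 'a set set) w. subcubic_outerplanar F \<Longrightarrow> card F < card E \<Longrightarrow> connected_from F w \<Longrightarrow> degree F w \<le> 2 \<Longrightarrow> good_root F w"
  shows "good_bridge (hang E X y) x"
proof -
  let ?F = "{e \<in> hang E X y. x \<notin> e}"
  have E: "finite E" "graph E" "degree E y \<le> 3" using so by (auto simp: subcubic_outerplanar_def)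
  have FE: "?F \<subseteq> E" by (auto simp: hang_def)
  have so': "subcubic_outerplanar ?F" by (rule subcubic_outerplanar_subset[OF so FE])
  have "?F \<noteq> E"
  proof
    assume eq: "?F = E"
    have "{x, y} \<in> ?F" by (simp only: eq xy(3))
    then show False by simp
  qed
  then have less: "card ?F < card E" using psubset_card_mono[OF E(1) psubsetI[OF FE]] by simp
  have hF: "hang E X y = insert {y, x} ?F"
  proof (intro equalityI subsetI)
    fix e assume e: "e \<in> hang E X y"
    show "e \<in> insert {y, x} ?F"
    proof (cases "x \<in> e")
      case True
      have eE: "e \<in> E" using e by (simp add: hang_def)
      obtain z where z: "e = {x, z}" using graph_edgeE[OF E(2) eE True] by blast
      have "x \<notin> avoid_comp E X y" using avoid_comp_avoids[OF _ xy(2)] xy(1) by blast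
      then have "z \<in> avoid_comp E X y" using e z by (auto simp: hang_def)
      then have "z = y" using attach[of z x] xy(1) eE z by blast
      then show ?thesis using z by (simp add: insert_commute)
    qed (use e in simp)
  next
    fix e assume "e \<in> insert {y, x} ?F"
    then show "e \<in> hang E X y" using xy(3) by (auto simp: hang_def insert_commute)
  qed
  \<comment> \<open>Walks within the component avoid \<open>x\<close>, so they survive the deletion
    of the bridge.\<close>
  have reach: "(y, z) \<in> (adj ?F)\<^sup>*" if "z \<in> avoid_comp E X y" for z
  proof -
    have "(y, z) \<in> (avoiding E X)\<^sup>*" using that by (simp add: avoid_comp_def)
    then show ?thesis
    proof induction
      case (step a b)
      have ab: "{a, b} \<in> E" "a \<notin> X" "b \<notin> X" using step by (auto simp: avoiding_def)
      have "a \<in> avoid_comp E X y" using step by (simp add: avoid_comp_def)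
      then have "{a, b} \<in> ?F" using ab xy(1) by (auto simp: hang_def)
      then show ?case using step.IH by (auto simp: adj_def intro: rtrancl_into_rtrancl)
    qed simp
  qed
  have "connected_from ?F y"
    unfolding connected_from_def
  proof
    fix e assume "e \<in> ?F"
    then obtain z where "z \<in> e" "z \<in> avoid_comp E X y" by (auto simp: hang_def)
    then show "\<exists>v\<in>e. (y, v) \<in> (adj ?F)\<^sup>*" using reach by blast
  qed
  moreover have "degree ?F y \<le> 2"
  proof -
    have "insert {x, y} {e \<in> ?F. y \<in> e} \<subseteq> {e \<in> E. y \<in> e}" using FE xy(3) by blast
    then have "card (insert {x, y} {e \<in> ?F. y \<in> e}) \<le> degree E y"
      unfolding degree_def using E(1) by (intro card_mono) auto
    moreover have "finite {e \<in> ?F. y \<in> e}" by (rule finite_subset[OF _ E(1)]) (use FE in blast)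
    ultimately have "Suc (degree ?F y) \<le> 3" using E(3) by (simp add: degree_def)
    then show ?thesis by simp
  qed
  ultimately have "good_root ?F y" by (rule IH[OF so' less])
  moreover have "x \<notin> \<Union>?F" by blast
  moreover have "x \<noteq> y" using xy by blast
  ultimately have "good_bridge (insert {y, x} ?F) x" by (rule good_bridge_root)
  then show ?thesis by (subst hF)
qed

lemma two_cedges:
  assumes "cycle E cs" "x \<in> set cs"
  obtains e1 e2 where "e1 \<noteq> e2" "e1 \<in> cedges cs" "e2 \<in> cedges cs" "x \<in> e1" "x \<in> e2"
proof -
  obtain ds where ds: "cycle E (x # ds)" "cedges (x # ds) = cedges cs"
    by (rule cycle_rotate[OF assms])
  obtain a b es where es: "ds = a # b # es" using ds(1) unfolding cycle_def
    by (cases ds; cases "tl ds") auto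
  let ?l = "last (b # es)"
  have "?l \<in> set (b # es)" by simp
  then have "?l \<noteq> a" "?l \<noteq> x" using ds(1) unfolding cycle_def es by auto
  then have "{x, a} \<noteq> {?l, x}" by (auto simp: doubleton_eq_iff)
  moreover have "{x, a} \<in> cedges (x # ds)" "{?l, x} \<in> cedges (x # ds)" by (auto simp: cedges_def es)
  ultimately show ?thesis using that[of "{x, a}" "{?l, x}"] ds(2) by auto
qed

text \<open>Two of the at most three edges at a vertex of the cycle belong to the cycle.\<close>

lemma third_edge_unique:
  assumes so: "subcubic_outerplanar E" and cy: "cycle E cs" "x \<in> set cs"
    and e: "e \<in> E" "e \<notin> cedges cs" "x \<in> e" and e': "e' \<in> E" "e' \<notin> cedges cs" "x \<in> e'"
  shows "e = e'"
proof (rule ccontr)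
  assume ne: "e \<noteq> e'"
  obtain e1 e2 where c: "e1 \<noteq> e2" "e1 \<in> cedges cs" "e2 \<in> cedges cs" "x \<in> e1" "x \<in> e2"
    by (rule two_cedges[OF cy])
  have "cedges cs \<subseteq> E" using cy(1) by (simp add: cycle_def)
  then have "{e1, e2, e, e'} \<subseteq> {e \<in> E. x \<in> e}" using c e e' by auto
  then have "card {e1, e2, e, e'} \<le> degree E x"
    unfolding degree_def using so by (intro card_mono) (auto simp: subcubic_outerplanar_def)
  moreover have "e1 \<noteq> e" "e1 \<noteq> e'" "e2 \<noteq> e" "e2 \<noteq> e'" using c e e' by auto
  then have "card {e1, e2, e, e'} = 4" using c(1) ne by simp
  moreover have "degree E x \<le> 3" using so by (simp add: subcubic_outerplanar_def)
  ultimately show False by simp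
qed

lemma third_edge_degree:
  assumes so: "subcubic_outerplanar E" and cy: "cycle E cs" "x \<in> set cs"
    and e: "e \<in> E" "e \<notin> cedges cs" "x \<in> e"
  shows "\<not> degree E x \<le> 2"
proof -
  obtain e1 e2 where c: "e1 \<noteq> e2" "e1 \<in> cedges cs" "e2 \<in> cedges cs" "x \<in> e1" "x \<in> e2"
    by (rule two_cedges[OF cy])
  have "cedges cs \<subseteq> E" using cy(1) by (simp add: cycle_def)
  then have "{e1, e2, e} \<subseteq> {e \<in> E. x \<in> e}" using c e by auto
  then have "card {e1, e2, e} \<le> degree E x"
    unfolding degree_def using so by (intro card_mono) (auto simp: subcubic_outerplanar_def)
  moreover have "e1 \<noteq> e" "e2 \<noteq> e" using c e by auto
  then have "card {e1, e2, e} = 3" using c(1) by simp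
  ultimately show ?thesis by simp
qed

lemma cedges_subset: "cs \<noteq> [] \<Longrightarrow> e \<in> cedges cs \<Longrightarrow> e \<subseteq> set cs"
  using pedges_subset[of e cs] by (auto simp: cedges_def)

text \<open>A path through the component between two points of attachment would be an ear.\<close>

lemma no_ear_component:
  assumes th: "theta_free E" and mx: "maximal_cycle E cs" and x: "x \<in> set cs" "x' \<in> set cs" "x \<noteq> x'"
    and y: "y \<notin> set cs" "{x, y} \<in> E" and y': "y' \<in> avoid_comp E (set cs) y" "{x', y'} \<in> E"
  shows False
proof -
  obtain p where p: "p \<noteq> []" "hd p = y" "last p = y'" "gpath E p" "set p \<inter> set cs = {}"
    using avoid_comp_path[OF y'(1) y(1)] by blast
  have "pedges ((x # p) @ [x']) = pedges (x # p) \<union> insert {last (x # p), hd [x']} (pedges [x'])"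
    by (rule pedges_append_ne) simp_all
  moreover have "pedges ([x] @ p) = pedges [x] \<union> insert {last [x], hd p} (pedges p)"
    by (rule pedges_append_ne) (use p(1) in simp_all)
  ultimately have "pedges (x # p @ [x']) = insert {y', x'} (insert {x, y} (pedges p))"
    using p(1-3) by auto
  then have "gpath E (x # p @ [x'])"
    using p(4,5) x y(2) y'(2) by (auto simp: gpath_def insert_commute)
  then show False by (rule no_ear[OF th mx x _ p(1,5)])
qed

lemma nth_split:
  assumes "i < j" "j < length cs"
  shows "cs = take i cs @ cs ! i # take (j - Suc i) (drop (Suc i) cs) @ cs ! j # drop (Suc j) cs"
proof -
  have 1: "cs = take i cs @ cs ! i # drop (Suc i) cs" by (rule id_take_nth_drop) (use assms in simp)
  have "drop (Suc i) cs = take (j - Suc i) (drop (Suc i) cs) @ drop (Suc i) cs ! (j - Suc i) # drop (Suc (j - Suc i)) (drop (Suc i) cs)"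
    by (rule id_take_nth_drop) (use assms in simp)
  moreover have "drop (Suc i) cs ! (j - Suc i) = cs ! j" using assms by simp
  moreover have "drop (Suc (j - Suc i)) (drop (Suc i) cs) = drop (Suc j) cs" using assms by simp
  ultimately have "drop (Suc i) cs = take (j - Suc i) (drop (Suc i) cs) @ cs ! j # drop (Suc j) cs" by simp
  then show ?thesis using 1 by metis
qed

text \<open>Otherwise take a shortest chord, from \<open>i\<close> to \<open>j\<close>: the chord at
  \<open>Suc i\<close> would stay below it and be shorter still.\<close>

lemma (in chorded_cycle) exists_unchorded:
  assumes "n > 0"
  shows "\<exists>k<n. \<forall>b. \<not> chord k b"
proof (rule ccontr)
  assume "\<not> ?thesis"
  then have all: "\<exists>b. chord k b" if "k < n" for k using that by blast
  define P where "P d \<longleftrightarrow> (\<exists>i j. chord i j \<and> i < j \<and> d = j - i)" for d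
  obtain b where b: "chord 0 b" using all assms by blast
  then have "P b" unfolding P_def using chord_Suc[OF b] by (intro exI[of _ 0] exI[of _ b]) auto
  then have L: "P (LEAST d. P d)" by (rule LeastI)
  then obtain i j where ij: "chord i j" "i < j" "(LEAST d. P d) = j - i" unfolding P_def by blast
  have "Suc i < j" using chord_Suc[OF ij(1)] ij(2) by simp
  moreover have "j < n" by (rule chord_less[OF chord_sym[OF ij(1)]])
  ultimately obtain l where l: "chord (Suc i) l" using all[of "Suc i"] by auto
  have "i < l \<and> l < j" using noncrossing[OF ij(1) l] \<open>Suc i < j\<close> by simp
  moreover have "l \<noteq> Suc i" using chord_Suc[OF l] by simp
  ultimately have lt: "Suc i < l" "l < j" by auto
  then have "P (l - Suc i)" unfolding P_def using l by blast
  then have "j - i \<le> l - Suc i" unfolding ij(3)[symmetric] by (rule Least_le)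
  then show False using lt by simp
qed

section \<open>The decomposition along a maximal cycle\<close>

definition cycle_hang :: "'a set set \<Rightarrow> 'a list \<Rightarrow> nat \<Rightarrow> 'a set set" where
  "cycle_hang E cs k = (if k < length cs then \<Union>{hang E (set cs) y | y. y \<notin> set cs \<and> {cs ! k, y} \<in> E} else {})"

definition cycle_chord :: "'a set set \<Rightarrow> 'a list \<Rightarrow> nat \<Rightarrow> nat \<Rightarrow> bool" where
  "cycle_chord E cs i j \<longleftrightarrow> i < length cs \<and> j < length cs \<and> {cs ! i, cs ! j} \<in> E \<and> {cs ! i, cs ! j} \<notin> cedges cs"

text \<open>\<open>IH\<close> is a parameter of the locale, so the same facts serve inside the
  induction of \<open>good_root_main\<close> and, with that lemma itself in place of
  \<open>IH\<close>, for whole components.\<close>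

locale maximal_cycle_graph =
  fixes E :: "'a set set" and cs :: "'a list"
  assumes so: "subcubic_outerplanar E" and mx: "maximal_cycle E cs"
    and IH: "\<And>(F :: 'a set set) w. subcubic_outerplanar F \<Longrightarrow> card F < card E \<Longrightarrow> connected_from F w \<Longrightarrow> degree F w \<le> 2 \<Longrightarrow> good_root F w"
begin

lemma cyc: "cycle E cs" using mx by (simp add: maximal_cycle_def)

lemma gE: "graph E" and th: "theta_free E" and cf: "crossing_free E"
  using so by (simp_all add: subcubic_outerplanar_def)

lemma dist: "distinct cs" and len: "3 \<le> length cs"
  using cyc by (simp_all add: cycle_def)

lemma ne: "cs \<noteq> []" using len by auto

lemma outside_not_cedge: "y \<notin> set cs \<Longrightarrow> {x, y} \<notin> cedges cs"
  using cedges_subset[OF ne, of "{x, y}"] by blast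

lemma neighbour_unique:
  assumes "x \<in> set cs" "{x, y} \<in> E" "{x, y} \<notin> cedges cs" "{x, z} \<in> E" "{x, z} \<notin> cedges cs"
  shows "y = z"
proof -
  have "{x, y} = {x, z}" by (rule third_edge_unique[OF so cyc assms(1)]) (use assms in auto)
  then show ?thesis by (auto simp: doubleton_eq_iff)
qed

text \<open>A vertex of the cycle has at most one neighbour off the cycle, so the union in
  \<open>cycle_hang\<close> has at most one member.\<close>

lemma cycle_hang_cases:
  assumes "k < length cs"
  obtains "cycle_hang E cs k = {}" "\<And>y. y \<notin> set cs \<Longrightarrow> {cs ! k, y} \<notin> E"
  | y where "y \<notin> set cs" "{cs ! k, y} \<in> E" "cycle_hang E cs k = hang E (set cs) y"
proof (cases "\<exists>y. y \<notin> set cs \<and> {cs ! k, y} \<in> E")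
  case False
  then have "{hang E (set cs) y | y. y \<notin> set cs \<and> {cs ! k, y} \<in> E} = {}" by blast
  then have "cycle_hang E cs k = {}" by (simp only: cycle_hang_def Union_empty if_cancel)
  then show ?thesis by (rule that(1)) (use False in blast)
next
  case True
  then obtain y where y: "y \<notin> set cs" "{cs ! k, y} \<in> E" by blast
  have "z = y" if z: "z \<notin> set cs" "{cs ! k, z} \<in> E" for z
    by (rule neighbour_unique[of "cs ! k"]) (use assms y z outside_not_cedge in auto)
  then have "{hang E (set cs) z | z. z \<notin> set cs \<and> {cs ! k, z} \<in> E} = {hang E (set cs) y}" using y by blast
  then have "cycle_hang E cs k = hang E (set cs) y" using assms by (simp add: cycle_hang_def)
  then show ?thesis using that(2) y by blast
qed

lemma cycle_hang_subset: "cycle_hang E cs k \<subseteq> E"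
  by (auto simp: cycle_hang_def hang_def)

lemma cycle_hang_vertex:
  assumes "k < length cs" "v \<in> \<Union>(cycle_hang E cs k)"
  obtains y where "y \<notin> set cs" "{cs ! k, y} \<in> E" "v \<in> avoid_comp E (set cs) y \<or> v = cs ! k"
  using assms(1)
proof (cases rule: cycle_hang_cases)
  case 1
  then show ?thesis using assms(2) by simp
next
  case (2 y)
  obtain e where e: "e \<in> hang E (set cs) y" "v \<in> e" using assms(2) 2(3) by auto
  from hang_vertex[OF gE e 2(1)] have "v \<in> avoid_comp E (set cs) y \<or> v = cs ! k"
  proof
    assume "v \<in> set cs \<and> (\<exists>z\<in>avoid_comp E (set cs) y. {v, z} \<in> E)"
    then obtain z where z: "v \<in> set cs" "z \<in> avoid_comp E (set cs) y" "{v, z} \<in> E" by blast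
    have "v = cs ! k"
    proof (rule ccontr)
      assume "v \<noteq> cs ! k"
      then show False
        using no_ear_component[OF th mx _ z(1) _ 2(1,2) z(2,3)] assms(1) by auto
    qed
    then show ?thesis ..
  qed simp
  then show ?thesis using that 2 by blast
qed

lemma cycle_hang_cycle:
  assumes "k < length cs" "l < length cs" "cs ! l \<in> \<Union>(cycle_hang E cs k)"
  shows "l = k"
proof -
  obtain y where y: "y \<notin> set cs" "cs ! l \<in> avoid_comp E (set cs) y \<or> cs ! l = cs ! k"
    by (rule cycle_hang_vertex[OF assms(1,3)])
  moreover have "cs ! l \<in> set cs" using assms(2) by simp
  ultimately have "cs ! l = cs ! k" using avoid_comp_avoids[OF _ y(1)] by blast
  then show ?thesis using dist assms by (simp add: nth_eq_iff_index_eq)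
qed

text \<open>A common vertex would put both outer neighbours into one component, attached to the
  cycle at two vertices.\<close>

lemma cycle_hang_disjoint:
  assumes "k < length cs" "l < length cs" "k \<noteq> l"
  shows "\<Union>(cycle_hang E cs k) \<inter> \<Union>(cycle_hang E cs l) = {}"
proof (rule ccontr)
  assume "\<not> ?thesis"
  then obtain v where v: "v \<in> \<Union>(cycle_hang E cs k)" "v \<in> \<Union>(cycle_hang E cs l)" by blast
  have nk: "v \<noteq> cs ! k" using cycle_hang_cycle[OF assms(2,1)] v(2) assms(3) by auto
  have nl: "v \<noteq> cs ! l" using cycle_hang_cycle[OF assms(1,2)] v(1) assms(3) by auto
  obtain y where y: "y \<notin> set cs" "{cs ! k, y} \<in> E" "v \<in> avoid_comp E (set cs) y"
    by (rule cycle_hang_vertex[OF assms(1) v(1)]) (use nk in blast)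
  obtain z where z: "z \<notin> set cs" "{cs ! l, z} \<in> E" "v \<in> avoid_comp E (set cs) z"
    by (rule cycle_hang_vertex[OF assms(2) v(2)]) (use nl in blast)
  have "z \<in> avoid_comp E (set cs) y" by (rule avoid_comp_trans[OF y(3) avoid_comp_sym[OF z(3)]])
  moreover have "cs ! k \<noteq> cs ! l" using dist assms by (simp add: nth_eq_iff_index_eq)
  ultimately show False
    using no_ear_component[OF th mx _ _ _ y(1,2) _ z(2)] assms(1,2) by auto
qed

lemma good_bridge_cycle_hang:
  assumes "k < length cs"
  shows "good_bridge (cycle_hang E cs k) (cs ! k)"
  using assms
proof (cases rule: cycle_hang_cases)
  case 1
  then show ?thesis using good_bridge_empty by simp
next
  case (2 y)
  have x: "cs ! k \<in> set cs" using assms by simp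
  have "good_bridge (hang E (set cs) y) (cs ! k)"
  proof (rule good_bridge_hang[OF so x 2(1,2) _ IH])
    fix z x' assume z: "z \<in> avoid_comp E (set cs) y" "x' \<in> set cs" "{x', z} \<in> E"
    have "x' = cs ! k" using no_ear_component[OF th mx x z(2) _ 2(1,2) z(1,3)] by auto
    moreover have "z \<notin> set cs" by (rule avoid_comp_avoids[OF z(1) 2(1)])
    ultimately show "x' = cs ! k \<and> z = y"
      using neighbour_unique[OF x, of z y] 2(1,2) z(3) outside_not_cedge by auto
  qed
  then show ?thesis using 2(3) by simp
qed

lemma chord_unique: "cycle_chord E cs i j \<Longrightarrow> cycle_chord E cs i k \<Longrightarrow> j = k"
  using neighbour_unique[of "cs ! i" "cs ! j" "cs ! k"] dist unfolding cycle_chord_def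
  by (auto simp: nth_eq_iff_index_eq)

lemma chord_sym: "cycle_chord E cs i j \<Longrightarrow> cycle_chord E cs j i"
  by (simp add: cycle_chord_def insert_commute)

text \<open>The ends \<open>i\<close> and \<open>j\<close> divide the cycle into two parts. If
  \<open>l\<close> were not in the part of \<open>k\<close>, the two chords would form the
  configuration excluded by \<open>crossing_free\<close>.\<close>

lemma chord_noncrossing:
  assumes ij: "cycle_chord E cs i j" and kl: "cycle_chord E cs k l" and ik: "i < k" "k < j"
  shows "i < l \<and> l < j"
proof (rule ccontr)
  assume neg: "\<not> ?thesis"
  have "l \<noteq> i" using chord_unique[OF ij, of k] chord_sym[OF kl] ik by auto
  moreover have "l \<noteq> j" using chord_unique[OF chord_sym[OF ij], of k] chord_sym[OF kl] ik by auto
  ultimately have l: "l < i \<or> j < l" using neg by auto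
  have n: "j < length cs" "l < length cs" "k < length cs" using ij kl by (simp_all add: cycle_chord_def)
  let ?xs = "take i cs" and ?ys = "take (j - Suc i) (drop (Suc i) cs)" and ?zs = "drop (Suc j) cs"
  have split: "cs = ?xs @ cs ! i # ?ys @ cs ! j # ?zs" by (rule nth_split) (use ik n in simp_all)
  have c': "cycle E (?xs @ cs ! i # ?ys @ cs ! j # ?zs)" using cyc split by simp
  have "?ys ! (k - Suc i) = cs ! k" "k - Suc i < length ?ys" using ik n by simp_all
  then have kin: "cs ! k \<in> set ?ys" by (metis nth_mem)
  have lin: "cs ! l \<in> set (rev (?zs @ ?xs))"
    using l
  proof
    assume "l < i"
    then have "?xs ! l = cs ! l" "l < length ?xs" using n by simp_all
    then have "cs ! l \<in> set ?xs" by (metis nth_mem)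
    then show ?thesis by simp
  next
    assume "j < l"
    then have "?zs ! (l - Suc j) = cs ! l" "l - Suc j < length ?zs" using n by simp_all
    then have "cs ! l \<in> set ?zs" by (metis nth_mem)
    then show ?thesis by simp
  qed
  have e: "{cs ! i, cs ! j} \<in> E" "{cs ! k, cs ! l} \<in> E" using ij kl by (simp_all add: cycle_chord_def)
  show False
    using cf[unfolded crossing_free_def, rule_format, OF cycle_arcs[OF c'] e(1) kin lin] e(2) by simp
qed

lemma chorded: "chorded_cycle ((!) cs) (length cs) (cycle_chord E cs) (cycle_hang E cs)"
proof
  show "inj_on ((!) cs) {..<length cs}" using dist by (simp add: inj_on_nth)
  show "graph (cycle_hang E cs k)" for k by (rule graph_subset[OF gE cycle_hang_subset])
  show "j \<noteq> Suc i \<and> j \<noteq> i" if "cycle_chord E cs i j" for i j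
  proof
    show "j \<noteq> Suc i"
      using that unfolding cycle_chord_def cedges_def pedges_nth by auto
    show "j \<noteq> i" using that graph_edge_neq[OF gE] unfolding cycle_chord_def by auto
  qed
  show "cycle_hang E cs i = {}" if c: "cycle_chord E cs i j" for i j
  proof -
    have i: "i < length cs" "j < length cs" using c by (simp_all add: cycle_chord_def)
    from i(1) show ?thesis
    proof (cases rule: cycle_hang_cases)
      case (2 y)
      have "y = cs ! j"
        by (rule neighbour_unique[of "cs ! i"]) (use c i 2 outside_not_cedge in \<open>auto simp: cycle_chord_def\<close>)
      then show ?thesis using 2 i by simp
    qed simp
  qed
  show "good_bridge (cycle_hang E cs k) (cs ! k)" if "k < length cs" for k by (rule good_bridge_cycle_hang[OF that])
  show "\<Union>(cycle_hang E cs k) \<inter> \<Union>(cycle_hang E cs l) = {}" if "k < length cs" "l < length cs" "k \<noteq> l" for k l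
    by (rule cycle_hang_disjoint[OF that])
  show "l = k" if "k < length cs" "l < length cs" "cs ! l \<in> \<Union>(cycle_hang E cs k)" for k l
    by (rule cycle_hang_cycle[OF that])
  show "i < length cs" if "cycle_chord E cs i j" for i j using that by (simp add: cycle_chord_def)
  show "cycle_chord E cs j i" if "cycle_chord E cs i j" for i j by (rule chord_sym[OF that])
  show "j = k" if "cycle_chord E cs i j" "cycle_chord E cs i k" for i j k by (rule chord_unique[OF that])
  show "i < l \<and> l < j" if "cycle_chord E cs i j" "cycle_chord E cs k l" "i < k" "k < j" for i j k l
    by (rule chord_noncrossing[OF that])
qed

text \<open>\<open>T\<close> is all but the bridge piece at the first vertex, which has no chord.
  That piece stays separate because a root may have at most two edges in \<open>good_root\<close>'s
  induction, and both are on the cycle.\<close>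

lemma cycle_decomposition:
  assumes cn: "connected_from E w" "w \<in> set cs" and unch: "\<And>b. \<not> cycle_chord E cs 0 b"
  obtains T where "E = T \<union> cycle_hang E cs 0" "glue T (cycle_hang E cs 0) (cs ! 0)" "good_root T (cs ! 0)"
proof -
  interpret C: chorded_cycle "(!) cs" "length cs" "cycle_chord E cs" "cycle_hang E cs" by (rule chorded)
  let ?n = "length cs" and ?H = "cycle_hang E cs 0"
  let ?T = "insert {cs ! 0, cs ! (?n - 1)} (C.open_edges 0 ?n)"
  have closing: "{last cs, hd cs} = {cs ! 0, cs ! (?n - 1)}"
    using ne by (simp add: hd_conv_nth last_conv_nth insert_commute)
  have cE: "cedges cs \<subseteq> E" using cyc by (simp add: cycle_def)
  have "E = ?T \<union> ?H"
  proof (intro equalityI subsetI)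
    fix e assume e: "e \<in> E"
    from edge_inside_or_hang[OF gE cn e] show "e \<in> ?T \<union> ?H"
    proof
      assume sub: "e \<subseteq> set cs"
      show ?thesis
      proof (cases "e \<in> cedges cs")
        case True
        then consider "e = {cs ! 0, cs ! (?n - 1)}" | i where "Suc i < ?n" "e = {cs ! i, cs ! Suc i}"
          unfolding cedges_def closing pedges_nth by blast
        then show ?thesis
        proof cases
          case 2
          then have "e \<in> C.open_edges 0 ?n" unfolding C.open_edges_def by blast
          then show ?thesis by simp
        qed simp
      next
        case False
        have "card e = 2" using gE e by (simp add: graph_def)
        then obtain x y where xy: "e = {x, y}" "x \<noteq> y" by (auto simp: card_2_iff)
        then obtain i j where ij: "i < ?n" "j < ?n" "x = cs ! i" "y = cs ! j"
          using sub by (auto simp: in_set_conv_nth)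
        have ch: "cycle_chord E cs i j" using e False xy ij by (simp add: cycle_chord_def)
        have i0: "i \<noteq> 0" using unch[of j] ch by (cases "i = 0") auto
        have j0: "j \<noteq> 0" using unch[of i] chord_sym[OF ch] by (cases "j = 0") auto
        have "e \<in> {{cs ! a, cs ! b} | a b. cycle_chord E cs a b \<and> 0 < a \<and> a < ?n \<and> 0 < b \<and> b < ?n}"
          by (intro CollectI exI[of _ i] exI[of _ j]) (use ch i0 j0 ij xy in simp)
        then have "e \<in> C.open_edges 0 ?n" unfolding C.open_edges_def by simp
        then show ?thesis by simp
      qed
    next
      assume "\<exists>x\<in>set cs. \<exists>y. y \<notin> set cs \<and> {x, y} \<in> E \<and> e \<in> hang E (set cs) y"
      then obtain x y where xy: "x \<in> set cs" "y \<notin> set cs" "{x, y} \<in> E" "e \<in> hang E (set cs) y" by blast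
      then obtain k where k: "k < ?n" "x = cs ! k" by (auto simp: in_set_conv_nth)
      have "e \<in> \<Union>{hang E (set cs) y | y. y \<notin> set cs \<and> {cs ! k, y} \<in> E}" using xy k(2) by blast
      then have eH: "e \<in> cycle_hang E cs k" using k(1) by (simp only: cycle_hang_def if_True)
      show ?thesis
      proof (cases "k = 0")
        case False
        then have "k \<in> {0<..<?n}" using k(1) by simp
        then have "e \<in> (\<Union>k\<in>{0<..<?n}. cycle_hang E cs k)" using eH by blast
        then have "e \<in> C.open_edges 0 ?n" unfolding C.open_edges_def by simp
        then show ?thesis by simp
      qed (use eH in simp)
    qed
  next
    fix e assume "e \<in> ?T \<union> ?H"
    then consider "e = {cs ! 0, cs ! (?n - 1)}" | "e \<in> C.open_edges 0 ?n" | "e \<in> ?H" by blast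
    then show "e \<in> E"
    proof cases
      case 1
      then show ?thesis using cE closing by (auto simp: cedges_def)
    next
      case 2
      then show ?thesis
      proof (cases rule: C.open_edges_cases)
        case (path k)
        then have "e \<in> cedges cs" unfolding cedges_def pedges_nth by blast
        then show ?thesis using cE by blast
      next
        case (chord a b)
        then show ?thesis by (simp add: cycle_chord_def)
      next
        case (hang k)
        then show ?thesis using cycle_hang_subset by blast
      qed
    next
      case 3
      then show ?thesis using cycle_hang_subset by blast
    qed
  qed
  moreover have "glue ?T ?H (cs ! 0)"
    unfolding glue_def
  proof
    fix v assume v: "v \<in> \<Union>?T \<inter> \<Union>?H"
    have n0: "0 < ?n" using ne by simp
    have vc: "v = cs ! 0" if "v = cs ! k" "k < ?n" for k
      using cycle_hang_cycle[OF n0, of k] v that by auto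
    have "v = cs ! 0 \<or> v = cs ! (?n - 1) \<or> v \<in> \<Union>(C.open_edges 0 ?n)" using v by auto
    then show "v \<in> {cs ! 0}"
    proof (elim disjE)
      assume "v = cs ! (?n - 1)"
      then show ?thesis using vc[of "?n - 1"] n0 by simp
    next
      assume "v \<in> \<Union>(C.open_edges 0 ?n)"
      from C.open_edges_vertices[OF this] show ?thesis
      proof (elim disjE exE conjE)
        fix k assume "k < ?n" "v = cs ! k"
        then show ?thesis using vc by simp
      next
        fix k assume k: "0 < k" "k < ?n" "v \<in> \<Union>(cycle_hang E cs k)"
        then show ?thesis using cycle_hang_disjoint[OF n0 k(2)] v by auto
      qed
    qed simp
  qed
  moreover have "good_root ?T (cs ! 0)" by (rule C.good_root_chorded_cycle[OF len unch])
  ultimately show ?thesis by (rule that)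
qed

end

text \<open>A cycle through \<open>w\<close> with the most vertices is maximal, since a cycle on a
  larger vertex set would pass through \<open>w\<close> too.\<close>

lemma maximal_cycle_exists:
  assumes fE: "finite E" "graph E" and cy: "cycle E ds" "w \<in> set ds"
  obtains cs where "maximal_cycle E cs" "w \<in> set cs"
proof -
  let ?P = "\<lambda>cs. cycle E cs \<and> w \<in> set cs"
  have "finite e" if "e \<in> E" for e
    using fE(2) that by (intro card_ge_0_finite) (simp add: graph_def)
  then have fin: "finite (\<Union>E)" using fE(1) by blast
  have sub: "set cs \<subseteq> \<Union>E" if c: "cycle E cs" for cs
  proof
    fix x assume "x \<in> set cs"
    then obtain e where "e \<in> cedges cs" "x \<in> e" using two_cedges[OF c, of x] by metis
    then show "x \<in> \<Union>E" using c by (auto simp: cycle_def)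
  qed
  have bound: "card (set cs) < Suc (card (\<Union>E))" if "?P cs" for cs
    using card_mono[OF fin sub] that by (simp add: less_Suc_eq_le)
  obtain cs where cs: "?P cs" "\<And>xs. ?P xs \<Longrightarrow> card (set xs) \<le> card (set cs)"
    using ex_has_greatest_nat[of ?P ds "\<lambda>cs. card (set cs)" "Suc (card (\<Union>E))"] cy bound by auto
  have "maximal_cycle E cs"
    unfolding maximal_cycle_def
  proof (intro conjI allI impI)
    show "cycle E cs" using cs(1) by simp
    fix xs assume xs: "cycle E xs" "set cs \<subseteq> set xs"
    then have "card (set xs) \<le> card (set cs)" using cs by auto
    then show "set xs = set cs" using card_seteq[OF finite_set xs(2)] by simp
  qed
  then show ?thesis using that cs(1) by blast
qed

lemma maximal_cycle_rotate:
  assumes "maximal_cycle E cs" "x \<in> set cs"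
  obtains ds where "maximal_cycle E (x # ds)" "set (x # ds) = set cs" "cedges (x # ds) = cedges cs"
proof -
  have "cycle E cs" using assms(1) by (simp add: maximal_cycle_def)
  from cycle_rotate[OF this assms(2)] obtain ds where
    "cycle E (x # ds)" "set (x # ds) = set cs" "cedges (x # ds) = cedges cs" .
  then show ?thesis using that[of ds] assms(1) by (simp add: maximal_cycle_def)
qed

lemma good_root_colourable: "good_root F v \<Longrightarrow> \<exists>f. valid F f"
  unfolding good_root_def by (fastforce simp: bridge_legs_def)

section \<open>A root that lies on no cycle\<close>

locale acyclic_vertex =
  fixes E :: "'a set set" and w :: 'a
  assumes so: "subcubic_outerplanar E" and cn: "connected_from E w"
    and acyclic: "\<And>cs. cycle E cs \<Longrightarrow> w \<notin> set cs"
    and IH: "\<And>(F :: 'a set set) v. subcubic_outerplanar F \<Longrightarrow> card F < card E \<Longrightarrow> connected_from F v \<Longrightarrow> degree F v \<le> 2 \<Longrightarrow> good_root F v"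
begin

lemma gE: "graph E"
  using so by (simp add: subcubic_outerplanar_def)

text \<open>A second neighbour of \<open>w\<close> in the same component would give a cycle through
  \<open>w\<close>; so each edge at \<open>w\<close> is a bridge.\<close>

lemma attach:
  assumes y: "{w, y} \<in> E" and z: "z \<in> avoid_comp E {w} y" "{w, z} \<in> E"
  shows "z = y"
proof (rule ccontr)
  assume zy: "z \<noteq> y"
  have "y \<notin> {w}" using graph_edge_neq[OF gE y] by auto
  from avoid_comp_path[OF z(1) this] obtain p where
    p: "p \<noteq> []" "hd p = y" "last p = z" "gpath E p" "set p \<inter> {w} = {}" by blast
  obtain a q where aq: "p = a # q" using p(1) by (cases p) auto
  have "q \<noteq> []" using p(2,3) zy aq by auto
  then have "2 \<le> length p" using aq by (cases q) auto
  moreover have "pedges ([w] @ p) = pedges [w] \<union> insert {last [w], hd p} (pedges p)"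
    by (rule pedges_append_ne) (use p(1) in simp_all)
  ultimately have "cycle E (w # p)"
    using p y z(2) by (auto simp: cycle_def cedges_def gpath_def insert_commute)
  then show False using acyclic by force
qed

lemma good_bridge_branch:
  assumes "{w, y} \<in> E"
  shows "good_bridge (hang E {w} y) w"
proof (rule good_bridge_hang[OF so _ _ assms _ IH])
  show "y \<notin> {w}" using graph_edge_neq[OF gE assms] by auto
  show "x' = w \<and> z = y" if "z \<in> avoid_comp E {w} y" "x' \<in> {w}" "{x', z} \<in> E" for z x'
    using attach[OF assms that(1)] that by simp
qed simp_all

lemma branch_subset: "hang E {w} y \<subseteq> E"
  by (auto simp: hang_def)

lemma branch_meet:
  assumes "{w, y} \<in> E" "{w, z} \<in> E" "y \<noteq> z"
  shows "\<Union>(hang E {w} y) \<inter> \<Union>(hang E {w} z) \<subseteq> {w}"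
proof
  fix v assume v: "v \<in> \<Union>(hang E {w} y) \<inter> \<Union>(hang E {w} z)"
  show "v \<in> {w}"
  proof (rule ccontr)
    assume nw: "v \<notin> {w}"
    have yz: "y \<notin> {w}" "z \<notin> {w}" using graph_edge_neq[OF gE] assms by auto
    have in_avoid_comp: "v \<in> avoid_comp E {w} u" if u: "v \<in> \<Union>(hang E {w} u)" "u \<notin> {w}" for u
    proof -
      obtain e where "e \<in> hang E {w} u" "v \<in> e" using u(1) by blast
      from hang_vertex[OF gE this u(2)] show ?thesis using nw by blast
    qed
    have "v \<in> avoid_comp E {w} y" "v \<in> avoid_comp E {w} z" using in_avoid_comp v yz by blast+
    then have "z \<in> avoid_comp E {w} y" using avoid_comp_trans avoid_comp_sym by metis
    then show False using attach[OF assms(1) _ assms(2)] assms(3) by blast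
  qed
qed

lemma branches: "E = (\<Union>y\<in>{y. {w, y} \<in> E}. hang E {w} y)"
proof (intro equalityI subsetI)
  fix e assume e: "e \<in> E"
  have "card e = 2" using gE e by (simp add: graph_def)
  then have "\<not> e \<subseteq> {w}" using card_mono[of "{w}" e] by auto
  moreover have "w \<in> {w}" by simp
  ultimately obtain x y where "x \<in> {w}" "{x, y} \<in> E" "e \<in> hang E {w} y"
    using edge_inside_or_hang[OF gE cn _ e, of "{w}"] by blast
  then show "e \<in> (\<Union>y\<in>{y. {w, y} \<in> E}. hang E {w} y)" by auto
qed (use branch_subset in blast)

lemma card_neighbours: "card {y. {w, y} \<in> E} = degree E w" "finite {y. {w, y} \<in> E}"
proof -
  have inj: "inj_on (\<lambda>y. {w, y}) {y. {w, y} \<in> E}" by (auto simp: inj_on_def doubleton_eq_iff)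
  have im: "(\<lambda>y. {w, y}) ` {y. {w, y} \<in> E} = {e \<in> E. w \<in> e}"
  proof (intro equalityI subsetI)
    fix e assume "e \<in> {e \<in> E. w \<in> e}"
    then have e: "e \<in> E" "w \<in> e" by auto
    obtain y where "e = {w, y}" using graph_edgeE[OF gE e] by blast
    then show "e \<in> (\<lambda>y. {w, y}) ` {y. {w, y} \<in> E}" using e by blast
  qed auto
  show "card {y. {w, y} \<in> E} = degree E w" unfolding degree_def im[symmetric] by (rule card_image[OF inj, symmetric])
  have "finite {e \<in> E. w \<in> e}" using so by (simp add: subcubic_outerplanar_def)
  then show "finite {y. {w, y} \<in> E}" using finite_imageD[OF _ inj] im by simp
qed

lemma good_root_two:
  assumes "{w, y} \<in> E" "{w, z} \<in> E" "y \<noteq> z"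
  shows "good_root (hang E {w} y \<union> hang E {w} z) w"
proof (rule good_root_fork)
  show "glue (hang E {w} y) (hang E {w} z) w" unfolding glue_def by (rule branch_meet[OF assms])
  show "graph (hang E {w} y)" by (rule graph_subset[OF gE branch_subset])
qed (use good_bridge_branch assms in simp_all)

lemma good_root_acyclic:
  assumes "degree E w \<le> 2"
  shows "good_root E w"
proof -
  let ?N = "{y. {w, y} \<in> E}"
  consider "card ?N = 0" | "card ?N = 1" | "card ?N = 2" using card_neighbours(1) assms by linarith
  then show ?thesis
  proof cases
    case 1
    then have "?N = {}" using card_neighbours(2) by simp
    then have "E = {}" using branches by (metis UN_empty)
    moreover have "good_root ({} \<union> {}) w" by (rule good_root_fork) (simp_all add: glue_def good_bridge_empty)
    ultimately show ?thesis by simp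
  next
    case 2
    then obtain y where y: "?N = {y}" by (auto simp: card_1_singleton_iff)
    then have E: "E = hang E {w} y" using branches by auto
    have "good_root (hang E {w} y \<union> {}) w"
    proof (rule good_root_fork)
      show "good_bridge (hang E {w} y) w" using good_bridge_branch y by blast
      show "graph (hang E {w} y)" by (rule graph_subset[OF gE branch_subset])
    qed (simp_all add: glue_def good_bridge_empty)
    then show ?thesis using E by simp
  next
    case 3
    then obtain y z where yz: "?N = {y, z}" "y \<noteq> z" by (auto simp: card_2_iff)
    then have E: "E = hang E {w} y \<union> hang E {w} z" using branches by auto
    have "good_root (hang E {w} y \<union> hang E {w} z) w" by (rule good_root_two) (use yz in blast)+
    then show ?thesis using E by simp
  qed
qed

lemma colourable_acyclic: "\<exists>f. valid E f"
proof (cases "degree E w \<le> 2")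
  case True
  show ?thesis by (rule good_root_colourable[OF good_root_acyclic[OF True]])
next
  case False
  let ?N = "{y. {w, y} \<in> E}"
  have "card ?N = 3" using False card_neighbours(1) so by (simp add: subcubic_outerplanar_def le_antisym)
  then obtain a b d where abd: "?N = {a, b, d}" "a \<noteq> b" "b \<noteq> d" "a \<noteq> d" by (auto simp: card_3_iff)
  have in_E: "{w, a} \<in> E" "{w, b} \<in> E" "{w, d} \<in> E" using abd(1) by blast+
  have E: "E = (hang E {w} a \<union> hang E {w} b) \<union> hang E {w} d" using branches abd(1) by auto
  \<comment> \<open>Two of the branches form a root piece, to which the third is glued.\<close>
  have "\<exists>f. valid ((hang E {w} a \<union> hang E {w} b) \<union> hang E {w} d) f"
  proof (rule good_root_bridge_colourable)
    show "glue (hang E {w} a \<union> hang E {w} b) (hang E {w} d) w"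
      unfolding glue_def using branch_meet[OF in_E(1,3) abd(4)] branch_meet[OF in_E(2,3) abd(3)] by blast
    show "graph (hang E {w} a \<union> hang E {w} b)"
      by (rule graph_subset[OF gE]) (use branch_subset in blast)
    show "good_root (hang E {w} a \<union> hang E {w} b) w" by (rule good_root_two[OF in_E(1,2) abd(2)])
    show "good_bridge (hang E {w} d) w" by (rule good_bridge_branch[OF in_E(3)])
  qed
  then show ?thesis using E by simp
qed

end

section \<open>The induction on the number of edges\<close>

lemma good_root_main:
  fixes E :: "'a set set"
  assumes "subcubic_outerplanar E" "connected_from E w" "degree E w \<le> 2"
  shows "good_root E w"
  using assms
proof (induction "card E" arbitrary: E w rule: less_induct)
  case less
  have IH: "good_root F v" if "subcubic_outerplanar F" "card F < card E" "connected_from F v" "degree F v \<le> 2" for F :: "'a set set" and v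
    by (rule less.hyps[OF that(2,1,3,4)])
  show ?case
  proof (cases "\<exists>cs. cycle E cs \<and> w \<in> set cs")
    case False
    then interpret acyclic_vertex E w using less.prems IH by unfold_locales blast+
    show ?thesis by (rule good_root_acyclic[OF less.prems(3)])
  next
    case True
    have fE: "finite E" "graph E" using less.prems by (simp_all add: subcubic_outerplanar_def)
    obtain cs0 where cs0: "maximal_cycle E cs0" "w \<in> set cs0"
      using True maximal_cycle_exists[OF fE] by blast
    obtain ds where mx: "maximal_cycle E (w # ds)"
      using maximal_cycle_rotate[OF cs0] by blast
    interpret maximal_cycle_graph E "w # ds" using less.prems(1) mx IH by unfold_locales blast+
    have w: "w \<in> set (w # ds)" by simp
    \<comment> \<open>The cycle uses up the degree of \<open>w\<close>, so neither a chord nor a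
      bridge is attached there and the cycle can be cut open at \<open>w\<close>.\<close>
    have no_third: "e \<in> cedges (w # ds)" if "e \<in> E" "w \<in> e" for e
      using third_edge_degree[OF less.prems(1) cyc w that(1) _ that(2)] less.prems(3) by blast
    have "\<not> cycle_chord E (w # ds) 0 b" for b
      using no_third[of "{w, (w # ds) ! b}"] by (auto simp: cycle_chord_def)
    from cycle_decomposition[OF less.prems(2) w this] obtain T where
      T: "E = T \<union> cycle_hang E (w # ds) 0" "good_root T w" by auto
    have "cycle_hang E (w # ds) 0 = {}"
    proof -
      have "0 < length (w # ds)" by simp
      then show ?thesis
      proof (cases rule: cycle_hang_cases)
        case (2 y)
        then show ?thesis using no_third[of "{w, y}"] outside_not_cedge[of y w] by simp
      qed
    qed
    then show ?thesis using T by simp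
  qed
qed

text \<open>The given root may have degree three. If it lies on a cycle, that cycle is cut open at a
  vertex without a chord instead, and the bridge piece at this vertex is glued on last.\<close>

lemma colourable_connected:
  fixes E :: "'a set set"
  assumes so: "subcubic_outerplanar E" and cn: "connected_from E w"
  shows "\<exists>f. valid E f"
proof (cases "\<exists>cs. cycle E cs \<and> w \<in> set cs")
  case False
  interpret acyclic_vertex E w
    by (rule acyclic_vertex.intro[OF so cn _ good_root_main]) (use False in blast)
  show ?thesis by (rule colourable_acyclic)
next
  case True
  have fE: "finite E" "graph E" using so by (simp_all add: subcubic_outerplanar_def)
  obtain cs where mx: "maximal_cycle E cs" and w: "w \<in> set cs"
    using True maximal_cycle_exists[OF fE] by blast
  interpret M: maximal_cycle_graph E cs by (rule maximal_cycle_graph.intro[OF so mx good_root_main])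
  interpret C: chorded_cycle "(!) cs" "length cs" "cycle_chord E cs" "cycle_hang E cs" by (rule M.chorded)
  obtain k where k: "k < length cs" "\<And>b. \<not> cycle_chord E cs k b"
    using C.exists_unchorded M.ne by auto
  have kin: "cs ! k \<in> set cs" using k(1) by simp
  obtain ds where mx': "maximal_cycle E (cs ! k # ds)" and ds: "set (cs ! k # ds) = set cs" "cedges (cs ! k # ds) = cedges cs"
    by (rule maximal_cycle_rotate[OF mx kin])
  let ?cs = "cs ! k # ds"
  interpret N: maximal_cycle_graph E ?cs by (rule maximal_cycle_graph.intro[OF so mx' good_root_main])
  have unch: "\<not> cycle_chord E ?cs 0 b" for b
  proof
    assume c: "cycle_chord E ?cs 0 b"
    then have "?cs ! b \<in> set ?cs" unfolding cycle_chord_def by (intro nth_mem) simp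
    then have "?cs ! b \<in> set cs" by (simp only: ds(1))
    then obtain j where j: "j < length cs" "cs ! j = ?cs ! b" by (auto simp: in_set_conv_nth)
    have "cycle_chord E cs k j" using c k(1) j unfolding cycle_chord_def ds(2) by simp
    then show False using k(2) by blast
  qed
  have w': "w \<in> set ?cs" using w by (simp only: ds(1))
  from N.cycle_decomposition[OF cn w' unch] obtain T where
    T: "E = T \<union> cycle_hang E ?cs 0" "glue T (cycle_hang E ?cs 0) (cs ! k)" "good_root T (cs ! k)" by auto
  have "graph T" by (rule graph_subset[OF fE(2)]) (use T(1) in blast)
  moreover have "good_bridge (cycle_hang E ?cs 0) (cs ! k)" using N.good_bridge_cycle_hang[of 0] by simp
  ultimately have "\<exists>f. valid (T \<union> cycle_hang E ?cs 0) f"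
    by (rule good_root_bridge_colourable[OF T(2) _ T(3)])
  then show ?thesis using T(1) by simp
qed

lemma colourable:
  fixes E :: "'a set set"
  assumes "subcubic_outerplanar E"
  shows "\<exists>f. valid E f"
  using assms
proof (induction "card E" arbitrary: E rule: less_induct)
  case less
  have E: "finite E" "graph E" using less.prems by (simp_all add: subcubic_outerplanar_def)
  show ?case
  proof (cases "E = {}")
    case False
    then obtain e0 where e0: "e0 \<in> E" by blast
    then have "card e0 = 2" using E(2) by (simp add: graph_def)
    then obtain w where w: "w \<in> e0" by fastforce
    define C where "C = {e \<in> E. \<exists>v\<in>e. (w, v) \<in> (adj E)\<^sup>*}"
    define R where "R = E - C"
    have CE: "C \<subseteq> E" and RE: "R \<subseteq> E" and un: "E = C \<union> R" by (auto simp: C_def R_def)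
    have e0C: "e0 \<in> C" using e0 w by (auto simp: C_def)
    have reach: "(w, v) \<in> (adj E)\<^sup>*" if v: "v \<in> \<Union>C" for v
    proof -
      obtain e u where e: "e \<in> E" "v \<in> e" "u \<in> e" "(w, u) \<in> (adj E)\<^sup>*" using v by (auto simp: C_def)
      show ?thesis
      proof (cases "u = v")
        case False
        then have "{u, v} \<in> E" using graph_edgeE[OF E(2) e(1,3)] e by auto
        then show ?thesis using e(4) by (auto simp: adj_def intro: rtrancl_into_rtrancl)
      qed (use e in simp)
    qed
    have disj: "\<Union>C \<inter> \<Union>R = {}"
    proof (rule ccontr)
      assume "\<Union>C \<inter> \<Union>R \<noteq> {}"
      then obtain v e where v: "v \<in> \<Union>C" "e \<in> R" "v \<in> e" by blast
      then have "e \<in> C" using reach[OF v(1)] RE by (auto simp: C_def)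
      then show False using v(2) by (simp add: R_def)
    qed
    have adjC: "(w, v) \<in> (adj C)\<^sup>*" if "(w, v) \<in> (adj E)\<^sup>*" for v
      using that
    proof induction
      case (step a b)
      then have "{a, b} \<in> C" by (auto simp: adj_def C_def)
      then show ?case using step.IH by (auto simp: adj_def intro: rtrancl_into_rtrancl)
    qed simp
    have cn: "connected_from C w"
      unfolding connected_from_def
    proof
      fix e assume "e \<in> C"
      then obtain v where "v \<in> e" "(w, v) \<in> (adj E)\<^sup>*" by (auto simp: C_def)
      then show "\<exists>v\<in>e. (w, v) \<in> (adj C)\<^sup>*" using adjC by blast
    qed
    obtain f1 where f1: "valid C f1"
      using colourable_connected[OF subcubic_outerplanar_subset[OF less.prems CE] cn] by blast
    have "e0 \<notin> R" using e0C by (simp add: R_def)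
    then have "R \<subset> E" using RE e0 by blast
    then obtain f2 where f2: "valid R f2"
      using less.hyps[OF psubset_card_mono[OF E(1)] subcubic_outerplanar_subset[OF less.prems RE]] by blast
    have wR: "w \<notin> \<Union>R" using disj e0C w by blast
    have none: "cols R f2 n w = {}" for n
    proof (rule ccontr)
      assume "cols R f2 n w \<noteq> {}"
      then obtain e x where x: "e \<in> R" "x \<in> e" "x \<in> vball R n w" by (auto simp: cols_def)
      have "w = x \<or> w \<in> \<Union>R" by (rule vball_support[OF vball_sym[OF x(3)]])
      then show False using wR x by blast
    qed
    \<comment> \<open>Gluing at \<open>w\<close> is vacuous here: even the trivial bounds for
      \<open>C\<close> are compatible with the empty ones for \<open>R\<close>, whose edges are out
      of reach of \<open>w\<close>.\<close>
    have iC: "info C f1 w UNIV UNIV True" by (simp add: info_def)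
    have iR: "info R f2 w {} {} False" by (simp add: info_def none)
    have g: "glue C R w" using disj by (simp add: glue_def)
    obtain f where "valid (C \<union> R) f" "\<forall>e\<in>C. f e = f1 e" "\<forall>e\<in>R. f e = f2 e"
      by (rule glue_colouring[OF g graph_subset[OF E(2) CE] f1 f2 iC iR]) (simp add: compat_def)
    then show ?thesis using un by auto
  next
    case True
    then show ?thesis by (intro exI[of _ undefined]) simp
  qed
qed

section \<open>From distances of vertices to distances of edges\<close>

lemma line_walk_vball:
  assumes gE: "graph E" and "(e, e') \<in> line_graph E ^^ Suc n"
  shows "\<exists>x\<in>e. \<exists>y\<in>e'. y \<in> vball E n x"
  using assms(2)
proof (induction n arbitrary: e')
  case 0
  then show ?case by (auto simp: line_graph_def)
next
  case (Suc n)
  then obtain d where d: "(e, d) \<in> line_graph E ^^ Suc n" "(d, e') \<in> line_graph E"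
    unfolding relpow.simps(2)[of "Suc n"] by blast
  obtain x y where xy: "x \<in> e" "y \<in> d" "y \<in> vball E n x" using Suc.IH[OF d(1)] by blast
  obtain z where z: "z \<in> d" "z \<in> e'" and dE: "d \<in> E" using d(2) by (auto simp: line_graph_def)
  have "z \<in> vball E (Suc n) x"
  proof (cases "z = y")
    case True
    then show ?thesis using vball_le[of n "Suc n" y E x] xy(3) by simp
  next
    case False
    then have "{y, z} \<in> E" using graph_edgeE[OF gE dE xy(2)] z(1) dE by auto
    then show ?thesis using xy(3) by auto
  qed
  then show ?case using xy(1) z(2) by blast
qed

text \<open>A walk of length \<open>m + 1\<close> in the line graph gives ends at distance at most
  \<open>m\<close>. Validity makes \<open>m\<close> exceed the radius, hence the summand 2.\<close>

lemma valid_edge_dist: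
  assumes gE: "graph E" and v: "valid E f" and e: "e \<in> E" "e' \<in> E" "e \<noteq> e'" "f e = f e'"
  shows "enat (radius (f e) + 2) \<le> edge_dist E e e'"
  unfolding edge_dist_def graph_dist_def
proof (rule INF_greatest)
  fix n assume "n \<in> {n. (e, e') \<in> line_graph E ^^ n}"
  then have n: "(e, e') \<in> line_graph E ^^ n" by simp
  then obtain m where m: "n = Suc m" using e(3) by (cases n) auto
  obtain x y where xy: "x \<in> e" "y \<in> e'" "y \<in> vball E m x" using line_walk_vball[OF gE n[unfolded m]] by blast
  have "\<not> m \<le> radius (f e)"
  proof
    assume "m \<le> radius (f e)"
    from vball_le[OF this xy(3)] show False
      using v[unfolded valid_def, rule_format, OF e(1,2) xy(1,2) e(3,4)] by simp
  qed
  then show "enat (radius (f e) + 2) \<le> enat n" using m by simp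
qed

theorem theorem3p1:
  fixes V :: "'a set" and E :: "'a set set"
  assumes "simple_graph V E"
    and "subcubic V E"
    and "outerplanar V E"
  shows "packing_edge_colorable E [1, 1, 2, 2, 3]"
proof -
  have EV: "finite V" "\<And>e. e \<in> E \<Longrightarrow> e \<subseteq> V \<and> card e = 2" using assms(1) by (auto simp: simple_graph_def)
  have gE: "graph E" using EV(2) by (simp add: graph_def)
  have "E \<subseteq> Pow V" using EV(2) by blast
  then have "finite E" using EV(1) by (meson finite_Pow_iff finite_subset)
  moreover have "degree E v \<le> 3" for v
  proof (cases "v \<in> V")
    case True
    then show ?thesis using assms(2) by (simp add: subcubic_def)
  next
    case False
    then have "{e \<in> E. v \<in> e} = {}" using EV(2) by blast
    then show ?thesis unfolding degree_def by (simp only: card.empty)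
  qed
  ultimately have "subcubic_outerplanar E"
    using gE outerplanar_theta_crossing_free[OF assms(1,3)] by (simp add: subcubic_outerplanar_def)
  then obtain f where f: "valid E f" using colourable by blast
  \<comment> \<open>The radii 0, 0, 1, 1, 2 are the entries of the sequence minus one, so
    \<open>radius + 2\<close> is the edge distance demanded of the class.\<close>
  define cs where "cs = [X0, X1, X2, X3, X4]"
  let ?C = "\<lambda>i. {e \<in> E. f e = cs ! i}"
  have lt5: "i < 5 \<longleftrightarrow> i = 0 \<or> i = 1 \<or> i = 2 \<or> i = 3 \<or> i = 4" for i :: nat by auto
  have "packing_edge_coloring E [1, 1, 2, 2, 3] ?C"
    unfolding packing_edge_coloring_def
  proof (intro conjI allI ballI impI)
    show "(\<Union>i<length [1, 1, 2, 2, 3 :: nat]. ?C i) = E"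
    proof (intro equalityI subsetI)
      fix e assume e: "e \<in> E"
      have "\<exists>i<5. f e = cs ! i"
        by (cases "f e") (auto simp: cs_def lt5)
      then show "e \<in> (\<Union>i<length [1, 1, 2, 2, 3 :: nat]. ?C i)" using e by auto
    qed auto
    have "i = j" if "i < 5" "j < 5" "cs ! i = cs ! j" for i j
      using that unfolding cs_def lt5 by (elim disjE) simp_all
    then show "disjoint_family_on ?C {..<length [1, 1, 2, 2, 3 :: nat]}"
      by (auto simp: disjoint_family_on_def)
    fix i e e' assume i: "i < length [1, 1, 2, 2, 3 :: nat]" and e: "e \<in> ?C i" "e' \<in> ?C i" "e \<noteq> e'"
    have "[1, 1, 2, 2, 3] ! i + 1 = radius (f e) + 2"
    proof -
      have "i = 0 \<or> i = 1 \<or> i = 2 \<or> i = 3 \<or> i = 4" using i by auto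
      then show ?thesis using e(1) unfolding cs_def by (elim disjE) simp_all
    qed
    then show "enat ([1, 1, 2, 2, 3] ! i + 1) \<le> edge_dist E e e'"
      using valid_edge_dist[OF gE f, of e e'] e by auto
  qed
  then show ?thesis unfolding packing_edge_colorable_def by blast
qed

end
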